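(* Every free metabelian group of finite rank is LERF. That is, for every integer $n\ge 0$, if $F_n$ is the free group of rank $n$ and $F_n''$ is its second derived subgroup, then $F_n/F_n''$ is LERF.
   Context: The profinite topology on a group $\Gamma$ is the topology having the cosets of finite-index subgroups as a basis. A subgroup $S$ of $\Gamma$ is called separable if it is closed in the profinite topology of $\Gamma$. A finitely generated group is LERF if all of its finitely generated subgroups are separable. *)

theory Defs
  imports "HOL-Algebra.Generated_Groups" "HOL-Analysis.Abstract_Topology"
begin

text \<open>
  A word over the alphabet \<open>X\<close> is a list of letters \<open>(x, True)\<close>, standing for \<open>x\<close>, and
  \<open>(x, False)\<close>, standing for the formal inverse of \<open>x\<close>.
\<close>

definition words :: "'a set \<Rightarrow> ('a \<times> bool) list set" where
  "words X = lists (X \<times> UNIV)"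

inductive_set word_eq :: "'a set \<Rightarrow> (('a \<times> bool) list \<times> ('a \<times> bool) list) set"
  for X where
  refl: "w \<in> words X \<Longrightarrow> (w, w) \<in> word_eq X"
| sym: "(v, w) \<in> word_eq X \<Longrightarrow> (w, v) \<in> word_eq X"
| trans: "(u, v) \<in> word_eq X \<Longrightarrow> (v, w) \<in> word_eq X \<Longrightarrow> (u, w) \<in> word_eq X"
| cancel: "u \<in> words X \<Longrightarrow> v \<in> words X \<Longrightarrow> x \<in> X \<Longrightarrow>
    (u @ [(x, b), (x, \<not> b)] @ v, u @ v) \<in> word_eq X"

definition free_group :: "'a set \<Rightarrow> ('a \<times> bool) list set monoid" where
  "free_group X =
    \<lparr>carrier = words X // word_eq X,
     mult = \<lambda>A B. \<Union>u\<in>A. \<Union>v\<in>B. word_eq X `` {u @ v},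
     one = word_eq X `` {[]}\<rparr>"

lemma words_append [simp]: "u @ v \<in> words X \<longleftrightarrow> u \<in> words X \<and> v \<in> words X"
  by (auto simp: words_def)

lemma words_Nil [simp]: "[] \<in> words X"
  by (simp add: words_def)

lemma words_Cons [simp]: "a # w \<in> words X \<longleftrightarrow> fst a \<in> X \<and> w \<in> words X"
  by (cases a) (auto simp: words_def)

lemma word_eq_in_words: "(v, w) \<in> word_eq X \<Longrightarrow> v \<in> words X \<and> w \<in> words X"
  by (induction rule: word_eq.induct) auto

lemma equiv_word_eq: "equiv (words X) (word_eq X)"
proof (rule equivI)
  show "word_eq X \<subseteq> words X \<times> words X"
    using word_eq_in_words by fast
  show "refl_on (words X) (word_eq X)"
    by (rule refl_onI) (rule word_eq.refl)
  show "Relation.sym (word_eq X)"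
    by (rule symI) (rule word_eq.sym)
  show "Relation.trans (word_eq X)"
    by (rule transI) (rule word_eq.trans)
qed

lemma word_eq_append_left:
  assumes "(v, w) \<in> word_eq X" "u \<in> words X"
  shows "(u @ v, u @ w) \<in> word_eq X"
  using assms
proof (induction rule: word_eq.induct)
  case (cancel p q x b)
  then show ?case using word_eq.cancel[of "u @ p" X q x b] by simp
next
  case (refl w)
  then show ?case by (simp add: word_eq.refl)
next
  case (sym v w)
  then show ?case by (blast intro: word_eq.sym)
next
  case (trans p v w)
  show ?case by (rule word_eq.trans[OF trans.IH(1)[OF trans.prems] trans.IH(2)[OF trans.prems]])
qed

lemma word_eq_append_right:
  assumes "(v, w) \<in> word_eq X" "u \<in> words X"
  shows "(v @ u, w @ u) \<in> word_eq X"
  using assms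
proof (induction rule: word_eq.induct)
  case (cancel p q x b)
  then show ?case using word_eq.cancel[of p X "q @ u" x b] by simp
next
  case (refl w)
  then show ?case by (simp add: word_eq.refl)
next
  case (sym v w)
  then show ?case by (blast intro: word_eq.sym)
next
  case (trans p v w)
  show ?case by (rule word_eq.trans[OF trans.IH(1)[OF trans.prems] trans.IH(2)[OF trans.prems]])
qed

lemma word_eq_append:
  assumes "(u, u') \<in> word_eq X" "(v, v') \<in> word_eq X"
  shows "(u @ v, u' @ v') \<in> word_eq X"
proof (rule word_eq.trans)
  show "(u @ v, u' @ v) \<in> word_eq X"
    using assms word_eq_in_words[OF assms(2)] by (intro word_eq_append_right) auto
  show "(u' @ v, u' @ v') \<in> word_eq X"
    using assms word_eq_in_words[OF assms(1)] by (intro word_eq_append_left) auto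
qed

lemma free_group_mult_class:
  assumes "u \<in> words X" "v \<in> words X"
  shows "word_eq X `` {u} \<otimes>\<^bsub>free_group X\<^esub> word_eq X `` {v} = word_eq X `` {u @ v}"
proof -
  have eq: "word_eq X `` {p @ q} = word_eq X `` {u @ v}"
    if "p \<in> word_eq X `` {u}" "q \<in> word_eq X `` {v}" for p q
    using equiv_class_eq[OF equiv_word_eq word_eq_append[of u p X v q]] that by simp
  have self: "u \<in> word_eq X `` {u}" "v \<in> word_eq X `` {v}"
    using assms by (auto intro: word_eq.refl)
  have "(\<Union>p\<in>word_eq X `` {u}. \<Union>q\<in>word_eq X `` {v}. word_eq X `` {p @ q})
      = (\<Union>p\<in>word_eq X `` {u}. \<Union>q\<in>word_eq X `` {v}. word_eq X `` {u @ v})"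
    by (intro SUP_cong HOL.refl eq)
  also have "\<dots> = word_eq X `` {u @ v}"
    using self by blast
  finally show ?thesis
    by (simp add: free_group_def)
qed

lemma free_group_one: "\<one>\<^bsub>free_group X\<^esub> = word_eq X `` {[]}"
  by (simp add: free_group_def)

lemma free_group_carrierE:
  assumes "A \<in> carrier (free_group X)"
  obtains w where "w \<in> words X" "A = word_eq X `` {w}"
  using assms by (auto simp: free_group_def elim: quotientE)

lemma free_group_carrierI: "w \<in> words X \<Longrightarrow> word_eq X `` {w} \<in> carrier (free_group X)"
  by (simp add: free_group_def quotientI)

lemma word_eq_inverse:
  assumes "w \<in> words X"
  shows "(rev (map (\<lambda>(x, b). (x, \<not> b)) w) @ w, []) \<in> word_eq X
    \<and> rev (map (\<lambda>(x, b). (x, \<not> b)) w) \<in> words X"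
  using assms
proof (induction w)
  case Nil
  then show ?case by (auto intro: word_eq.refl)
next
  case (Cons a w)
  obtain x b where a: "a = (x, b)" by (cases a)
  let ?r = "rev (map (\<lambda>(x, b). (x, \<not> b)) w)"
  from Cons a have *: "x \<in> X" "w \<in> words X" "?r \<in> words X" "(?r @ w, []) \<in> word_eq X"
    by auto
  have "(?r @ [(x, \<not> b), (x, \<not> \<not> b)] @ w, ?r @ w) \<in> word_eq X"
    using * by (intro word_eq.cancel) auto
  from word_eq.trans[OF this *(4)] * a show ?case by auto
qed

lemma group_free_group: "group (free_group X)"
proof (rule groupI)
  fix A assume "A \<in> carrier (free_group X)"
  then obtain w where w: "w \<in> words X" "A = word_eq X `` {w}"
    by (rule free_group_carrierE)
  define v where "v = rev (map (\<lambda>(x, b). (x, \<not> b)) w)"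
  have v: "v \<in> words X" "(v @ w, []) \<in> word_eq X"
    using word_eq_inverse[OF w(1)] by (auto simp: v_def)
  show "\<exists>B\<in>carrier (free_group X). B \<otimes>\<^bsub>free_group X\<^esub> A = \<one>\<^bsub>free_group X\<^esub>"
    using v w equiv_class_eq[OF equiv_word_eq v(2)]
    by (intro bexI[of _ "word_eq X `` {v}"])
       (auto simp: free_group_mult_class free_group_one free_group_carrierI)
qed (auto elim!: free_group_carrierE
    simp: free_group_mult_class free_group_one free_group_carrierI)

text \<open>Uniqueness of the extension \<open>h\<close> follows from \<open>free_group_generated\<close> below.\<close>

lemma free_group_universal:
  assumes H: "group H" and f: "f \<in> X \<rightarrow> carrier H"
  shows "\<exists>h \<in> hom (free_group X) H. \<forall>x\<in>X. h (word_eq X `` {[(x, True)]}) = f x"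
proof -
  interpret H: group H by (rule H)
  define l where "l = (\<lambda>(x, b). if b then f x else inv\<^bsub>H\<^esub> f x)"
  define e where "e = (\<lambda>w. foldr (\<lambda>a y. l a \<otimes>\<^bsub>H\<^esub> y) w \<one>\<^bsub>H\<^esub>)"
  have l: "l a \<in> carrier H" if "fst a \<in> X" for a
    using that f by (auto simp: l_def split: prod.splits)
  have e_Nil: "e [] = \<one>\<^bsub>H\<^esub>" and e_Cons: "e (a # w) = l a \<otimes>\<^bsub>H\<^esub> e w" for a w
    by (simp_all add: e_def)
  have e_in: "e w \<in> carrier H" if "w \<in> words X" for w
    using that by (induction w) (auto simp: e_Nil e_Cons l)
  have e_app: "e (u @ v) = e u \<otimes>\<^bsub>H\<^esub> e v" if "u \<in> words X" "v \<in> words X" for u v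
    using that by (induction u) (auto simp: e_Nil e_Cons l e_in H.m_assoc)
  have e_eq: "e v = e w" if "(v, w) \<in> word_eq X" for v w
    using that
  proof (induction rule: word_eq.induct)
    case (cancel u v x b)
    have "f x \<in> carrier H" using f cancel(3) by (rule funcset_mem)
    then have "e [(x, b), (x, \<not> b)] = \<one>\<^bsub>H\<^esub>"
      by (cases b) (auto simp: e_Cons e_Nil l_def)
    then have "e ([(x, b), (x, \<not> b)] @ v) = e v"
      using cancel e_app[of "[(x, b), (x, \<not> b)]" v] e_in[of v] by (simp del: append_Cons append_Nil)
    then show ?case
      using cancel e_app[of u "[(x, b), (x, \<not> b)] @ v"] e_app[of u v]
      by (simp del: append_Cons append_Nil)
  qed (simp_all only:)
  define h where "h = (\<lambda>A. e (SOME w. w \<in> A))"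
  have h: "h (word_eq X `` {w}) = e w" if "w \<in> words X" for w
  proof -
    have "(SOME v. v \<in> word_eq X `` {w}) \<in> word_eq X `` {w}"
      by (rule someI[of "\<lambda>v. v \<in> word_eq X `` {w}" w])
        (use that in \<open>auto intro: word_eq.refl\<close>)
    then have "e w = h (word_eq X `` {w})"
      unfolding h_def by (intro e_eq) simp
    then show ?thesis by simp
  qed
  have "h \<in> hom (free_group X) H"
  proof (rule homI)
    fix A assume "A \<in> carrier (free_group X)"
    then obtain u where u: "u \<in> words X" "A = word_eq X `` {u}"
      by (rule free_group_carrierE)
    then show "h A \<in> carrier H"
      by (simp add: h e_in)
    fix B assume "B \<in> carrier (free_group X)"
    then obtain v where "v \<in> words X" "B = word_eq X `` {v}"
      by (rule free_group_carrierE)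
    with u show "h (A \<otimes>\<^bsub>free_group X\<^esub> B) = h A \<otimes>\<^bsub>H\<^esub> h B"
      by (simp add: h e_app free_group_mult_class)
  qed
  moreover have "h (word_eq X `` {[(x, True)]}) = f x" if "x \<in> X" for x
    using that funcset_mem[OF f that] by (simp add: h e_Cons e_Nil l_def)
  ultimately show ?thesis by blast
qed

lemma free_group_generated:
  "carrier (free_group X) =
    generate (free_group X) ((\<lambda>x. word_eq X `` {[(x, True)]}) ` X)" (is "_ = generate _ ?S")
proof
  interpret F: group "free_group X" by (rule group_free_group)
  have S: "?S \<subseteq> carrier (free_group X)" by (auto intro: free_group_carrierI)
  then show "generate (free_group X) ?S \<subseteq> carrier (free_group X)"
    by (rule F.generate_incl)
  have letter: "word_eq X `` {[(x, b)]} \<in> generate (free_group X) ?S" if x: "x \<in> X" for x b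
  proof (cases b)
    case True
    with x show ?thesis by (auto intro: generate.incl)
  next
    case False
    have "([(x, False), (x, True)], []) \<in> word_eq X"
      using word_eq.cancel[of "[]" X "[]" x False] x by simp
    from equiv_class_eq[OF equiv_word_eq this]
    have "inv\<^bsub>free_group X\<^esub> (word_eq X `` {[(x, True)]}) = word_eq X `` {[(x, False)]}"
      using x by (intro F.inv_equality)
        (auto simp: free_group_mult_class free_group_one free_group_carrierI)
    moreover have "inv\<^bsub>free_group X\<^esub> (word_eq X `` {[(x, True)]})
        \<in> generate (free_group X) ?S"
      using x by (intro generate.inv) auto
    ultimately show ?thesis
      using False by simp
  qed
  have "word_eq X `` {w} \<in> generate (free_group X) ?S" if "w \<in> words X" for w
    using that
  proof (induction w)
    case Nil
    then show ?case using generate.one[of "free_group X"] by (simp add: free_group_one)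
  next
    case (Cons a w)
    then have "word_eq X `` {[a]} \<otimes>\<^bsub>free_group X\<^esub> word_eq X `` {w} \<in> generate (free_group X) ?S"
      using letter[of "fst a" "snd a"] by (intro generate.eng) auto
    with Cons show ?case by (simp add: free_group_mult_class)
  qed
  then show "carrier (free_group X) \<subseteq> generate (free_group X) ?S"
    by (auto elim!: free_group_carrierE)
qed

text \<open>
  Right cosets suffice: the left coset \<open>g H\<close> is the right coset \<open>(g H g\<^sup>-\<^sup>1) g\<close> of a subgroup of
  the same index. The cosets are given to \<open>topology_generated_by\<close> as a subbasis; they are in
  fact a basis, as shown in \<open>openin_profinite_topology\<close>.
\<close>

definition finite_index_subgroup :: "'a set \<Rightarrow> ('a, 'b) monoid_scheme \<Rightarrow> bool" where
  "finite_index_subgroup H G \<longleftrightarrow> subgroup H G \<and> finite (rcosets\<^bsub>G\<^esub> H)"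

definition finite_index_cosets :: "('a, 'b) monoid_scheme \<Rightarrow> 'a set set" where
  "finite_index_cosets G = (\<Union>H \<in> {H. finite_index_subgroup H G}. rcosets\<^bsub>G\<^esub> H)"

definition profinite_topology :: "('a, 'b) monoid_scheme \<Rightarrow> 'a topology" where
  "profinite_topology G = topology_generated_by (finite_index_cosets G)"

lemma (in group) finite_index_subgroup_Int:
  assumes "finite_index_subgroup H G" "finite_index_subgroup K G"
  shows "finite_index_subgroup (H \<inter> K) G"
proof -
  have H: "subgroup H G" "finite (rcosets H)" and K: "subgroup K G" "finite (rcosets K)"
    using assms by (auto simp: finite_index_subgroup_def)
  have HK: "subgroup (H \<inter> K) G"
    by (rule subgroups_Inter_pair[OF H(1) K(1)])
  have "rcosets (H \<inter> K) \<subseteq> (\<lambda>(A, B). A \<inter> B) ` ((rcosets H) \<times> (rcosets K))"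
  proof
    fix C assume "C \<in> rcosets (H \<inter> K)"
    then obtain a where a: "a \<in> carrier G" "C = (H \<inter> K) #> a"
      by (auto simp: RCOSETS_def)
    have "(H \<inter> K) #> a = (H #> a) \<inter> (K #> a)"
    proof (intro equalityI subsetI)
      fix y assume "y \<in> (H #> a) \<inter> (K #> a)"
      then obtain h k where hk: "h \<in> H" "k \<in> K" "y = h \<otimes> a" "y = k \<otimes> a"
        by (auto simp: r_coset_def)
      then have "h = k"
        using a(1) subgroup.mem_carrier[OF H(1)] subgroup.mem_carrier[OF K(1)]
          right_cancel[of a h k] by auto
      with hk show "y \<in> (H \<inter> K) #> a"
        by (auto simp: r_coset_def)
    qed (auto simp: r_coset_def)
    with a show "C \<in> (\<lambda>(A, B). A \<inter> B) ` ((rcosets H) \<times> (rcosets K))"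
      by (auto simp: RCOSETS_def)
  qed
  with H K HK show ?thesis
    by (auto simp: finite_index_subgroup_def intro: finite_subset)
qed

lemma (in group) finite_index_cosets_basis:
  assumes "A \<in> finite_index_cosets G" "B \<in> finite_index_cosets G" "x \<in> A \<inter> B"
  shows "\<exists>C \<in> finite_index_cosets G. x \<in> C \<and> C \<subseteq> A \<inter> B"
proof -
  obtain H K where H: "finite_index_subgroup H G" "A \<in> rcosets H"
    and K: "finite_index_subgroup K G" "B \<in> rcosets K"
    using assms by (auto simp: finite_index_cosets_def)
  have sub: "subgroup H G" "subgroup K G"
    using H K by (auto simp: finite_index_subgroup_def)
  have x: "x \<in> carrier G"
    using rcosets_part_G[OF sub(1)] H assms by auto
  have "A = H #> x" "B = K #> x"
    using assms(3) H(2) K(2) repr_independence[OF _ _ sub(1)] repr_independence[OF _ _ sub(2)]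
    by (auto simp: RCOSETS_def)
  moreover have "subgroup (H \<inter> K) G"
    by (rule subgroups_Inter_pair[OF sub])
  then have "x \<in> (H \<inter> K) #> x"
    by (rule rcos_self[OF x])
  moreover have "(H \<inter> K) #> x \<in> finite_index_cosets G"
    using finite_index_subgroup_Int[OF H(1) K(1)] x
    by (auto simp: finite_index_cosets_def RCOSETS_def)
  ultimately show ?thesis
    by (intro bexI[of _ "(H \<inter> K) #> x"]) (auto simp: r_coset_def)
qed

lemma (in group) openin_profinite_topology:
  "openin (profinite_topology G) = arbitrary union_of (\<lambda>U. U \<in> finite_index_cosets G)"
proof -
  have "\<exists>V. V \<in> finite_index_cosets G \<and> x \<in> V \<and> V \<subseteq> U"
    if "generate_topology_on (finite_index_cosets G) U" "x \<in> U" for U x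
    using that
  proof (induction arbitrary: x rule: generate_topology_on.induct)
    case (Int A B)
    then obtain C D where "C \<in> finite_index_cosets G" "x \<in> C" "C \<subseteq> A"
      "D \<in> finite_index_cosets G" "x \<in> D" "D \<subseteq> B" by (metis IntE)
    then show ?case
      using finite_index_cosets_basis[of C D x] by blast
  qed blast+
  then show ?thesis
    unfolding openin_topology_base_unique profinite_topology_def
    by (auto simp: openin_topology_generated_by_iff intro: generate_topology_on.Basis)
qed

lemma (in group) topspace_profinite_topology: "topspace (profinite_topology G) = carrier G"
proof -
  have R: "rcosets (carrier G) = {carrier G}"
    using coset_join2[OF _ subgroup_self] by (auto simp: RCOSETS_def)
  then have "finite_index_subgroup (carrier G) G"
    by (simp add: finite_index_subgroup_def subgroup_self)
  with R have "carrier G \<in> finite_index_cosets G"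
    unfolding finite_index_cosets_def by blast
  moreover have "\<Union> (finite_index_cosets G) \<subseteq> carrier G"
    using rcosets_part_G by (auto simp: finite_index_cosets_def finite_index_subgroup_def)
  ultimately show ?thesis
    unfolding profinite_topology_def by auto
qed

definition separable :: "'a set \<Rightarrow> ('a, 'b) monoid_scheme \<Rightarrow> bool" where
  "separable S G \<longleftrightarrow> subgroup S G \<and> closedin (profinite_topology G) S"

definition fg_subgroup :: "'a set \<Rightarrow> ('a, 'b) monoid_scheme \<Rightarrow> bool" where
  "fg_subgroup S G \<longleftrightarrow> (\<exists>A. finite A \<and> A \<subseteq> carrier G \<and> S = generate G A)"

definition LERF :: "('a, 'b) monoid_scheme \<Rightarrow> bool" where
  "LERF G \<longleftrightarrow> group G \<and> fg_subgroup (carrier G) G \<and> (\<forall>S. fg_subgroup S G \<longrightarrow> separable S G)"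

end

theory Submission
  imports "HOL-Computational_Algebra.Polynomial" "HOL-Computational_Algebra.Primes"
    "HOL-Library.Function_Algebras" "HOL-Library.Poly_Mapping" "HOL-Algebra.Free_Abelian_Groups" Defs
begin

text \<open>
  The Magnus embedding identifies \<open>F/F''\<close> with a subgroup of the wreath product \<open>M \<rtimes> Q\<close>, where
  \<open>Q = \<int>\<^sup>X\<close> and \<open>M = \<int>[Q]\<^sup>X\<close>. Let \<open>S\<close> be a finitely generated subgroup with image \<open>P\<close> in \<open>Q\<close>.
  If \<open>g\<close> lies over an element of \<open>P\<close>, one may assume that \<open>g = m \<in> M\<close>, and \<open>m\<close> has to be separated
  from the \<open>\<int>[P]\<close>-submodule \<open>K = S \<inter> M\<close>. Both are supported on finitely many cosets of \<open>P\<close>, so they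
  stay apart in \<open>\<int>[Q/R]\<^sup>X\<close> for some \<open>R\<close> with \<open>P \<inter> R = 0\<close> and \<open>P + R\<close> of finite index. This is a
  finitely generated \<open>\<int>[P]\<close>-module, and such modules are residually finite by a theorem of P. Hall.
\<close>

text \<open>A finite-index submodule \<open>L\<close> that separates \<open>m\<close> from
  \<open>K\<close> does not yet separate \<open>m\<close> from \<open>S\<close>. It is invariant
  under \<open>P\<close> only, so it is shrunk to a \<open>Q\<close>-invariant \<open>L0\<close> of
  finite index. Moreover an element \<open>h\<close> of a finite-index subgroup may move in
  \<open>Q\<close>, and then \<open>h m \<in> S\<close> does not place anything in \<open>K\<close>.
  So \<open>\<pi> h\<close> is confined to a finite-index subgroup of \<open>Q\<close> that acts
  trivially modulo \<open>L0\<close> and meets \<open>P\<close> only in images of elements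
  \<open>s \<in> S\<close> whose \<open>M\<close>-component lies in \<open>L0\<close>. Multiplying
  by the inverse of such an \<open>s\<close> brings \<open>h m\<close> into \<open>K\<close>, and
  \<open>m \<in> L\<close> would follow. P. Hall's theorem rests on the fact that a field which is
  finitely generated as a ring is finite. This is proved in the manner of Zariski's lemma: the field
  property descends through the generators to the integers, and finiteness climbs back up. Quotients
  of modules and rings are expressed as congruences inside one fixed type, so ideals, degrees and
  finiteness are all read modulo a submodule.\<close>

section \<open>Submodules and the ascending chain condition\<close>

text \<open>\<open>T\<close> is only a set of scalars: for \<open>T = {}\<close> these are the
  additive subgroups, in general the submodules over the ring generated by \<open>T\<close>.\<close>

definition submod :: "('r \<Rightarrow> 'v \<Rightarrow> 'v) \<Rightarrow> 'r set \<Rightarrow> 'v::ab_group_add set \<Rightarrow> bool" where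
  "submod scale T K \<longleftrightarrow>
    0 \<in> K \<and> (\<forall>x\<in>K. \<forall>y\<in>K. x - y \<in> K) \<and> (\<forall>t\<in>T. \<forall>x\<in>K. scale t x \<in> K)"

text \<open>For a subgroup \<open>K\<close> this is finiteness of the image of \<open>W\<close> in
  the quotient by \<open>K\<close>. \<open>K\<close> need not lie in \<open>W\<close>.\<close>

definition fin_mod :: "'v::ab_group_add set \<Rightarrow> 'v set \<Rightarrow> bool" where
  "fin_mod W K \<longleftrightarrow> (\<exists>Z. finite Z \<and> (\<forall>w\<in>W. \<exists>z\<in>Z. w - z \<in> K))"

text \<open>The chains live in the ambient module and are compared only inside \<open>W\<close>,
  which spares a type for \<open>W\<close>.\<close>

definition noeth :: "('r \<Rightarrow> 'v \<Rightarrow> 'v) \<Rightarrow> 'r set \<Rightarrow> 'v::ab_group_add set \<Rightarrow> bool" where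
  "noeth scale T W \<longleftrightarrow> (\<forall>L. (\<forall>n::nat. submod scale T (L n)) \<longrightarrow> (\<forall>n. L n \<subseteq> L (Suc n)) \<longrightarrow>
    (\<exists>N. \<forall>n\<ge>N. L n \<inter> W = L N \<inter> W))"

lemma submodI:
  assumes "0 \<in> K" "\<And>x y. x \<in> K \<Longrightarrow> y \<in> K \<Longrightarrow> x - y \<in> K"
    "\<And>t x. t \<in> T \<Longrightarrow> x \<in> K \<Longrightarrow> scale t x \<in> K"
  shows "submod scale T K"
  using assms by (auto simp: submod_def)

lemma submod_zero: "submod scale T K \<Longrightarrow> 0 \<in> K"
  and submod_diff: "submod scale T K \<Longrightarrow> x \<in> K \<Longrightarrow> y \<in> K \<Longrightarrow> x - y \<in> K"
  and submod_scale: "submod scale T K \<Longrightarrow> t \<in> T \<Longrightarrow> x \<in> K \<Longrightarrow> scale t x \<in> K"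
  by (auto simp: submod_def)

lemma submod_uminus: "submod scale T K \<Longrightarrow> x \<in> K \<Longrightarrow> - x \<in> K"
  using submod_diff[of scale T K 0 x] submod_zero[of scale T K] by simp

lemma submod_add: "submod scale T K \<Longrightarrow> x \<in> K \<Longrightarrow> y \<in> K \<Longrightarrow> x + y \<in> K"
  using submod_diff[of scale T K x "- y"] submod_uminus[of scale T K y] by simp

lemma submod_antimono: "submod scale T K \<Longrightarrow> T' \<subseteq> T \<Longrightarrow> submod scale T' K"
  by (auto simp: submod_def)

lemma submod_Inter: "(\<And>K. K \<in> \<K> \<Longrightarrow> submod scale T K) \<Longrightarrow> submod scale T (\<Inter>\<K>)"
  by (auto simp: submod_def)

lemma submod_Int: "submod scale T K \<Longrightarrow> submod scale T L \<Longrightarrow> submod scale T (K \<inter> L)"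
  by (auto simp: submod_def)

lemma submod_hull: "submod scale T (submod scale T hull Y)"
  by (rule hull_in) (auto intro: submod_Inter)

lemma submod_sum: "submod scale T K \<Longrightarrow> (\<And>i. i \<in> I \<Longrightarrow> f i \<in> K) \<Longrightarrow> sum f I \<in> K"
  by (induction I rule: infinite_finite_induct) (auto intro: submod_zero submod_add)

text \<open>Finite index is handled through finite colourings: intersections correspond to pairs of
  colours, and the pigeonhole principle applies directly.\<close>

lemma fin_modI_coloring:
  assumes "finite (f ` W)" "\<And>v w. v \<in> W \<Longrightarrow> w \<in> W \<Longrightarrow> f v = f w \<Longrightarrow> v - w \<in> K"
  shows "fin_mod W K"
  unfolding fin_mod_def
proof (intro exI conjI ballI)
  let ?g = "\<lambda>c. SOME w. w \<in> W \<and> f w = c"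
  show "finite (?g ` f ` W)" using assms(1) by blast
  fix w assume w: "w \<in> W"
  have "?g (f w) \<in> W \<and> f (?g (f w)) = f w"
    by (rule someI[of _ w]) (use w in auto)
  then show "\<exists>z\<in>?g ` f ` W. w - z \<in> K"
    using w assms(2)[of w "?g (f w)"] by auto
qed

lemma fin_mod_coloring:
  assumes "fin_mod W K" "submod scale T K"
  obtains f :: "'v::ab_group_add \<Rightarrow> 'v" where "finite (f ` W)"
    "\<And>v w. v \<in> W \<Longrightarrow> w \<in> W \<Longrightarrow> f v = f w \<Longrightarrow> v - w \<in> K"
proof -
  from assms(1) obtain Z where Z: "finite Z" "\<And>w. w \<in> W \<Longrightarrow> \<exists>z\<in>Z. w - z \<in> K"
    unfolding fin_mod_def by blast
  then obtain f where f: "\<And>w. w \<in> W \<Longrightarrow> f w \<in> Z \<and> w - f w \<in> K" by metis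
  have "v - w \<in> K" if "v \<in> W" "w \<in> W" "f v = f w" for v w
  proof -
    have "v - f v \<in> K" "w - f w \<in> K" using f that(1,2) by blast+
    from submod_diff[OF assms(2) this] that(3) show ?thesis by simp
  qed
  moreover have "finite (f ` W)" using f Z(1) by (meson finite_subset image_subsetI)
  ultimately show ?thesis using that by blast
qed

lemma fin_mod_range_coloring:
  fixes L :: "'v::ab_group_add set"
  assumes "fin_mod UNIV L" "submod s T L"
  obtains f :: "'v \<Rightarrow> 'v" where "finite (range f)" "\<And>v w. f v = f w \<Longrightarrow> v - w \<in> L"
  using fin_mod_coloring[OF assms] by (metis UNIV_I)

lemma fin_mod_mono: "fin_mod W K \<Longrightarrow> W' \<subseteq> W \<Longrightarrow> K \<subseteq> K' \<Longrightarrow> fin_mod W' K'"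
  unfolding fin_mod_def by (meson subsetD)

lemma fin_mod_Int:
  fixes W :: "'v::ab_group_add set"
  assumes "fin_mod W K" "fin_mod W L" "submod s T K" "submod s' T' L"
  shows "fin_mod W (K \<inter> L)"
proof -
  obtain f :: "'v \<Rightarrow> 'v" where f: "finite (f ` W)" "\<And>v w. v \<in> W \<Longrightarrow> w \<in> W \<Longrightarrow> f v = f w \<Longrightarrow> v - w \<in> K"
    using fin_mod_coloring[OF assms(1,3)] by metis
  obtain g :: "'v \<Rightarrow> 'v" where g: "finite (g ` W)" "\<And>v w. v \<in> W \<Longrightarrow> w \<in> W \<Longrightarrow> g v = g w \<Longrightarrow> v - w \<in> L"
    using fin_mod_coloring[OF assms(2,4)] by metis
  have "finite ((\<lambda>w. (f w, g w)) ` W)"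
    by (rule finite_subset[of _ "f ` W \<times> g ` W"]) (use f g in auto)
  then show ?thesis
    by (rule fin_modI_coloring) (use f g in auto)
qed

section \<open>Chains of subgroups of the integers\<close>

lemma submod_int_principal:
  assumes "submod s T (U :: int set)"
  shows "\<exists>d\<in>U. \<forall>k\<in>U. d dvd k"
proof (cases "U = {0}")
  case False
  then obtain u where "u \<in> U" "u \<noteq> 0" using submod_zero[OF assms] by blast
  then have "\<exists>n>0. int n \<in> U"
    using submod_uminus[OF assms, of u] by (intro exI[of _ "nat \<bar>u\<bar>"]) (auto simp: abs_if)
  then obtain d where d: "d > 0" "int d \<in> U" and least: "\<And>n. n < d \<Longrightarrow> n > 0 \<Longrightarrow> int n \<notin> U"
    using exists_least_iff[of "\<lambda>n. n > 0 \<and> int n \<in> U"] by blast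
  have mult: "int n * int d \<in> U" for n
    by (induction n) (auto simp: algebra_simps intro: submod_zero[OF assms] submod_add[OF assms] d)
  have mult': "n * int d \<in> U" for n
  proof (cases "n \<ge> 0")
    case True then show ?thesis using mult[of "nat n"] by simp
  next
    case False then show ?thesis using submod_uminus[OF assms mult[of "nat (- n)"]] by simp
  qed
  have "int d dvd k" if "k \<in> U" for k
  proof -
    have "k mod int d \<in> U"
      using submod_diff[OF assms that mult'[of "k div int d"]] by (simp add: minus_div_mult_eq_mod)
    moreover have "0 \<le> k mod int d" "k mod int d < int d" using d by auto
    ultimately have "k mod int d = 0"
      using least[of "nat (k mod int d)"] by (cases "k mod int d = 0") (auto simp: nat_less_iff)
    then show ?thesis by auto
  qed
  with d show ?thesis by blast
qed auto

lemma chain_mono: "(\<And>n::nat. L n \<subseteq> L (Suc n)) \<Longrightarrow> m \<le> n \<Longrightarrow> L m \<subseteq> L n"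
  using lift_Suc_mono_le[of L m n] by simp

text \<open>The union of the chain is cyclic, and its generator already lies in some
  \<open>L N\<close>.\<close>

lemma int_chain_stabilizes:
  fixes L :: "nat \<Rightarrow> int set"
  assumes "\<And>n. submod s T (L n)" "\<And>n. L n \<subseteq> L (Suc n)"
  shows "\<exists>N. \<forall>n\<ge>N. L n = L N"
proof -
  note mono = chain_mono[of L, OF assms(2)]
  have "submod s T (\<Union>n. L n)"
  proof (rule submodI)
    fix x y assume "x \<in> (\<Union>n. L n)" "y \<in> (\<Union>n. L n)"
    then obtain i j where "x \<in> L i" "y \<in> L j" by blast
    then have "x \<in> L (max i j)" "y \<in> L (max i j)" using mono[of i "max i j"] mono[of j "max i j"] by auto
    then show "x - y \<in> (\<Union>n. L n)" using submod_diff[OF assms(1)] by blast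
  qed (use submod_zero[OF assms(1)] submod_scale[OF assms(1)] in blast)+
  from submod_int_principal[OF this] obtain d N
    where d: "d \<in> L N" "\<And>k n. k \<in> L n \<Longrightarrow> d dvd k" by blast
  have mult: "int n * d \<in> L N" for n
    by (induction n) (auto simp: algebra_simps intro: submod_zero[OF assms(1)] submod_add[OF assms(1)] d)
  have mult': "n * d \<in> L N" for n
  proof (cases "n \<ge> 0")
    case True then show ?thesis using mult[of "nat n"] by simp
  next
    case False then show ?thesis using submod_uminus[OF assms(1) mult[of "nat (- n)"]] by simp
  qed
  have "L n \<subseteq> L N" for n
  proof
    fix k assume "k \<in> L n"
    then obtain j where "k = d * j" using d(2) by (metis dvdE)
    then show "k \<in> L N" using mult'[of j] by (simp add: mult.commute)
  qed
  then show ?thesis using mono by (meson subset_antisym)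
qed

text \<open>The elements \<open>w\<^sub>0 + t w\<^sub>1 + \<dots> + t\<^sup>j\<^sup>-\<^sup>1 w\<^sub>j\<^sub>-\<^sub>1\<close> with all \<open>w\<^sub>i \<in> W\<close>.\<close>

primrec poly_span :: "('r::monoid_mult \<Rightarrow> 'v \<Rightarrow> 'v) \<Rightarrow> 'r \<Rightarrow> 'v::ab_group_add set \<Rightarrow> nat \<Rightarrow> 'v set" where
  "poly_span scale t W 0 = {0}"
| "poly_span scale t W (Suc j) = {scale (t ^ j) w + c |w c. w \<in> W \<and> c \<in> poly_span scale t W j}"

lemma poly_span_SucI:
  "w \<in> W \<Longrightarrow> c \<in> poly_span scale t W j \<Longrightarrow> x = scale (t ^ j) w + c \<Longrightarrow> x \<in> poly_span scale t W (Suc j)"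
  by auto

lemma sumsetI: "k \<in> K \<Longrightarrow> l \<in> L \<Longrightarrow> x = k + l \<Longrightarrow> x \<in> {k + l |k l. k \<in> K \<and> l \<in> L}"
  by auto

section \<open>Noetherian modules and Hilbert's basis theorem\<close>

context module
begin

lemma scale_of_int_closed:
  assumes "submod s T K" "x \<in> K"
  shows "of_int k *s x \<in> K"
proof -
  have n: "of_nat n *s x \<in> K" for n
    by (induction n) (use assms in \<open>auto simp: algebra_simps scale_left_distrib intro: submod_zero submod_add\<close>)
  show ?thesis
  proof (cases "k \<ge> 0")
    case True then show ?thesis using n[of "nat k"] by simp
  next
    case False then show ?thesis using submod_uminus[OF assms(1) n[of "nat (- k)"]] by simp
  qed
qed

lemma submod_hull_insert:
  "submod scale {} hull insert y Y = {of_int k *s y + w |k w. w \<in> submod scale {} hull Y}" (is "_ = ?R")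
proof
  let ?W = "submod scale {} hull Y"
  have W: "submod scale {} ?W" by (rule submod_hull)
  have "submod scale {} ?R"
  proof (rule submodI)
    show "0 \<in> ?R" using submod_zero[OF W] by (auto intro!: exI[of _ 0])
    fix x x' assume "x \<in> ?R" "x' \<in> ?R"
    then obtain k w k' w' where "x = of_int k *s y + w" "x' = of_int k' *s y + w'" "w \<in> ?W" "w' \<in> ?W"
      by blast
    then show "x - x' \<in> ?R"
      using submod_diff[OF W, of w w']
      by (auto intro!: exI[of _ "k - k'"] exI[of _ "w - w'"] simp: scale_left_diff_distrib)
  qed auto
  moreover have "y \<in> ?R" using submod_zero[OF W] by (auto intro!: exI[of _ 1])
  moreover have "x \<in> ?R" if "x \<in> Y" for x
    using hull_inc[OF that, of "submod scale {}"] by (auto intro!: exI[of _ 0] exI[of _ x])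
  ultimately show "submod scale {} hull insert y Y \<subseteq> ?R"
    by (intro hull_minimal) auto
  have "of_int k *s y \<in> submod scale {} hull insert y Y" for k
    by (intro scale_of_int_closed[OF submod_hull] hull_inc) auto
  moreover have "?W \<subseteq> submod scale {} hull insert y Y" by (rule hull_mono) auto
  ultimately show "?R \<subseteq> submod scale {} hull insert y Y"
    using submod_add[OF submod_hull] by blast
qed

text \<open>The coefficients of a new generator \<open>y\<close> in the elements of
  \<open>L n\<close> form a chain of subgroups of the integers. Once this chain and that of the
  \<open>L n \<inter> ?W\<close> are stationary, so is the chain inside the larger hull.\<close>

lemma noeth_hull_empty:
  assumes "finite Y"
  shows "noeth scale {} (submod scale {} hull Y)"
  using assms
proof (induction Y)
  case empty
  have "submod scale {} {0}" by (auto simp: submod_def)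
  then have "submod scale {} hull {} = {0}"
    using submod_zero[OF submod_hull] hull_minimal[of "{}" "{0}" "submod scale {}"] by blast
  then have *: "L \<inter> (submod scale {} hull {}) = {0}" if "submod scale {} L" for L
    using submod_zero[OF that] by auto
  show ?case unfolding noeth_def
    by (intro allI impI exI[of _ 0]) (simp add: *)
next
  case (insert y Y)
  let ?W = "submod scale {} hull Y"
  have W: "submod scale {} ?W" by (rule submod_hull)
  show ?case unfolding noeth_def
  proof (intro allI impI)
    fix L :: "nat \<Rightarrow> 'b set"
    assume L: "\<forall>n. submod scale {} (L n)" and chain: "\<forall>n. L n \<subseteq> L (Suc n)"
    define I where "I n = {k::int. \<exists>w\<in>?W. of_int k *s y + w \<in> L n}" for n
    have "submod (*) {} (I n)" for n
    proof (rule submodI)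
      show "0 \<in> I n" using submod_zero[OF W] submod_zero[of scale "{}" "L n"] L by (auto simp: I_def intro!: bexI[of _ 0])
      fix j k assume "j \<in> I n" "k \<in> I n"
      then obtain v w where vw: "v \<in> ?W" "w \<in> ?W" "of_int j *s y + v \<in> L n" "of_int k *s y + w \<in> L n"
        by (auto simp: I_def)
      have "of_int (j - k) *s y + (v - w) \<in> L n"
        using submod_diff[OF L[rule_format] vw(3,4)] by (simp add: scale_left_diff_distrib algebra_simps)
      then show "j - k \<in> I n"
        using submod_diff[OF W vw(1,2)] unfolding I_def by blast
    qed auto
    moreover have "I n \<subseteq> I (Suc n)" for n using chain by (fastforce simp: I_def)
    ultimately obtain N1 where N1: "\<And>n. n \<ge> N1 \<Longrightarrow> I n = I N1"
      using int_chain_stabilizes[of "(*)" "{}" I] by blast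
    obtain N2 where N2: "\<And>n. n \<ge> N2 \<Longrightarrow> L n \<inter> ?W = L N2 \<inter> ?W"
      using insert.IH L chain unfolding noeth_def by blast
    define N where "N = max N1 N2"
    have mono: "m \<le> n \<Longrightarrow> L m \<subseteq> L n" for m n using chain_mono[of L] chain by blast
    have "L n \<inter> (submod scale {} hull insert y Y) \<subseteq> L N" if "n \<ge> N" for n
    proof
      fix x assume x: "x \<in> L n \<inter> (submod scale {} hull insert y Y)"
      then obtain k w where w: "w \<in> ?W" "x = of_int k *s y + w"
        by (auto simp: submod_hull_insert)
      with x have "k \<in> I n" by (auto simp: I_def)
      then have "k \<in> I N" using N1[of n] N1[of N] that by (simp add: N_def)
      then obtain v where v: "v \<in> ?W" "of_int k *s y + v \<in> L N" by (auto simp: I_def)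
      then have "w - v \<in> L n \<inter> ?W"
        using submod_diff[OF W w(1) v(1)] submod_diff[of scale "{}" "L n" x "of_int k *s y + v"]
          L x mono[OF that] w by auto
      then have "w - v \<in> L N" using N2[of n] N2[of N] that by (auto simp: N_def)
      then have "(w - v) + (of_int k *s y + v) \<in> L N" using v L submod_add by blast
      then show "x \<in> L N" using w by (simp add: algebra_simps)
    qed
    then show "\<exists>N. \<forall>n\<ge>N. L n \<inter> (submod scale {} hull insert y Y) = L N \<inter> (submod scale {} hull insert y Y)"
      using mono by (intro exI[of _ N]) blast
  qed
qed

lemma submod_poly_span:
  assumes W: "submod scale T W"
  shows "submod scale T (poly_span scale t W j)"
proof (induction j)
  case 0 then show ?case by (auto simp: submod_def)
next
  case (Suc j)
  let ?C = "poly_span scale t W j"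
  show ?case
  proof (rule submodI)
    show "0 \<in> poly_span scale t W (Suc j)" by (rule poly_span_SucI[OF submod_zero[OF W] submod_zero[OF Suc]]) simp
    fix x y assume "x \<in> poly_span scale t W (Suc j)" "y \<in> poly_span scale t W (Suc j)"
    then obtain v c w d where "x = t ^ j *s v + c" "y = t ^ j *s w + d" "v \<in> W" "w \<in> W" "c \<in> ?C" "d \<in> ?C"
      by auto
    then show "x - y \<in> poly_span scale t W (Suc j)"
      by (intro poly_span_SucI[OF submod_diff[OF W] submod_diff[OF Suc], of v w c d])
        (auto simp: scale_right_diff_distrib)
  next
    fix s x assume s: "s \<in> T" and "x \<in> poly_span scale t W (Suc j)"
    then obtain v c where "x = t ^ j *s v + c" "v \<in> W" "c \<in> ?C" by auto
    then show "s *s x \<in> poly_span scale t W (Suc j)"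
      by (intro poly_span_SucI[OF submod_scale[OF W s] submod_scale[OF Suc s], of v c])
        (auto simp: scale_right_distrib mult.commute)
  qed
qed

lemma poly_span_Suc: "submod scale T W \<Longrightarrow> poly_span scale t W j \<subseteq> poly_span scale t W (Suc j)"
  by (auto intro: poly_span_SucI[OF submod_zero] simp del: poly_span.simps)

lemma poly_span_mono: "submod scale T W \<Longrightarrow> i \<le> j \<Longrightarrow> poly_span scale t W i \<subseteq> poly_span scale t W j"
  by (rule chain_mono[of "poly_span scale t W", OF poly_span_Suc])

lemma poly_span_shift:
  assumes W: "submod scale T W" and "x \<in> poly_span scale t W j"
  shows "t *s x \<in> poly_span scale t W (Suc j)"
  using assms(2)
proof (induction j arbitrary: x)
  case 0 then show ?case using submod_zero[OF W] by auto
next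
  case (Suc j)
  then obtain v c where x: "x = t ^ j *s v + c" "v \<in> W" "c \<in> poly_span scale t W j" by auto
  show ?case
    by (rule poly_span_SucI[OF x(2) Suc.IH[OF x(3)]]) (simp add: x(1) scale_right_distrib)
qed

lemma poly_span_one: "poly_span scale t W 1 = W"
  by auto

lemma submod_poly_span_Union:
  assumes W: "submod scale T W"
  shows "submod scale (insert t T) (\<Union>j. poly_span scale t W j)" (is "submod _ _ ?W'")
proof (rule submodI)
  show "0 \<in> ?W'" using submod_zero[OF submod_poly_span[OF W]] by blast
  fix x y assume "x \<in> ?W'" "y \<in> ?W'"
  then obtain i j where "x \<in> poly_span scale t W i" "y \<in> poly_span scale t W j" by blast
  then have "x \<in> poly_span scale t W (max i j)" "y \<in> poly_span scale t W (max i j)"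
    using poly_span_mono[OF W, of i "max i j"] poly_span_mono[OF W, of j "max i j"] by auto
  then show "x - y \<in> ?W'" using submod_diff[OF submod_poly_span[OF W]] by blast
next
  fix s x assume s: "s \<in> insert t T" and "x \<in> ?W'"
  then obtain j where x: "x \<in> poly_span scale t W j" by blast
  have "s *s x \<in> poly_span scale t W (Suc j)"
  proof (cases "s = t")
    case True then show ?thesis using poly_span_shift[OF W x] by simp
  next
    case False
    then show ?thesis
      using s submod_scale[OF submod_poly_span[OF W] _ x, of s] poly_span_Suc[OF W, of t j] by blast
  qed
  then show "s *s x \<in> ?W'" by blast
qed

text \<open>Hilbert's basis argument: a submodule is controlled by its sets \<open>lc j\<close> of leading coefficients in degree \<open>j\<close>.\<close>

lemma noeth_poly_span:
  assumes W: "submod scale T W" and noeth: "noeth scale T W"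
  shows "noeth scale (insert t T) (\<Union>j. poly_span scale t W j)"
  unfolding noeth_def
proof (intro allI impI)
  fix L :: "nat \<Rightarrow> 'b set"
  assume L: "\<forall>n. submod scale (insert t T) (L n)" and chain: "\<forall>n. L n \<subseteq> L (Suc n)"
  have L_T: "submod scale T (L n)" for n using L submod_antimono by blast
  have mono: "m \<le> n \<Longrightarrow> L m \<subseteq> L n" for m n using chain_mono[of L] chain by blast
  define lc where "lc j n = {w \<in> W. \<exists>c\<in>poly_span scale t W j. t ^ j *s w + c \<in> L n}" for j n
  have lc: "submod scale T (lc j n)" for j n
  proof (rule submodI)
    show "0 \<in> lc j n"
      using submod_zero[OF W] submod_zero[OF L_T] submod_zero[OF submod_poly_span[OF W]]
      by (auto simp: lc_def intro!: bexI[of _ 0])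
    fix v w assume "v \<in> lc j n" "w \<in> lc j n"
    then obtain c d where *: "v \<in> W" "w \<in> W" "c \<in> poly_span scale t W j" "d \<in> poly_span scale t W j"
      "t ^ j *s v + c \<in> L n" "t ^ j *s w + d \<in> L n" by (auto simp: lc_def)
    have "t ^ j *s (v - w) + (c - d) \<in> L n"
      using submod_diff[OF L_T *(5,6)] by (simp add: scale_right_diff_distrib algebra_simps)
    then show "v - w \<in> lc j n"
      using submod_diff[OF W *(1,2)] submod_diff[OF submod_poly_span[OF W] *(3,4)] by (auto simp: lc_def)
  next
    fix s w assume s: "s \<in> T" and "w \<in> lc j n"
    then obtain c where *: "w \<in> W" "c \<in> poly_span scale t W j" "t ^ j *s w + c \<in> L n" by (auto simp: lc_def)
    have "t ^ j *s (s *s w) + s *s c \<in> L n"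
      using submod_scale[OF L_T s *(3)] by (simp add: scale_right_distrib mult.commute)
    then show "s *s w \<in> lc j n"
      using submod_scale[OF W s *(1)] submod_scale[OF submod_poly_span[OF W] s *(2)] by (auto simp: lc_def)
  qed
  have lc_n: "lc j m \<subseteq> lc j n" if "m \<le> n" for j m n using mono[OF that] by (auto simp: lc_def)
  have lc_Suc: "lc j n \<subseteq> lc (Suc j) n" for j n
  proof
    fix w assume "w \<in> lc j n"
    then obtain c where *: "w \<in> W" "c \<in> poly_span scale t W j" "t ^ j *s w + c \<in> L n" by (auto simp: lc_def)
    have "t ^ Suc j *s w + t *s c \<in> L n"
      using submod_scale[OF L[rule_format] insertI1 *(3)] by (simp add: scale_right_distrib)
    then show "w \<in> lc (Suc j) n"
      using * poly_span_shift[OF W *(2)] unfolding lc_def by blast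
  qed
  have lc_j: "lc i n \<subseteq> lc j n" if "i \<le> j" for i j n
    using chain_mono[of "\<lambda>j. lc j n"] lc_Suc that by blast
  have lc_W: "lc j n \<inter> W = lc j n" for j n by (auto simp: lc_def)
  have stable: "\<exists>N. \<forall>n\<ge>N. D n = D N" if "\<And>n. submod scale T (D n)" "\<And>n. D n \<subseteq> D (Suc n)"
    "\<And>n. D n \<inter> W = D n" for D :: "nat \<Rightarrow> 'b set"
    using noeth[unfolded noeth_def, rule_format, of D] that by simp
  \<comment> \<open>\<open>lc\<close> grows in both indices, so its diagonal becomes stationary at
    some \<open>M\<close>. This settles all degrees above \<open>M\<close> at once and leaves
    finitely many degrees \<open>j \<le> M\<close>, each of which is stationary from its own
    \<open>N0 j\<close> on.\<close>
  have diag: "lc n n \<subseteq> lc (Suc n) (Suc n)" for n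
    using lc_n[of n "Suc n" n] lc_Suc[of n "Suc n"] by auto
  have "\<exists>N. \<forall>n\<ge>N. lc n n = lc N N"
    using stable[of "\<lambda>n. lc n n"] lc diag lc_W by simp
  then obtain M where M: "\<And>n. n \<ge> M \<Longrightarrow> lc n n = lc M M" by blast
  have "\<exists>N. \<forall>n\<ge>N. lc j n = lc j N" for j
    using stable[of "lc j"] lc lc_n lc_W by simp
  then obtain N0 where N0: "\<And>j n. n \<ge> N0 j \<Longrightarrow> lc j n = lc j (N0 j)" by metis
  define N where "N = Max (insert M (N0 ` {..M}))"
  have NM: "N \<ge> M" and NN0: "\<And>j. j \<le> M \<Longrightarrow> N \<ge> N0 j"
    unfolding N_def by (rule Max_ge; simp)+
  have lcN: "lc j n \<subseteq> lc j N" if "n \<ge> N" for j n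
  proof (cases "j \<le> M")
    case True
    then show ?thesis using N0[of j n] N0[of j N] NN0[of j] that by auto
  next
    case False
    have "lc j n \<subseteq> lc (max j n) (max j n)" using lc_n[of n "max j n" j] lc_j[of j "max j n" "max j n"] by auto
    also have "\<dots> = lc M M" using M[of "max j n"] False by simp
    also have "\<dots> \<subseteq> lc j N" using lc_j[of M j M] lc_n[OF NM, of j] False by auto
    finally show ?thesis .
  qed
  have "x \<in> L N" if "n \<ge> N" "x \<in> poly_span scale t W j" "x \<in> L n" for n j x
    using that(2,3)
  proof (induction j arbitrary: x)
    case 0 then show ?case using submod_zero[OF L_T] by simp
  next
    case (Suc j)
    then obtain w c where x: "x = t ^ j *s w + c" "w \<in> W" "c \<in> poly_span scale t W j" by auto
    with Suc.prems have "w \<in> lc j n" by (auto simp: lc_def)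
    then have "w \<in> lc j N" using lcN[OF that(1)] by blast
    then obtain d where d: "d \<in> poly_span scale t W j" "t ^ j *s w + d \<in> L N" by (auto simp: lc_def)
    have "x - (t ^ j *s w + d) \<in> L n"
      using Suc.prems(2) d(2) mono[OF that(1)] submod_diff[OF L_T] by blast
    then have "c - d \<in> L N"
      using Suc.IH[of "c - d"] submod_diff[OF submod_poly_span[OF W] x(3) d(1)] x(1) by simp
    then have "(c - d) + (t ^ j *s w + d) \<in> L N" using d(2) submod_add[OF L_T] by blast
    then show ?case using x by (simp add: algebra_simps)
  qed
  then show "\<exists>N. \<forall>n\<ge>N. L n \<inter> (\<Union>j. poly_span scale t W j) = L N \<inter> (\<Union>j. poly_span scale t W j)"
    using mono by (intro exI[of _ N]) blast
qed

text \<open>Without scalars the additive hull of \<open>Y\<close> will do. Each \<open>t\<close> is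
  then adjoined by a Hilbert basis step, which replaces \<open>W\<close> by the polynomials in
  \<open>t\<close> with coefficients in \<open>W\<close>.\<close>

lemma noeth_exists:
  assumes "finite T" "finite Y"
  shows "\<exists>W. Y \<subseteq> W \<and> submod scale T W \<and> noeth scale T W"
  using assms(1)
proof (induction T)
  case empty
  show ?case
    by (intro exI[of _ "submod scale {} hull Y"] conjI hull_subset submod_hull noeth_hull_empty assms(2))
next
  case (insert t T)
  then obtain W where W: "Y \<subseteq> W" "submod scale T W" "noeth scale T W" by blast
  have "Y \<subseteq> (\<Union>j. poly_span scale t W j)" using W(1) UN_upper[of 1 UNIV "poly_span scale t W"] by (simp only: poly_span_one) blast
  then show ?case
    by (intro exI[of _ "\<Union>j. poly_span scale t W j"] conjI submod_poly_span_Union noeth_poly_span W(2,3))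
qed

lemma submod_sumset:
  assumes "submod scale T K" "submod scale T L"
  shows "submod scale T {k + l |k l. k \<in> K \<and> l \<in> L}" (is "submod _ _ ?S")
proof (rule submodI)
  show "0 \<in> ?S" by (rule sumsetI[OF submod_zero[OF assms(1)] submod_zero[OF assms(2)]]) simp
  fix x y assume "x \<in> ?S" "y \<in> ?S"
  then obtain k l k' l' where "x = k + l" "y = k' + l'" "k \<in> K" "l \<in> L" "k' \<in> K" "l' \<in> L" by blast
  then show "x - y \<in> ?S"
    by (intro sumsetI[OF submod_diff[OF assms(1)] submod_diff[OF assms(2)], of k k' l l']) auto
next
  fix t x assume "t \<in> T" "x \<in> ?S"
  then show "t *s x \<in> ?S"
    using submod_scale[OF assms(1), of t] submod_scale[OF assms(2), of t]
    by (fastforce simp: scale_right_distrib)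
qed

text \<open>With a Noetherian \<open>W\<close> containing \<open>Y\<close>, the sum of
  \<open>K\<close> and \<open>W\<close> is everything. Since \<open>K \<subseteq> L n\<close>, each
  \<open>L n\<close> is determined by \<open>L n \<inter> W\<close>.\<close>

lemma ascending_chain:
  assumes fin: "finite T" "finite Y" and K: "submod scale T K" and gen: "submod scale T hull (K \<union> Y) = UNIV"
    and L: "\<And>n::nat. submod scale T (L n)" "\<And>n. K \<subseteq> L n" "\<And>n. L n \<subseteq> L (Suc n)"
  shows "\<exists>N. \<forall>n\<ge>N. L n = L N"
proof -
  obtain W where W: "Y \<subseteq> W" "submod scale T W" "noeth scale T W"
    using noeth_exists[OF fin] by blast
  let ?S = "{k + w |k w. k \<in> K \<and> w \<in> W}"
  have "K \<union> Y \<subseteq> ?S"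
    using submod_zero[OF K] submod_zero[OF W(2)] W(1) by force
  with submod_sumset[OF K W(2)] gen have S: "UNIV \<subseteq> ?S"
    using hull_minimal[of "K \<union> Y" ?S "submod scale T"] by simp
  obtain N where N: "\<And>n. n \<ge> N \<Longrightarrow> L n \<inter> W = L N \<inter> W"
    using W(3) L unfolding noeth_def by blast
  have "L n \<subseteq> L N" if "n \<ge> N" for n
  proof
    fix x assume x: "x \<in> L n"
    obtain k w where kw: "x = k + w" "k \<in> K" "w \<in> W" using S by blast
    then have "w \<in> L n" using x L(2) submod_diff[OF L(1), of x n k] by auto
    then have "w \<in> L N" using N[OF that] kw by blast
    then show "x \<in> L N" using kw L(2) submod_add[OF L(1)] by blast
  qed
  then show ?thesis using chain_mono[of L, OF L(3)] by (meson subset_antisym)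
qed

end

section \<open>Polynomials over a subring\<close>

text \<open>This is the subring generated by \<open>T\<close>: products of elements of
  \<open>T\<close> arise by scaling 1 repeatedly, and closure under multiplication is
  \<open>ring_gen_mult\<close>.\<close>

definition ring_gen :: "'r::comm_ring_1 set \<Rightarrow> 'r set" where
  "ring_gen T = submod (*) T hull {1}"

lemma module_times: "module ((*) :: 'r::comm_ring_1 \<Rightarrow> 'r \<Rightarrow> 'r)"
  by unfold_locales (auto simp: algebra_simps)

lemma submod_ring_gen: "submod (*) T (ring_gen T)"
  unfolding ring_gen_def by (rule submod_hull)

lemma one_in_ring_gen: "1 \<in> ring_gen T"
  unfolding ring_gen_def by (rule hull_inc) simp

lemma ring_gen_minimal: "submod (*) T K \<Longrightarrow> 1 \<in> K \<Longrightarrow> ring_gen T \<subseteq> K"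
  unfolding ring_gen_def by (rule hull_minimal) auto

lemma ring_gen_inc: "t \<in> T \<Longrightarrow> t \<in> ring_gen T"
  using submod_scale[OF submod_ring_gen, of t T 1] one_in_ring_gen by auto

lemma ring_gen_mono: "T \<subseteq> T' \<Longrightarrow> ring_gen T \<subseteq> ring_gen T'"
  by (intro ring_gen_minimal one_in_ring_gen submod_antimono[OF submod_ring_gen])

lemma (in module) scale_ring_gen_closed:
  assumes K: "submod scale T K" and a: "a \<in> ring_gen T" and x: "x \<in> K"
  shows "a *s x \<in> K"
proof -
  have "submod (*) T {a. \<forall>x\<in>K. a *s x \<in> K}"
    by (rule submodI)
      (use K in \<open>auto simp: scale_left_diff_distrib simp flip: scale_scale
        intro: submod_zero submod_diff submod_scale\<close>)
  from ring_gen_minimal[OF this] a x show ?thesis by auto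
qed

lemma ring_gen_mult: "a \<in> ring_gen T \<Longrightarrow> b \<in> ring_gen T \<Longrightarrow> a * b \<in> ring_gen T"
  by (rule module.scale_ring_gen_closed[OF module_times submod_ring_gen])

definition subrg :: "'r::comm_ring_1 set \<Rightarrow> bool" where
  "subrg B \<longleftrightarrow> 1 \<in> B \<and> submod (*) B B"

lemma subrg_ring_gen: "subrg (ring_gen T)"
  unfolding subrg_def
  by (intro conjI one_in_ring_gen submodI ring_gen_mult submod_zero[OF submod_ring_gen] submod_diff[OF submod_ring_gen])

lemma subrg_one: "subrg B \<Longrightarrow> 1 \<in> B"
  and subrg_zero: "subrg B \<Longrightarrow> 0 \<in> B"
  and subrg_diff: "subrg B \<Longrightarrow> x \<in> B \<Longrightarrow> y \<in> B \<Longrightarrow> x - y \<in> B"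
  and subrg_uminus: "subrg B \<Longrightarrow> x \<in> B \<Longrightarrow> - x \<in> B"
  and subrg_add: "subrg B \<Longrightarrow> x \<in> B \<Longrightarrow> y \<in> B \<Longrightarrow> x + y \<in> B"
  and subrg_mult: "subrg B \<Longrightarrow> x \<in> B \<Longrightarrow> y \<in> B \<Longrightarrow> x * y \<in> B"
  and subrg_sum: "subrg B \<Longrightarrow> (\<And>i. i \<in> J \<Longrightarrow> f i \<in> B) \<Longrightarrow> sum f J \<in> B"
  unfolding subrg_def
  by (auto intro: submod_zero submod_diff submod_uminus submod_add submod_sum submod_scale[of "(*)" B B])

lemma subrg_power: "subrg B \<Longrightarrow> x \<in> B \<Longrightarrow> x ^ n \<in> B"
  by (induction n) (auto intro: subrg_one subrg_mult)

lemmas subrg_closed = subrg_one subrg_zero subrg_diff subrg_uminus subrg_add subrg_mult subrg_sum subrg_power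

definition polys :: "'r::comm_ring_1 set \<Rightarrow> 'r poly set" where
  "polys B = {p. \<forall>i. coeff p i \<in> B}"

lemma polysD: "p \<in> polys B \<Longrightarrow> coeff p i \<in> B"
  by (simp add: polys_def)

lemma
  assumes B: "subrg B"
  shows polys_diff: "p \<in> polys B \<Longrightarrow> q \<in> polys B \<Longrightarrow> p - q \<in> polys B"
    and polys_add: "p \<in> polys B \<Longrightarrow> q \<in> polys B \<Longrightarrow> p + q \<in> polys B"
    and polys_uminus: "p \<in> polys B \<Longrightarrow> - p \<in> polys B"
    and polys_mult: "p \<in> polys B \<Longrightarrow> q \<in> polys B \<Longrightarrow> p * q \<in> polys B"
    and polys_smult: "b \<in> B \<Longrightarrow> p \<in> polys B \<Longrightarrow> smult b p \<in> polys B"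
    and polys_monom: "b \<in> B \<Longrightarrow> monom b n \<in> polys B"
    and polys_pCons: "b \<in> B \<Longrightarrow> p \<in> polys B \<Longrightarrow> pCons b p \<in> polys B"
    and polys_0: "0 \<in> polys B"
    and polys_1: "1 \<in> polys B"
  by (auto simp: polys_def coeff_mult coeff_pCons one_pCons split: nat.split intro: subrg_closed[OF B])

lemma polys_power: "subrg B \<Longrightarrow> p \<in> polys B \<Longrightarrow> p ^ n \<in> polys B"
  by (induction n) (auto intro: polys_1 polys_mult)

lemma polys_sum: "subrg B \<Longrightarrow> (\<And>i. i \<in> J \<Longrightarrow> f i \<in> polys B) \<Longrightarrow> sum f J \<in> polys B"
  by (induction J rule: infinite_finite_induct) (auto intro: polys_0 polys_add)

lemmas polys_closed = polys_diff polys_add polys_uminus polys_mult polys_smult polys_monom polys_pCons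
  polys_0 polys_1 polys_power polys_sum

lemma poly_closed: "subrg B \<Longrightarrow> p \<in> polys B \<Longrightarrow> t \<in> B \<Longrightarrow> poly p t \<in> B"
  by (auto simp: poly_altdef intro!: subrg_closed polysD)

lemma polys_mono: "B \<subseteq> A \<Longrightarrow> polys B \<subseteq> polys A"
  by (auto simp: polys_def)

lemma ring_gen_insert: "ring_gen (insert t T) = (\<lambda>p. poly p t) ` polys (ring_gen T)" (is "_ = ?R")
proof
  note B = subrg_ring_gen[of T]
  have "submod (*) (insert t T) ?R"
  proof (rule submodI)
    show "0 \<in> ?R" using polys_0[OF B] by (auto intro!: image_eqI[of _ _ 0])
    fix x y assume "x \<in> ?R" "y \<in> ?R"
    then obtain p q where "p \<in> polys (ring_gen T)" "q \<in> polys (ring_gen T)" "x = poly p t" "y = poly q t"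
      by auto
    then show "x - y \<in> ?R" using polys_diff[OF B, of p q] by (intro image_eqI[of _ _ "p - q"]) auto
  next
    fix s x assume s: "s \<in> insert t T" and "x \<in> ?R"
    then obtain p where p: "p \<in> polys (ring_gen T)" "x = poly p t" by auto
    show "s * x \<in> ?R"
    proof (cases "s = t")
      case True
      then show ?thesis using p polys_pCons[OF B subrg_zero[OF B] p(1)]
        by (auto intro!: image_eqI[of _ _ "pCons 0 p"])
    next
      case False
      then show ?thesis using p polys_smult[OF B ring_gen_inc[of s] p(1)] s
        by (auto intro!: image_eqI[of _ _ "smult s p"])
    qed
  qed
  moreover have "1 \<in> ?R" using polys_1[OF B] by (auto intro!: image_eqI[of _ _ 1])
  ultimately show "ring_gen (insert t T) \<subseteq> ?R" by (rule ring_gen_minimal)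
  have "ring_gen T \<subseteq> ring_gen (insert t T)" "t \<in> ring_gen (insert t T)"
    by (auto intro: ring_gen_mono[THEN subsetD] ring_gen_inc)
  then show "?R \<subseteq> ring_gen (insert t T)"
    using poly_closed[OF subrg_ring_gen] polys_mono by blast
qed

text \<open>The leading coefficient of \<open>g\<close> need not be a unit, so each reduction step
  first multiplies the dividend by it. The alternative \<open>r = 0\<close> covers constant
  \<open>g\<close>.\<close>

lemma pseudo_division:
  assumes B: "subrg B" and g: "g \<in> polys B" and f: "f \<in> polys B"
  shows "\<exists>N. \<exists>q\<in>polys B. \<exists>r\<in>polys B. smult (lead_coeff g ^ N) f = q * g + r \<and> (r = 0 \<or> degree r < degree g)"
  using f
proof (induction "degree f" arbitrary: f rule: less_induct)
  case less
  show ?case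
  proof (cases "f = 0 \<or> degree f < degree g")
    case True
    then show ?thesis
      using less.prems polys_0[OF B] by (intro exI[of _ 0] bexI[of _ 0] bexI[of _ f]) auto
  next
    case False
    define m where "m = monom (lead_coeff f) (degree f - degree g)"
    define f1 where "f1 = smult (lead_coeff g) f - m * g"
    have m: "m \<in> polys B" unfolding m_def by (intro polys_monom[OF B] polysD less.prems)
    have f1: "f1 \<in> polys B" unfolding f1_def by (intro polys_closed B m g less.prems polysD)
    have "f1 = 0 \<or> degree f1 < degree f"
    proof (cases "f1 = 0")
      case False
      have "coeff f1 i = 0" if i: "i \<ge> degree f" for i
      proof (cases "i = degree f")
        case True
        with \<open>\<not> (f = 0 \<or> degree f < degree g)\<close> show ?thesis
          using mult.commute[of "lead_coeff f" "lead_coeff g"] by (simp add: f1_def m_def coeff_monom_mult)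
      next
        case False
        with i \<open>\<not> (f = 0 \<or> degree f < degree g)\<close> have "i > degree f" "i - (degree f - degree g) > degree g"
          by auto
        then show ?thesis by (simp add: f1_def m_def coeff_monom_mult coeff_eq_0)
      qed
      then have "\<not> degree f \<le> degree f1" using False by (metis leading_coeff_0_iff)
      then show ?thesis by simp
    qed simp
    then have "\<exists>N. \<exists>q\<in>polys B. \<exists>r\<in>polys B. smult (lead_coeff g ^ N) f1 = q * g + r \<and> (r = 0 \<or> degree r < degree g)"
    proof
      assume "f1 = 0"
      then show ?thesis using polys_0[OF B] by (intro exI[of _ 0] bexI[of _ 0]) auto
    qed (use less.hyps f1 in blast)
    then obtain N q r where *: "q \<in> polys B" "r \<in> polys B"
      "smult (lead_coeff g ^ N) f1 = q * g + r" "r = 0 \<or> degree r < degree g" by blast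
    have "smult (lead_coeff g ^ Suc N) f = smult (lead_coeff g ^ N) (f1 + m * g)"
      by (simp add: f1_def mult.commute)
    also have "\<dots> = (q + smult (lead_coeff g ^ N) m) * g + r"
      by (simp add: smult_add_right *(3) algebra_simps)
    finally show ?thesis
      using *(2,4) polys_add[OF B *(1) polys_smult[OF B subrg_power[OF B polysD[OF g]] m]] by blast
  qed
qed

section \<open>Adjoining an integral element to a finite quotient\<close>

lemma pigeonhole_fin_mod:
  fixes W :: "'v::ab_group_add set"
  assumes "fin_mod W K" "submod s T K" "\<And>n::nat. x n \<in> W"
  shows "\<exists>i j. i < j \<and> x i - x j \<in> K"
proof -
  obtain f :: "'v \<Rightarrow> 'v" where f: "finite (f ` W)" "\<And>v w. v \<in> W \<Longrightarrow> w \<in> W \<Longrightarrow> f v = f w \<Longrightarrow> v - w \<in> K"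
    using fin_mod_coloring[OF assms(1,2)] by metis
  have "finite (range (f \<circ> x))" by (rule finite_subset[OF _ f(1)]) (use assms(3) in auto)
  then have "\<not> inj (f \<circ> x)" using finite_imageD infinite_UNIV_nat by blast
  then obtain i j where "f (x i) = f (x j)" "i \<noteq> j" by (auto simp: inj_on_def)
  then show ?thesis using f(2) assms(3) by (metis linorder_neqE_nat)
qed

text \<open>The relation is a monic equation of degree \<open>d\<close> for \<open>t\<close> on
  \<open>W\<close> modulo \<open>K\<close>, so the combinations of \<open>1, t, ..., t^(d-1)\<close>
  with coefficients in \<open>W\<close> are stable under \<open>t\<close> modulo \<open>K\<close>.
  Each coefficient matters only up to \<open>K\<close>, hence takes finitely many values.\<close>

lemma (in module) fin_mod_adjoin:
  assumes W: "submod scale T W" "fin_mod W K" and K: "submod scale (insert t T) K"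
    and rel: "\<And>w. w \<in> W \<Longrightarrow> t ^ d *s w \<in> {c + k |c k. c \<in> poly_span scale t W d \<and> k \<in> K}"
  shows "\<exists>W'. W \<subseteq> W' \<and> submod scale (insert t T) W' \<and> fin_mod W' K"
proof (intro exI conjI)
  let ?C = "poly_span scale t W d"
  let ?W' = "{c + k |c k. c \<in> ?C \<and> k \<in> K}"
  have K_T: "submod scale T K" using K submod_antimono by blast
  have W': "submod scale T ?W'" by (rule submod_sumset[OF submod_poly_span[OF W(1)] K_T])
  have C: "?C \<subseteq> ?W'" and K': "K \<subseteq> ?W'"
    using submod_zero[OF K] submod_zero[OF submod_poly_span[OF W(1)], of t d] by force+
  show "W \<subseteq> ?W'"
  proof (cases d)
    \<comment> \<open>For \<open>d = 0\<close> the span is \<open>{0}\<close>, and the relation says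
      that \<open>W\<close> lies in \<open>K\<close>.\<close>
    case 0
    then show ?thesis using rel by force
  next
    case (Suc e)
    then show ?thesis using C poly_span_mono[OF W(1), of 1 d t] poly_span_one[of t W] by auto
  qed
  have tC: "t *s c \<in> ?W'" if "c \<in> ?C" for c
  proof -
    from poly_span_shift[OF W(1) that] obtain w c' where x: "t *s c = t ^ d *s w + c'" "w \<in> W" "c' \<in> ?C" by auto
    show ?thesis unfolding x(1) by (rule submod_add[OF W' rel[OF x(2)] subsetD[OF C x(3)]])
  qed
  show "submod scale (insert t T) ?W'"
  proof (rule submodI)
    fix s x assume s: "s \<in> insert t T" and x: "x \<in> ?W'"
    show "s *s x \<in> ?W'"
    proof (cases "s = t")
      case True
      from x obtain c k where "x = c + k" "c \<in> ?C" "k \<in> K" by blast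
      then show ?thesis
        using submod_add[OF W' tC subsetD[OF K' submod_scale[OF K insertI1]], of c k] True
        by (simp add: scale_right_distrib)
    next
      case False
      then show ?thesis using s submod_scale[OF W' _ x] by blast
    qed
  qed (rule submod_zero[OF W'] submod_diff[OF W']; assumption)+
  have t_pow: "t ^ j *s k \<in> K" if "k \<in> K" for j k
    by (induction j) (use that submod_scale[OF K insertI1] in \<open>auto simp flip: scale_scale\<close>)
  have "fin_mod (poly_span scale t W j) K" for j
  proof (induction j)
    case 0 then show ?case using submod_zero[OF K] by (auto simp: fin_mod_def intro!: exI[of _ "{0}"])
  next
    case (Suc j)
    from Suc W(2) obtain Z1 Z2 where Z: "finite Z1" "finite Z2"
      "\<And>c. c \<in> poly_span scale t W j \<Longrightarrow> \<exists>z\<in>Z1. c - z \<in> K" "\<And>w. w \<in> W \<Longrightarrow> \<exists>z\<in>Z2. w - z \<in> K"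
      unfolding fin_mod_def by blast
    show ?case unfolding fin_mod_def
    proof (intro exI conjI ballI)
      let ?Z = "(\<lambda>(z, z'). t ^ j *s z' + z) ` (Z1 \<times> Z2)"
      show "finite ?Z" using Z by blast
      fix x assume "x \<in> poly_span scale t W (Suc j)"
      then obtain w c where x: "x = t ^ j *s w + c" "w \<in> W" "c \<in> poly_span scale t W j" by auto
      then obtain z z' where z: "z \<in> Z1" "c - z \<in> K" "z' \<in> Z2" "w - z' \<in> K" using Z by meson
      have "x - (t ^ j *s z' + z) = t ^ j *s (w - z') + (c - z)" by (simp add: x scale_right_diff_distrib)
      also have "\<dots> \<in> K" by (intro submod_add[OF K] t_pow z)
      finally show "\<exists>z\<in>?Z. x - z \<in> K" using z by force
    qed
  qed
  from this[of d] obtain Z where Z: "finite Z" "\<And>c. c \<in> ?C \<Longrightarrow> \<exists>z\<in>Z. c - z \<in> K"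
    unfolding fin_mod_def by blast
  have "\<exists>z\<in>Z. x - z \<in> K" if x: "x \<in> ?W'" for x
  proof -
    from x obtain c k where ck: "x = c + k" "c \<in> ?C" "k \<in> K" by blast
    then obtain z where z: "z \<in> Z" "c - z \<in> K" using Z(2) by blast
    have "x - z = (c - z) + k" by (simp add: ck)
    then show ?thesis using submod_add[OF K z(2) ck(3)] z(1) by metis
  qed
  then show "fin_mod ?W' K" using Z(1) unfolding fin_mod_def by blast
qed

lemma (in module) sum_in_poly_span:
  assumes "submod scale T W" "\<And>i. i < d \<Longrightarrow> f i \<in> W"
  shows "(\<Sum>i<d. t ^ i *s f i) \<in> poly_span scale t W d"
  using assms(2)
proof (induction d)
  case (Suc d)
  then show ?case by (intro poly_span_SucI[of "f d" W "\<Sum>i<d. t ^ i *s f i"]) auto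
qed auto

section \<open>The Nullstellensatz over the integers\<close>

text \<open>This stands for the integral domain \<open>A/(A \<inter> I)\<close>. \<open>I\<close> is
  not assumed to lie in \<open>A\<close>; membership in \<open>I\<close> plays the role of being
  zero.\<close>

locale prime_mod =
  fixes A I :: "'r::comm_ring_1 set"
  assumes subrg: "subrg A"
    and ideal: "submod (*) A I"
    and one_notin: "1 \<notin> I"
    and prime: "\<And>a b. a \<in> A \<Longrightarrow> b \<in> A \<Longrightarrow> a * b \<in> I \<Longrightarrow> a \<in> I \<or> b \<in> I"
begin

lemma ideal_mult: "a \<in> A \<Longrightarrow> x \<in> I \<Longrightarrow> a * x \<in> I"
  and ideal_mult_right: "a \<in> A \<Longrightarrow> x \<in> I \<Longrightarrow> x * a \<in> I"
  and ideal_diff: "x \<in> I \<Longrightarrow> y \<in> I \<Longrightarrow> x - y \<in> I"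
  and ideal_add: "x \<in> I \<Longrightarrow> y \<in> I \<Longrightarrow> x + y \<in> I"
  and ideal_uminus: "x \<in> I \<Longrightarrow> - x \<in> I"
  and ideal_0: "0 \<in> I"
  using submod_scale[OF ideal] submod_diff[OF ideal] submod_add[OF ideal] submod_uminus[OF ideal]
    submod_zero[OF ideal] by (auto simp: mult.commute)

lemma ideal_diff_iff: "x - y \<in> I \<Longrightarrow> x \<in> I \<longleftrightarrow> y \<in> I"
  using ideal_add[of "x - y" y] ideal_diff[of x "x - y"] by auto

lemma prime_power: "a \<in> A \<Longrightarrow> a ^ n \<in> I \<Longrightarrow> a \<in> I"
proof (induction n)
  case 0 then show ?case using one_notin by simp
next
  case (Suc n)
  then show ?case using prime[of a "a ^ n"] subrg_power[OF subrg, of a n] by auto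
qed

lemma ideal_diff_power: "a \<in> A \<Longrightarrow> b \<in> A \<Longrightarrow> a - b \<in> I \<Longrightarrow> a ^ n - b ^ n \<in> I"
proof (induction n)
  case 0 then show ?case by (simp add: ideal_0)
next
  case (Suc n)
  have "a ^ Suc n - b ^ Suc n = a * (a ^ n - b ^ n) + (a - b) * b ^ n" by (simp add: algebra_simps)
  then show ?case
    using ideal_add[OF ideal_mult[OF Suc.prems(1) Suc.IH] ideal_mult_right[OF subrg_power[OF subrg, of b n]]] Suc.prems
    by simp
qed

definition vanishing :: "'r poly \<Rightarrow> bool" where
  "vanishing p \<longleftrightarrow> (\<forall>i. coeff p i \<in> I)"

lemma vanishing_poly: "vanishing p \<Longrightarrow> t \<in> A \<Longrightarrow> poly p t \<in> I"
  unfolding poly_altdef vanishing_def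
  by (intro submod_sum[OF ideal] ideal_mult_right subrg_power[OF subrg]) auto

lemma vanishing_mult: "p \<in> polys A \<Longrightarrow> vanishing q \<Longrightarrow> vanishing (p * q)"
  unfolding vanishing_def coeff_mult
  by (intro allI submod_sum[OF ideal] ideal_mult) (auto intro: polysD)

lemma vanishing_diff: "vanishing p \<Longrightarrow> vanishing q \<Longrightarrow> vanishing (p - q)"
  and vanishing_add: "vanishing p \<Longrightarrow> vanishing q \<Longrightarrow> vanishing (p + q)"
  by (auto simp: vanishing_def intro: ideal_diff ideal_add)

text \<open>\<open>degree\<close> does not see the ideal. Cutting off the top coefficients that lie
  in \<open>I\<close> yields a representative whose \<open>degree\<close> is the degree over the
  domain \<open>A/I\<close>.\<close>

lemma truncate:
  assumes p: "p \<in> polys B" and B: "subrg B" and "\<not> vanishing p"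
  obtains p' where "p' \<in> polys B" "lead_coeff p' \<notin> I" "vanishing (p - p')" "degree p' \<le> degree p"
proof -
  define n where "n = (GREATEST i. coeff p i \<notin> I)"
  have bound: "coeff p i \<notin> I \<Longrightarrow> i \<le> degree p" for i
    using ideal_0 by (metis le_degree)
  obtain i where "coeff p i \<notin> I" using assms(3) by (auto simp: vanishing_def)
  then have n: "coeff p n \<notin> I" unfolding n_def by (rule GreatestI_nat) (use bound in blast)
  have gt: "coeff p i \<in> I" if "i > n" for i
    using Greatest_le_nat[of "\<lambda>i. coeff p i \<notin> I" i "degree p"] bound that unfolding n_def by force
  define p' where "p' = poly_cutoff (Suc n) p"
  have c: "coeff p' i = (if i \<le> n then coeff p i else 0)" for i by (simp add: p'_def coeff_poly_cutoff)
  have "degree p' \<le> n" by (rule degree_le) (simp add: c)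
  moreover have "n \<le> degree p'" by (rule le_degree) (use n c ideal_0 in auto)
  ultimately have d: "degree p' = n" by simp
  show ?thesis
  proof (rule that)
    show "p' \<in> polys B" using polysD[OF p] subrg_zero[OF B] by (auto simp: polys_def c)
    show "lead_coeff p' \<notin> I" using n by (simp add: d c)
    show "vanishing (p - p')" using gt by (auto simp: vanishing_def c ideal_0)
    show "degree p' \<le> degree p" using bound[OF n] d by simp
  qed
qed

lemma lead_coeff_mult_notin:
  assumes "p \<in> polys A" "q \<in> polys A" "lead_coeff p \<notin> I" "lead_coeff q \<notin> I"
  shows "coeff (p * q) (degree p + degree q) \<notin> I"
  using assms prime[of "lead_coeff p" "lead_coeff q"] by (auto simp: coeff_mult_degree_sum dest: polysD)

definition divides_powers :: "'r set \<Rightarrow> 'r \<Rightarrow> bool" where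
  "divides_powers B c \<longleftrightarrow> c \<in> B \<and> c \<notin> I \<and> (\<forall>b\<in>B. b \<notin> I \<longrightarrow> (\<exists>y\<in>B. \<exists>k::nat. b * y - c ^ k \<in> I))"

text \<open>\<open>divides_powers B c\<close> says that \<open>B/I\<close> becomes a field once \<open>c\<close> is inverted. If \<open>t\<close> were
  transcendental over \<open>B/I\<close>, then \<open>1 + c t\<close> would divide a power of \<open>c\<close>, to which it is coprime.\<close>

lemma algebraic_generator:
  assumes B: "subrg B" "B \<subseteq> A" and t: "t \<in> A"
    and c: "divides_powers ((\<lambda>p. poly p t) ` polys B) c"
  shows "\<exists>f\<in>polys B. poly f t \<in> I \<and> lead_coeff f \<notin> I"
proof (rule ccontr)
  assume contra: "\<not> ?thesis"
  have polysA: "p \<in> polys B \<Longrightarrow> p \<in> polys A" for p using polys_mono[OF B(2)] by blast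
  have free: "vanishing p" if p: "p \<in> polys B" "poly p t \<in> I" for p
  proof (rule ccontr)
    assume "\<not> vanishing p"
    then obtain p' where p': "p' \<in> polys B" "lead_coeff p' \<notin> I" "vanishing (p - p')"
      using truncate[OF p(1) B(1)] by metis
    then have "poly p t - poly p' t \<in> I" using vanishing_poly[OF p'(3) t] by simp
    then show False using ideal_diff_iff p(2) contra p' by blast
  qed
  from c obtain C0 where C0: "C0 \<in> polys B" "c = poly C0 t" "c \<notin> I" by (auto simp: divides_powers_def)
  then have "\<not> vanishing C0" using vanishing_poly t by blast
  then obtain C where C: "C \<in> polys B" "lead_coeff C \<notin> I" "vanishing (C0 - C)"
    using truncate[OF C0(1) B(1)] by metis
  have cC: "c - poly C t \<in> I" using vanishing_poly[OF C(3) t] C0(2) by simp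
  have cA: "c \<in> A" "poly C t \<in> A"
    using C0 poly_closed[OF subrg polysA t] C(1) by auto
  define X :: "'r poly" where "X = pCons 0 1"
  have X: "X \<in> polys B" unfolding X_def by (intro polys_closed B subrg_zero)
  define D where "D = - (X * C)"
  have D: "D \<in> polys B" unfolding D_def by (intro polys_closed B X C)
  define U where "U = 1 - D"
  have U: "U \<in> polys B" unfolding U_def by (intro polys_closed B D)
  have C_nz: "C \<noteq> 0" using C(2) ideal_0 by auto
  have U_eq: "U = pCons 1 C" by (simp add: U_def D_def X_def one_pCons)
  have dU: "degree U = Suc (degree C)" and lU: "lead_coeff U \<notin> I"
    using C_nz C(2) by (auto simp: U_eq)
  have "poly U t \<notin> I" using free[OF U] lU unfolding vanishing_def by blast
  then obtain Y k where Y: "Y \<in> polys B" "poly U t * poly Y t - c ^ k \<in> I"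
    using c U unfolding divides_powers_def by blast
  have "poly U t * poly Y t - poly C t ^ k = (poly U t * poly Y t - c ^ k) + (c ^ k - poly C t ^ k)" by simp
  also have "\<dots> \<in> I" by (intro ideal_add Y ideal_diff_power cC cA)
  finally have "poly (U * Y - C ^ k) t \<in> I" by simp
  then have van: "vanishing (U * Y - C ^ k)" by (rule free[rotated]) (intro polys_closed B U Y C)
  \<comment> \<open>\<open>V\<close> inverts \<open>U\<close> modulo \<open>I\<close>: the geometric
    sum contributes \<open>1 - D ^ k\<close>, and \<open>U * Y\<close>, which is
    \<open>C ^ k\<close> modulo \<open>I\<close>, contributes
    \<open>(- X) ^ k * C ^ k = D ^ k\<close>.\<close>
  define V where "V = (- X) ^ k * Y + (\<Sum>i<k. D ^ i)"
  have V: "V \<in> polys B" unfolding V_def by (intro polys_closed B X Y D)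
  have DX: "D ^ k = (- X) ^ k * C ^ k" by (simp add: D_def flip: power_mult_distrib)
  have "U * V = (- X) ^ k * (U * Y) + U * (\<Sum>i<k. D ^ i)" by (simp add: V_def algebra_simps)
  also have "U * (\<Sum>i<k. D ^ i) = 1 - D ^ k" by (simp add: U_def one_diff_power_eq)
  finally have "U * V - 1 = (- X) ^ k * (U * Y - C ^ k)" by (simp add: DX algebra_simps)
  then have UV: "vanishing (U * V - 1)"
    using vanishing_mult[OF polysA[OF polys_power[OF B(1) polys_uminus[OF B(1) X]]] van, of k] by simp
  show False
  proof (cases "vanishing V")
    case True
    then have "vanishing (U * V)" by (rule vanishing_mult[OF polysA[OF U]])
    from vanishing_diff[OF this UV] have "vanishing 1" by simp
    then show False using one_notin by (auto simp: vanishing_def dest: spec[of _ 0])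
  next
    case False
    then obtain V' where V': "V' \<in> polys B" "lead_coeff V' \<notin> I" "vanishing (V - V')"
      using truncate[OF V B(1)] by metis
    have "vanishing ((U * V - 1) - U * (V - V'))"
      by (intro vanishing_diff UV vanishing_mult polysA U V')
    then have "vanishing (U * V' - 1)" by (simp add: algebra_simps)
    \<comment> \<open>A unit of a polynomial ring over a domain is constant. As \<open>U\<close> has
      positive degree, the 1 does not reach this coefficient, which is the product of two leading
      coefficients outside \<open>I\<close>.\<close>
    then have "coeff (U * V' - 1) (degree U + degree V') \<in> I" unfolding vanishing_def by blast
    then have "coeff (U * V') (degree U + degree V') \<in> I" by (simp add: dU)
    then show False using lead_coeff_mult_notin[OF polysA[OF U] polysA[OF V'(1)] lU V'(2)] by blast
  qed
qed

text \<open>As \<open>t\<close> is algebraic over \<open>B/I\<close>, the element \<open>c\<close>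
  divides some \<open>e \<in> B\<close> outside \<open>I\<close>. Let \<open>b0\<close> be the
  leading coefficient of a relation \<open>f\<close> of least degree. For \<open>b \<in> B\<close>
  outside \<open>I\<close>, an equation \<open>b Z(t) = c ^ k\<close> is turned into one for
  \<open>e ^ k\<close>, reduced by \<open>f\<close> at the cost of a power of \<open>b0\<close>, and
  compared in degree 0. Thus \<open>b0 * e\<close> has the required property over
  \<open>B\<close>.\<close>

lemma divides_powers_descend:
  assumes B: "subrg B" "B \<subseteq> A" and t: "t \<in> A"
    and c: "divides_powers ((\<lambda>p. poly p t) ` polys B) c"
  shows "\<exists>a. divides_powers B a"
proof -
  have polysA: "p \<in> polys B \<Longrightarrow> p \<in> polys A" for p using polys_mono[OF B(2)] by blast
  have evalA: "p \<in> polys B \<Longrightarrow> poly p t \<in> A" for p using poly_closed[OF subrg polysA t] by blast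
  have BA: "b \<in> B \<Longrightarrow> b \<in> A" for b using B(2) by blast
  define P where "P f \<longleftrightarrow> f \<in> polys B \<and> poly f t \<in> I \<and> lead_coeff f \<notin> I" for f
  obtain f where f: "P f" and f_min: "\<And>g. P g \<Longrightarrow> degree f \<le> degree g"
    using algebraic_generator[OF assms] exists_least_iff[of "\<lambda>n. \<exists>f. P f \<and> degree f = n"]
    unfolding P_def by (metis linorder_not_less)
  then have fB: "f \<in> polys B" "poly f t \<in> I" "lead_coeff f \<notin> I" by (auto simp: P_def)
  text \<open>Minimality of the degree makes \<open>1, t, \<dots>, t\<^sup>d\<^sup>-\<^sup>1\<close> linearly independent over \<open>B/I\<close>.\<close>
  have free: "vanishing p" if p: "p \<in> polys B" "poly p t \<in> I" "degree p < degree f" for p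
  proof (rule ccontr)
    assume "\<not> vanishing p"
    then obtain p' where p': "p' \<in> polys B" "lead_coeff p' \<notin> I" "vanishing (p - p')" "degree p' \<le> degree p"
      using truncate[OF p(1) B(1)] by metis
    then have "poly p t - poly p' t \<in> I" using vanishing_poly[OF p'(3) t] by simp
    then have "P p'" using ideal_diff_iff p(2) p' by (auto simp: P_def)
    then show False using f_min p' p(3) by fastforce
  qed
  have df: "degree f > 0"
  proof (rule ccontr)
    assume "\<not> degree f > 0"
    then have "poly f t = lead_coeff f" by (auto elim!: degree_eq_zeroE)
    then show False using fB by simp
  qed
  from c obtain C where C: "C \<in> polys B" "c = poly C t" "c \<notin> I" by (auto simp: divides_powers_def)
  \<comment> \<open>The nonzero multiples of \<open>c\<close>, written with degree below
    \<open>degree f\<close>. One of least degree turns out to be constant, and this constant is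
    \<open>e\<close>.\<close>
  define Q where "Q g \<longleftrightarrow> g \<in> polys B \<and> lead_coeff g \<notin> I \<and> degree g < degree f \<and>
    (\<exists>Y\<in>polys B. poly g t - c * poly Y t \<in> I)" for g
  have QI: "\<exists>g. Q g \<and> degree g \<le> degree r"
    if r: "r \<in> polys B" "\<not> vanishing r" "degree r < degree f" "Y \<in> polys B" "poly r t - c * poly Y t \<in> I" for r Y
  proof -
    obtain g where g: "g \<in> polys B" "lead_coeff g \<notin> I" "vanishing (r - g)" "degree g \<le> degree r"
      using truncate[OF r(1) B(1) r(2)] by metis
    have "poly r t - poly g t \<in> I" using vanishing_poly[OF g(3) t] by simp
    from ideal_diff[OF r(5) this] have "poly g t - c * poly Y t \<in> I" by (simp add: algebra_simps)
    then show ?thesis using g r(3,4) by (auto simp: Q_def)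
  qed
  have "\<exists>g. Q g"
  proof -
    obtain N q r where qr: "q \<in> polys B" "r \<in> polys B" "smult (lead_coeff f ^ N) C = q * f + r"
      "r = 0 \<or> degree r < degree f"
      using pseudo_division[OF B(1) fB(1) C(1)] by blast
    have dr: "degree r < degree f" using qr(4) df by auto
    have eq: "poly r t - c * lead_coeff f ^ N = - (poly q t * poly f t)"
      using arg_cong[OF qr(3), of "\<lambda>p. poly p t"] C(2) by (simp add: algebra_simps)
    have mem: "poly r t - c * lead_coeff f ^ N \<in> I"
      unfolding eq by (intro ideal_uminus ideal_mult fB evalA qr)
    have "\<not> vanishing r"
    proof
      assume "vanishing r"
      then have "c * lead_coeff f ^ N \<in> I" using vanishing_poly[OF _ t] mem ideal_diff_iff by blast
      moreover have "lead_coeff f ^ N \<in> A" by (intro subrg_power[OF subrg] polysD polysA fB)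
      moreover have "c \<in> A" using evalA C by blast
      ultimately show False using prime C(3) fB(3) prime_power polysD[OF polysA[OF fB(1)]] by blast
    qed
    moreover have "poly r t - c * poly [:lead_coeff f ^ N:] t \<in> I" using mem by simp
    ultimately show ?thesis
      using QI[OF qr(2) _ dr, of "[:lead_coeff f ^ N:]"] B
      by (auto intro: polys_closed subrg_closed polysD[OF fB(1)])
  qed
  then obtain g where g: "Q g" and g_min: "\<And>h. Q h \<Longrightarrow> degree g \<le> degree h"
    using exists_least_iff[of "\<lambda>n. \<exists>f. Q f \<and> degree f = n"] by (metis linorder_not_less)
  then obtain Y where gB: "g \<in> polys B" "lead_coeff g \<notin> I" "degree g < degree f"
    and Y: "Y \<in> polys B" "poly g t - c * poly Y t \<in> I" by (auto simp: Q_def)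
  have gt: "poly g t \<notin> I" using free[of g] gB by (auto simp: vanishing_def)
  \<comment> \<open>Otherwise divide \<open>f\<close> by \<open>g\<close>. The remainder is again a
    multiple of \<open>c\<close> at \<open>t\<close>, hence zero modulo \<open>I\<close> by
    minimality of \<open>g\<close>. So \<open>f\<close> factors modulo \<open>I\<close>, and the
    cofactor \<open>q\<close>, of smaller degree than \<open>f\<close>, vanishes at
    \<open>t\<close>, against the minimality of \<open>f\<close>.\<close>
  have dg: "degree g = 0"
  proof (rule ccontr)
    assume dg: "degree g \<noteq> 0"
    obtain N q r where qr: "q \<in> polys B" "r \<in> polys B" "smult (lead_coeff g ^ N) f = q * g + r"
      "r = 0 \<or> degree r < degree g"
      using pseudo_division[OF B(1) gB(1) fB(1)] by blast
    have dr: "degree r < degree g" using qr(4) dg by auto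
    have lg: "lead_coeff g ^ N \<in> A" by (intro subrg_power[OF subrg] polysD polysA gB)
    have r_eq: "poly r t = lead_coeff g ^ N * poly f t - poly q t * poly g t"
      using arg_cong[OF qr(3), of "\<lambda>p. poly p t"] by (simp add: algebra_simps)
    have "vanishing r"
    proof (rule ccontr)
      assume nv: "\<not> vanishing r"
      have "poly r t - c * poly (- (q * Y)) t = lead_coeff g ^ N * poly f t - poly q t * (poly g t - c * poly Y t)"
        by (simp add: r_eq algebra_simps)
      also have "\<dots> \<in> I" by (intro ideal_diff ideal_mult lg fB Y evalA qr)
      finally obtain h where "Q h" "degree h \<le> degree r"
        using QI[OF qr(2) nv, of "- (q * Y)"] dr gB(3) B qr(1) Y(1) by (auto intro: polys_closed)
      then show False using g_min dr by fastforce
    qed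
    then have "lead_coeff g ^ N * poly f t - poly q t * poly g t \<in> I" using vanishing_poly[OF _ t] r_eq by metis
    then have "poly q t * poly g t \<in> I" using ideal_diff_iff ideal_mult[OF lg fB(2)] by blast
    then have qt: "poly q t \<in> I" using prime evalA qr(1) gB(1) gt by blast
    have lgN: "lead_coeff g ^ N \<notin> I" using prime_power polysD[OF polysA[OF gB(1)]] gB(2) by blast
    have lgf: "lead_coeff g ^ N * lead_coeff f \<notin> I"
      using prime[OF lg] lgN fB(3) polysD[OF polysA[OF fB(1)]] by blast
    have nvq: "\<not> vanishing q"
    proof
      assume "vanishing q"
      then have "vanishing (g * q)" by (rule vanishing_mult[OF polysA[OF gB(1)]])
      then have "vanishing (smult (lead_coeff g ^ N) f)"
        unfolding qr(3) by (intro vanishing_add \<open>vanishing r\<close>) (simp add: mult.commute)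
      then show False using lgf by (auto simp: vanishing_def dest: spec[of _ "degree f"])
    qed
    obtain q' where q': "q' \<in> polys B" "lead_coeff q' \<notin> I" "vanishing (q - q')"
      using truncate[OF qr(1) B(1) nvq] by metis
    have "vanishing (r + g * (q - q'))" by (intro vanishing_add \<open>vanishing r\<close> vanishing_mult polysA gB q')
    also have "r + g * (q - q') = smult (lead_coeff g ^ N) f - q' * g" using qr(3) by (simp add: algebra_simps)
    finally have v: "vanishing (smult (lead_coeff g ^ N) f - q' * g)" .
    have "degree q' + degree g \<le> degree f"
    proof (rule ccontr)
      assume "\<not> ?thesis"
      then have "coeff (smult (lead_coeff g ^ N) f) (degree q' + degree g) = 0" by (simp add: coeff_eq_0)
      with v have "- coeff (q' * g) (degree q' + degree g) \<in> I"
        unfolding vanishing_def by (metis coeff_diff diff_0)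
      then show False
        using lead_coeff_mult_notin[OF polysA polysA, OF q'(1) gB(1) q'(2) gB(2)] ideal_uminus by force
    qed
    then have "degree q' < degree f" using dg by simp
    moreover have "poly q t - poly q' t \<in> I" using vanishing_poly[OF q'(3) t] by simp
    then have "poly q' t \<in> I" using qt ideal_diff_iff by blast
    ultimately have "vanishing q'" using free q'(1) by blast
    then show False using q'(2) by (auto simp: vanishing_def)
  qed
  define e where "e = lead_coeff g"
  have g_e: "poly g t = e" unfolding e_def using dg by (auto elim!: degree_eq_zeroE)
  have e: "e \<in> B" "e \<notin> I" "e - c * poly Y t \<in> I" using gB Y polysD g_e unfolding e_def by auto
  define b0 where "b0 = lead_coeff f"
  have b0: "b0 \<in> B" "b0 \<notin> I" using fB polysD by (auto simp: b0_def)
  show ?thesis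
  proof (intro exI[of _ "b0 * e"], unfold divides_powers_def, intro conjI ballI impI)
    show "b0 * e \<in> B" by (intro subrg_mult B b0 e)
    show "b0 * e \<notin> I" using prime[OF BA BA] b0 e by blast
    fix b assume b: "b \<in> B" "b \<notin> I"
    then have "b = poly [:b:] t" "[:b:] \<in> polys B" using B by (auto intro: polys_closed)
    then have "b \<in> (\<lambda>p. poly p t) ` polys B" by blast
    then obtain Z k where Z: "Z \<in> polys B" "b * poly Z t - c ^ k \<in> I"
      using c b(2) unfolding divides_powers_def by blast
    obtain N q r where qr: "q \<in> polys B" "r \<in> polys B" "smult (lead_coeff f ^ N) (Z * Y ^ k) = q * f + r"
      "r = 0 \<or> degree r < degree f"
      using pseudo_division[OF B(1) fB(1), of "Z * Y ^ k"] Z(1) Y(1) B by (auto intro: polys_closed)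
    have dr: "degree r < degree f" using qr(4) df by auto
    \<comment> \<open>\<open>h\<close> vanishes at \<open>t\<close> modulo \<open>I\<close> and has
      degree below \<open>degree f\<close>, so all its coefficients lie in \<open>I\<close>; the
      constant one is an equation inside \<open>B\<close>.\<close>
    define h where "h = smult b r - [:b0 ^ N * e ^ k:]"
    have h: "h \<in> polys B" unfolding h_def by (intro polys_closed subrg_closed B qr b e b0)
    have dh: "degree h < degree f" unfolding h_def
      using dr df degree_smult_le[of b r] by (intro degree_diff_less) auto
    have rt: "poly r t = b0 ^ N * (poly Z t * poly Y t ^ k) - poly q t * poly f t"
      using arg_cong[OF qr(3), of "\<lambda>p. poly p t"] by (simp add: algebra_simps b0_def)
    have "poly h t = b0 ^ N * ((b * poly Z t - c ^ k) * poly Y t ^ k) - b * poly q t * poly f t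
        - b0 ^ N * (e ^ k - (c * poly Y t) ^ k)"
      by (simp add: h_def rt algebra_simps power_mult_distrib)
    also have "\<dots> \<in> I"
    proof -
      have 1: "(b * poly Z t - c ^ k) * poly Y t ^ k \<in> I"
        by (intro ideal_mult_right Z subrg_power[OF subrg] evalA Y)
      have 2: "e ^ k - (c * poly Y t) ^ k \<in> I"
        by (intro ideal_diff_power e BA[OF e(1)] subrg_mult[OF subrg] evalA Y) (use evalA C in blast)
      have 3: "b0 ^ N \<in> A" by (intro subrg_power[OF subrg] BA b0)
      have 4: "b * poly q t \<in> A" by (intro subrg_mult[OF subrg] BA b evalA qr)
      show ?thesis
        by (rule ideal_diff[OF ideal_diff[OF ideal_mult[OF 3 1] ideal_mult[OF 4 fB(2)]] ideal_mult[OF 3 2]])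
    qed
    finally have "vanishing h" using free[OF h _ dh] by blast
    then have h0: "b * coeff r 0 - b0 ^ N * e ^ k \<in> I" by (auto simp: vanishing_def h_def dest: spec[of _ 0])
    show "\<exists>y\<in>B. \<exists>k'. b * y - (b0 * e) ^ k' \<in> I"
    proof (intro bexI exI)
      \<comment> \<open>The extra factor \<open>b0 ^ k * e ^ N\<close> evens out the exponents of
        \<open>b0\<close> and \<open>e\<close>.\<close>
      have "b * (coeff r 0 * (b0 ^ k * e ^ N)) - (b0 * e) ^ (N + k) = (b * coeff r 0 - b0 ^ N * e ^ k) * (b0 ^ k * e ^ N)"
        by (simp add: algebra_simps power_mult_distrib power_add)
      also have "\<dots> \<in> I" by (intro ideal_mult_right[OF _ h0] subrg_mult subrg_power subrg BA b0 e)
      finally show "b * (coeff r 0 * (b0 ^ k * e ^ N)) - (b0 * e) ^ (N + k) \<in> I" .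
      show "coeff r 0 * (b0 ^ k * e ^ N) \<in> B" by (intro subrg_closed B b0 e polysD qr)
    qed
  qed
qed


lemma of_int_in: "of_int k \<in> A"
proof -
  have n: "of_nat n \<in> A" for n
    by (induction n) (auto intro: subrg_closed[OF subrg])
  show ?thesis
    using n[of "nat k"] subrg_uminus[OF subrg n[of "nat (- k)"]] by (cases "k \<ge> 0") auto
qed

lemma ring_gen_empty: "ring_gen {} = range (of_int :: int \<Rightarrow> 'r)"
proof
  show "ring_gen {} \<subseteq> range (of_int :: int \<Rightarrow> 'r)"
  proof (rule ring_gen_minimal)
    show "submod (*) {} (range of_int :: 'r set)"
      by (rule submodI) (auto intro: range_eqI[of _ _ 0] simp flip: of_int_diff)
  qed (auto intro: range_eqI[of _ _ 1])
  have "of_int k * 1 \<in> ring_gen {}" for k :: int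
    by (rule module.scale_of_int_closed[OF module_times submod_ring_gen one_in_ring_gen])
  then show "range of_int \<subseteq> ring_gen {}" by auto
qed

text \<open>In characteristic 0, a prime larger than the absolute value of \<open>a\<close> would
  have to divide a power of \<open>a\<close>.\<close>

lemma positive_char:
  assumes "divides_powers (range of_int) a"
  shows "\<exists>n>0. of_int (int n) \<in> I"
proof (rule ccontr)
  assume contra: "\<not> ?thesis"
  have nz: "m = 0" if "of_int m \<in> I" for m :: int
  proof (rule ccontr)
    assume "m \<noteq> 0"
    then have "of_int (int (nat \<bar>m\<bar>)) \<in> I" "nat \<bar>m\<bar> > 0"
      using that ideal_uminus[OF that] by (auto simp: abs_if)
    then show False using contra by blast
  qed
  obtain m where m: "a = of_int m" "a \<notin> I" using assms by (auto simp: divides_powers_def)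
  then have "m \<noteq> 0" using ideal_0 by auto
  obtain p where p: "prime p" "nat \<bar>m\<bar> < p" using bigger_prime by blast
  then have "of_int (int p) \<notin> I" using nz[of "int p"] prime_gt_0_nat[of p] by auto
  then obtain y k where "of_int (int p) * of_int y - a ^ k \<in> I"
    using assms unfolding divides_powers_def by blast
  then have "of_int (int p * y - m ^ k) \<in> I" by (simp add: m)
  then have "int p dvd m ^ k" using nz by (metis dvd_triv_left eq_iff_diff_eq_0)
  then have "int p dvd m" using p(1) by (meson prime_dvd_power prime_nat_int_transfer)
  then show False using zdvd_imp_le[of "int p" "\<bar>m\<bar>"] p(2) \<open>m \<noteq> 0\<close> by auto
qed

text \<open>The property descends to \<open>ring_gen T\<close>, which is finite modulo
  \<open>I\<close> by induction. A finite domain is a field, so the leading coefficient of an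
  equation for \<open>t\<close> becomes invertible, \<open>t\<close> is integral, and
  \<open>fin_mod_adjoin\<close> applies.\<close>

lemma fin_mod_of_divides_powers:
  assumes "finite T" "T \<subseteq> A" "divides_powers (ring_gen T) c"
  shows "fin_mod (ring_gen T) I"
  using assms
proof (induction T arbitrary: c)
  case empty
  then obtain n where n: "n > 0" "of_int (int n) \<in> I"
    using positive_char by (auto simp: ring_gen_empty)
  show ?case unfolding ring_gen_empty
  proof (rule fin_modI_coloring)
    let ?f = "\<lambda>x. SOME r. r \<in> {0..<int n} \<and> x - of_int r \<in> I"
    have f: "?f x \<in> {0..<int n} \<and> x - of_int (?f x) \<in> I" if "x \<in> range of_int" for x :: 'r
    proof -
      from that obtain k where k: "x = of_int k" by blast
      have "x - of_int (k mod int n) = of_int (k - k mod int n)" by (simp add: k)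
      also have "\<dots> = of_int (k div int n) * of_int (int n)"
        by (simp only: minus_mod_eq_div_mult of_int_mult)
      also have "\<dots> \<in> I" by (intro ideal_mult of_int_in n)
      finally have "k mod int n \<in> {0..<int n} \<and> x - of_int (k mod int n) \<in> I" using n(1) by auto
      then show ?thesis by (rule someI)
    qed
    show "finite (?f ` range of_int)" by (rule finite_subset[of _ "{0..<int n}"]) (use f in blast)+
    fix v w :: 'r assume v: "v \<in> range of_int" and w: "w \<in> range of_int" and eq: "?f v = ?f w"
    have "(v - of_int (?f v)) - (w - of_int (?f w)) \<in> I" using f[OF v] f[OF w] ideal_diff by blast
    then show "v - w \<in> I" using eq by simp
  qed
next
  case (insert t T)
  let ?B = "ring_gen T"
  have t: "t \<in> A" and T: "T \<subseteq> A" using insert.prems by auto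
  note B = subrg_ring_gen[of T]
  have "submod (*) T A" using submod_scale[of "(*)" A A] subrg T by (auto simp: submod_def subrg_def)
  then have BA: "?B \<subseteq> A" by (rule ring_gen_minimal) (rule subrg_one[OF subrg])
  have "divides_powers ((\<lambda>p. poly p t) ` polys ?B) c" using insert.prems(2) by (simp add: ring_gen_insert)
  then obtain a f where a: "divides_powers ?B a" and f: "f \<in> polys ?B" "poly f t \<in> I" "lead_coeff f \<notin> I"
    using divides_powers_descend[OF B BA t] algebraic_generator[OF B BA t] by metis
  have fin: "fin_mod ?B I" using insert.IH[OF T a] .
  define b0 where "b0 = lead_coeff f"
  have b0: "b0 \<in> ?B" "b0 \<notin> I" using f polysD by (auto simp: b0_def)
  \<comment> \<open>Two powers of \<open>b0\<close> agree modulo \<open>I\<close>; cancelling the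
    smaller one exhibits \<open>b'\<close>, a power of \<open>b0\<close>, as an inverse of
    \<open>b0\<close>.\<close>
  obtain i j where ij: "i < j" "b0 ^ i - b0 ^ j \<in> I"
    using pigeonhole_fin_mod[OF fin ideal, of "\<lambda>n. b0 ^ n"] subrg_power[OF B b0(1)] by blast
  have "b0 ^ i - b0 ^ j = b0 ^ i * (1 - b0 ^ (j - i))"
    using ij(1) by (simp add: right_diff_distrib flip: power_add)
  then have "b0 ^ i \<in> I \<or> 1 - b0 ^ (j - i) \<in> I"
    using ij(2) by (intro prime) (auto intro!: BA[THEN subsetD] subrg_closed[OF B] b0)
  then have inv: "1 - b0 ^ (j - i) \<in> I" using prime_power b0 BA by blast
  define b' where "b' = b0 ^ (j - i - 1)"
  have b': "b' \<in> ?B" unfolding b'_def by (rule subrg_power[OF B b0(1)])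
  have "b0 * b' = b0 ^ (j - i)" unfolding b'_def using ij(1) by (simp add: Suc_diff_Suc flip: power_Suc)
  then have inv: "1 - b0 * b' \<in> I" using inv by simp
  have I_sub: "submod (*) (insert t T) I" using submod_antimono[OF ideal] t T by auto
  have "t ^ degree f * b \<in> {x + k |x k. x \<in> poly_span (*) t ?B (degree f) \<and> k \<in> I}" if b: "b \<in> ?B" for b
  proof -
    \<comment> \<open>The lower coefficients of the equation \<open>poly f t = 0\<close> after
      division by \<open>b0\<close> and multiplication by \<open>b\<close>.\<close>
    let ?g = "\<lambda>i. - (coeff f i * b' * b)"
    have 1: "(\<Sum>i<degree f. t ^ i * ?g i) \<in> poly_span (*) t ?B (degree f)"
      by (rule module.sum_in_poly_span[OF module_times submod_ring_gen]) (intro subrg_closed B polysD f b b')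
    have 2: "t ^ degree f * b - (\<Sum>i<degree f. t ^ i * ?g i) = (1 - b0 * b') * (t ^ degree f * b) + b' * b * poly f t"
    proof -
      define S where "S = (\<Sum>i<degree f. coeff f i * t ^ i)"
      have f_eq: "poly f t = b0 * t ^ degree f + S"
        by (simp add: poly_altdef b0_def S_def lessThan_Suc_atMost[symmetric])
      have "t ^ i * ?g i = - (b' * b) * (coeff f i * t ^ i)" for i
        by (simp add: mult_ac)
      then have g_eq: "(\<Sum>i<degree f. t ^ i * ?g i) = - (b' * b) * S"
        by (simp only: S_def sum_distrib_left)
      show ?thesis unfolding g_eq f_eq by (simp add: algebra_simps)
    qed
    have 3: "(1 - b0 * b') * (t ^ degree f * b) + b' * b * poly f t \<in> I"
      using b b' t BA
      by (intro ideal_add ideal_mult_right[OF _ inv] ideal_mult[OF _ f(2)]) (auto intro!: subrg_closed[OF subrg])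
    show ?thesis
      by (rule sumsetI[OF 1 3]) (use 2 in \<open>simp only: diff_eq_eq add.commute\<close>)
  qed
  from module.fin_mod_adjoin[OF module_times submod_ring_gen fin I_sub this]
  obtain W' where W': "?B \<subseteq> W'" "submod (*) (insert t T) W'" "fin_mod W' I" by blast
  have "ring_gen (insert t T) \<subseteq> W'"
    using ring_gen_minimal[OF W'(2)] W'(1) one_in_ring_gen by blast
  then show ?case using W'(3) fin_mod_mono by blast
qed

end

text \<open>The field is \<open>ring_gen T\<close> modulo \<open>I\<close>.\<close>

lemma finitely_generated_field_finite:
  fixes I :: "'r::comm_ring_1 set"
  assumes "finite T" "submod (*) T I" "1 \<notin> I"
    and inverse: "\<And>a. a \<in> ring_gen T \<Longrightarrow> a \<notin> I \<Longrightarrow> \<exists>b\<in>ring_gen T. a * b - 1 \<in> I"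
  shows "fin_mod (ring_gen T) I"
proof -
  note A = subrg_ring_gen[of T]
  have closed: "a * x \<in> I" if "a \<in> ring_gen T" "x \<in> I" for a x
    by (rule module.scale_ring_gen_closed[OF module_times assms(2) that])
  interpret prime_mod "ring_gen T" I
  proof
    show "subrg (ring_gen T)" by (rule A)
    show "submod (*) (ring_gen T) I"
      by (intro submodI closed submod_zero[OF assms(2)] submod_diff[OF assms(2)])
    show "1 \<notin> I" by (rule assms(3))
    fix a b assume ab: "a \<in> ring_gen T" "b \<in> ring_gen T" "a * b \<in> I"
    show "a \<in> I \<or> b \<in> I"
    proof (rule disjCI)
      assume "b \<notin> I"
      then obtain c where c: "c \<in> ring_gen T" "b * c - 1 \<in> I" using inverse ab by blast
      have "c * (a * b) - a * (b * c - 1) \<in> I"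
        by (intro submod_diff[OF assms(2)] closed ab c)
      then show "a \<in> I" by (simp add: algebra_simps)
    qed
  qed
  \<comment> \<open>In a field every nonzero element divides 1, so \<open>c = 1\<close> starts the
    descent.\<close>
  have "divides_powers (ring_gen T) 1"
    using inverse one_in_ring_gen one_notin by (auto simp: divides_powers_def)
  then show ?thesis
    using fin_mod_of_divides_powers[OF assms(1)] ring_gen_inc by blast
qed

section \<open>Residual finiteness of finitely generated modules\<close>

context module
begin

lemma fin_mod_hull_empty:
  assumes "finite Y" and L: "submod scale {} L" and tors: "\<And>y. y \<in> Y \<Longrightarrow> \<exists>n>0. of_int n *s y \<in> L"
  shows "fin_mod (submod scale {} hull Y) L"
  using assms(1) tors
proof (induction Y)
  case empty
  have "submod scale {} hull {} \<subseteq> L" by (rule hull_minimal) (use L in auto)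
  then show ?case unfolding fin_mod_def by (intro exI[of _ "{0}"]) auto
next
  case (insert y Y)
  obtain n where n: "n > 0" "of_int n *s y \<in> L" using insert.prems by blast
  obtain Z where Z: "finite Z" "\<And>w. w \<in> submod scale {} hull Y \<Longrightarrow> \<exists>z\<in>Z. w - z \<in> L"
    using insert.IH insert.prems unfolding fin_mod_def by blast
  show ?case unfolding fin_mod_def
  proof (intro exI conjI ballI)
    let ?Z = "(\<lambda>(r, z). of_int r *s y + z) ` ({0..<n} \<times> Z)"
    show "finite ?Z" using Z by blast
    fix x assume "x \<in> submod scale {} hull insert y Y"
    then obtain k w where x: "x = of_int k *s y + w" "w \<in> submod scale {} hull Y"
      by (auto simp: submod_hull_insert)
    then obtain z where z: "z \<in> Z" "w - z \<in> L" using Z by blast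
    have k: "of_int k - of_int (k mod n) = of_int (k div n) * (of_int n :: 'a)"
      by (simp add: minus_mod_eq_div_mult flip: of_int_diff of_int_mult)
    have "x - (of_int (k mod n) *s y + z) = (of_int k - of_int (k mod n)) *s y + (w - z)"
      by (simp add: x scale_left_diff_distrib)
    also have "\<dots> = of_int (k div n) *s (of_int n *s y) + (w - z)"
      by (simp add: k)
    also have "\<dots> \<in> L" by (intro submod_add[OF L] scale_of_int_closed[OF L] n z)
    finally show "\<exists>z\<in>?Z. x - z \<in> L" using z(1) n(1) by (force intro: bexI[of _ "(k mod n, z)"])
  qed
qed

lemma plus_rangeI: "k \<in> K \<Longrightarrow> x = k + e *s v \<Longrightarrow> x \<in> {k + e *s v |k v. k \<in> K}"
  by auto

text \<open>Filter the module by the sums of \<open>K\<close> with the images of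
  \<open>e ^ j\<close>. Multiplication by \<open>e ^ j\<close> maps the finite quotient for
  \<open>j = 1\<close> onto the \<open>j\<close>-th layer, and there are only \<open>s\<close>
  layers above \<open>K\<close>.\<close>

lemma fin_mod_nilpotent:
  assumes K: "submod scale T K" and e: "e \<in> ring_gen T" and nil: "\<And>v. e ^ s *s v \<in> K"
    and fin: "fin_mod UNIV {k + e *s v |k v. k \<in> K}"
  shows "fin_mod UNIV K"
proof -
  note A = subrg_ring_gen[of T]
  from fin obtain Z1 where Z1: "finite Z1" "\<And>x. \<exists>z\<in>Z1. \<exists>k v. x - z = k + e *s v \<and> k \<in> K"
    unfolding fin_mod_def by auto
  have "fin_mod UNIV {k + e ^ j *s v |k v. k \<in> K}" for j
  proof (induction j)
    case 0
    have "x - 0 \<in> {k + e ^ 0 *s v |k v. k \<in> K}" for x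
      by (rule plus_rangeI[OF submod_zero[OF K], of _ _ x]) simp
    then show ?case unfolding fin_mod_def by (intro exI[of _ "{0}"]) simp
  next
    case (Suc j)
    then obtain Z where Z: "finite Z" "\<And>x. \<exists>z\<in>Z. \<exists>k v. x - z = k + e ^ j *s v \<and> k \<in> K"
      unfolding fin_mod_def by auto
    show ?case unfolding fin_mod_def
    proof (intro exI conjI ballI)
      let ?Z = "(\<lambda>(z, z'). z + e ^ j *s z') ` (Z \<times> Z1)"
      show "finite ?Z" using Z Z1 by blast
      fix x
      obtain z k v where x: "z \<in> Z" "x - z = k + e ^ j *s v" "k \<in> K" using Z(2) by blast
      obtain z' k' v' where v: "z' \<in> Z1" "v - z' = k' + e *s v'" "k' \<in> K" using Z1(2) by blast
      have "x - (z + e ^ j *s z') = (x - z) - e ^ j *s z'" by simp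
      also have "\<dots> = k + e ^ j *s (v - z')" by (simp only: x scale_right_diff_distrib) simp
      also have "\<dots> = (k + e ^ j *s k') + e ^ Suc j *s v'"
        by (simp only: v scale_right_distrib power_Suc2 scale_scale add.assoc)
      finally have "x - (z + e ^ j *s z') = (k + e ^ j *s k') + e ^ Suc j *s v'" .
      moreover have "k + e ^ j *s k' \<in> K"
        by (intro submod_add[OF K] x scale_ring_gen_closed[OF K] subrg_power[OF A] e v)
      moreover have "z + e ^ j *s z' \<in> ?Z" using x v by (intro image_eqI[of _ _ "(z, z')"]) auto
      ultimately show "\<exists>z\<in>?Z. x - z \<in> {k + e ^ Suc j *s v |k v. k \<in> K}" by blast
    qed
  qed
  moreover have "{k + e ^ s *s v |k v. k \<in> K} \<subseteq> K" using nil submod_add[OF K] by blast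
  ultimately show ?thesis using fin_mod_mono by blast
qed

lemma submod_plus_range:
  assumes K: "submod scale T K"
  shows "submod scale T {k + e *s v |k v. k \<in> K}"
proof -
  have "submod scale T (range (scale e))"
  proof (rule submodI)
    show "t *s x \<in> range (scale e)" if "x \<in> range (scale e)" for t x
      using that by (auto simp only: scale_left_commute[of t e])
  qed (auto intro: range_eqI[of _ _ 0] simp flip: scale_right_diff_distrib)
  from submod_sumset[OF K this] show ?thesis
    by (rule back_subst[of "submod scale T"]) blast
qed

text \<open>The last hypothesis defers finiteness to submodules modulo which all of \<open>E\<close>
  acts as zero. The elements of \<open>E\<close> are made to act as zero one by one, with
  \<open>fin_mod_nilpotent\<close> leading back.\<close>

lemma fin_mod_nilpotents:
  assumes "finite E" "E \<subseteq> ring_gen T" "submod scale T K" "\<And>e. e \<in> E \<Longrightarrow> \<exists>s. \<forall>v. e ^ s *s v \<in> K"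
    "\<And>L. submod scale T L \<Longrightarrow> K \<subseteq> L \<Longrightarrow> (\<And>e v. e \<in> E \<Longrightarrow> e *s v \<in> L) \<Longrightarrow> fin_mod UNIV L"
  shows "fin_mod UNIV K"
  using assms
proof (induction E arbitrary: K)
  case empty
  then show ?case by blast
next
  case (insert e E)
  let ?K = "{k + e *s v |k v. k \<in> K}"
  note K = insert.prems(2)
  have sub: "K \<subseteq> ?K" by (rule subsetI, rule plus_rangeI[of _ _ _ _ 0]) auto
  have ev: "e *s v \<in> ?K" for v by (rule plus_rangeI[OF submod_zero[OF K], of _ _ v]) simp
  have "fin_mod UNIV ?K"
  proof (rule insert.IH)
    show "submod scale T ?K" by (rule submod_plus_range[OF K])
    show "\<exists>s. \<forall>v. f ^ s *s v \<in> ?K" if "f \<in> E" for f using insert.prems(3)[of f] that sub by blast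
    fix L assume L: "submod scale T L" "?K \<subseteq> L" "\<And>f v. f \<in> E \<Longrightarrow> f *s v \<in> L"
    show "fin_mod UNIV L"
    proof (rule insert.prems(4)[OF L(1)])
      show "K \<subseteq> L" using sub L(2) by (rule subset_trans)
      show "f *s v \<in> L" if f: "f \<in> insert e E" for f v
      proof (cases "f = e")
        case True then show ?thesis using subsetD[OF L(2) ev] by simp
      next
        case False then show ?thesis using f L(3) by blast
      qed
    qed
  qed (use insert.prems in auto)
  moreover obtain s where "\<And>v. e ^ s *s v \<in> K" using insert.prems(3)[of e] by blast
  ultimately show ?case using fin_mod_nilpotent[OF K] insert.prems(1) by blast
qed

lemma fin_mod_UNIV:
  assumes gen: "submod scale T hull (K \<union> Y) = UNIV" and L: "submod scale T L" "K \<subseteq> L"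
    and W: "Y \<subseteq> W" "submod scale T W" "fin_mod W L"
  shows "fin_mod UNIV L"
proof -
  let ?S = "{l + w |l w. l \<in> L \<and> w \<in> W}"
  have "K \<union> Y \<subseteq> ?S"
    using submod_zero[OF L(1)] submod_zero[OF W(2)] W(1) L(2) by force
  with submod_sumset[OF L(1) W(2)] gen have S: "UNIV \<subseteq> ?S"
    using hull_minimal[of "K \<union> Y" ?S "submod scale T"] by simp
  obtain Z where Z: "finite Z" "\<And>w. w \<in> W \<Longrightarrow> \<exists>z\<in>Z. w - z \<in> L" using W(3) unfolding fin_mod_def by blast
  have "\<exists>z\<in>Z. x - z \<in> L" for x
  proof -
    obtain l w where x: "x = l + w" "l \<in> L" "w \<in> W" using S by blast
    then obtain z where z: "z \<in> Z" "w - z \<in> L" using Z(2) by blast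
    have "x - z = l + (w - z)" by (simp add: x(1))
    then show ?thesis using submod_add[OF L(1) x(2) z(2)] z(1) by metis
  qed
  then show ?thesis using Z(1) unfolding fin_mod_def by blast
qed

text \<open>Modulo \<open>L\<close> the additive hull of \<open>Y\<close> is finite, being killed by
  \<open>p\<close>. Each \<open>t\<close> satisfies the monic equation \<open>t ^ j = t ^ i\<close>
  of degree \<open>j\<close>, so adjoining it preserves finiteness.\<close>

lemma fin_mod_of_relations:
  assumes fin: "finite T" "finite Y" and gen: "submod scale T hull (K \<union> Y) = UNIV"
    and L: "submod scale T L" "K \<subseteq> L" and p: "p > 0" "\<And>v. of_int p *s v \<in> L"
    and rel: "\<And>t. t \<in> T \<Longrightarrow> \<exists>i j. i < j \<and> (\<forall>v. (t ^ i - t ^ j) *s v \<in> L)"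
  shows "fin_mod UNIV L"
proof -
  have "\<exists>W. Y \<subseteq> W \<and> submod scale T' W \<and> fin_mod W L" if "finite T'" "T' \<subseteq> T" for T'
    using that
  proof (induction T')
    case empty
    have "submod scale {} L" using L(1) submod_antimono by blast
    then have "fin_mod (submod scale {} hull Y) L"
      using fin_mod_hull_empty[OF fin(2)] p by blast
    then show ?case using submod_hull[of scale "{}" Y] hull_subset[of Y] by blast
  next
    case (insert t T')
    then obtain W where W: "Y \<subseteq> W" "submod scale T' W" "fin_mod W L" by blast
    obtain i j where ij: "i < j" "\<And>v. (t ^ i - t ^ j) *s v \<in> L" using rel insert.prems by blast
    have "t ^ j *s w \<in> {c + k |c k. c \<in> poly_span scale t W j \<and> k \<in> L}" if w: "w \<in> W" for w
    proof (rule sumsetI)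
      have "t ^ i *s w \<in> poly_span scale t W (Suc i)"
        by (rule poly_span_SucI[OF w submod_zero[OF submod_poly_span[OF W(2)]]]) simp
      then show "t ^ i *s w \<in> poly_span scale t W j" using poly_span_mono[OF W(2), of "Suc i" j t] ij(1) by auto
      show "- ((t ^ i - t ^ j) *s w) \<in> L" by (rule submod_uminus[OF L(1) ij(2)])
      show "t ^ j *s w = t ^ i *s w + - ((t ^ i - t ^ j) *s w)" by (simp add: scale_left_diff_distrib)
    qed
    moreover have "submod scale (insert t T') L" using submod_antimono[OF L(1)] insert.prems by blast
    ultimately obtain W' where "W \<subseteq> W'" "submod scale (insert t T') W'" "fin_mod W' L"
      using fin_mod_adjoin[OF W(2,3)] by blast
    then show ?case using W(1) by blast
  qed
  then obtain W where W: "Y \<subseteq> W" "submod scale T W" "fin_mod W L" using fin(1) by blast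
  show ?thesis by (rule fin_mod_UNIV[OF gen L W])
qed

text \<open>By Zorn's lemma. A set \<open>E\<close> is avoided instead of a single point because
  complements of a subgroup \<open>P\<close> are found with \<open>E = P - {0}\<close>.\<close>

lemma exists_maximal_avoiding:
  assumes "submod scale T K" "K \<inter> E = {}"
  obtains M where "submod scale T M" "K \<subseteq> M" "M \<inter> E = {}"
    "\<And>L. submod scale T L \<Longrightarrow> M \<subseteq> L \<Longrightarrow> L \<noteq> M \<Longrightarrow> L \<inter> E \<noteq> {}"
proof -
  let ?\<A> = "{L. submod scale T L \<and> K \<subseteq> L \<and> L \<inter> E = {}}"
  have "\<exists>M\<in>?\<A>. \<forall>X\<in>?\<A>. M \<subseteq> X \<longrightarrow> X = M"
  proof (rule subset_Zorn)
    fix C assume C: "subset.chain ?\<A> C"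
    show "\<exists>U\<in>?\<A>. \<forall>X\<in>C. X \<subseteq> U"
    proof (cases "C = {}")
      case True
      then show ?thesis using assms by blast
    next
      case False
      have sub: "X \<in> C \<Longrightarrow> submod scale T X" for X using C unfolding subset.chain_def by blast
      have "submod scale T (\<Union>C)"
      proof (rule submodI)
        show "0 \<in> \<Union>C" using False sub submod_zero[of scale T] by blast
        fix x y assume "x \<in> \<Union>C" "y \<in> \<Union>C"
        then obtain X Y where XY: "X \<in> C" "x \<in> X" "Y \<in> C" "y \<in> Y" by blast
        then have "X \<subseteq> Y \<or> Y \<subseteq> X" using C unfolding subset.chain_def by blast
        then show "x - y \<in> \<Union>C"
          using XY submod_diff[OF sub, of X x y] submod_diff[OF sub, of Y x y] by blast
      next
        fix t x assume t: "t \<in> T" and "x \<in> \<Union>C"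
        then obtain X where X: "X \<in> C" "x \<in> X" by blast
        show "t *s x \<in> \<Union>C" using submod_scale[OF sub[OF X(1)] t X(2)] X(1) by blast
      qed
      moreover have "K \<subseteq> X \<and> X \<inter> E = {}" if "X \<in> C" for X
        using C that unfolding subset.chain_def by blast
      then have "K \<subseteq> \<Union>C" "\<Union>C \<inter> E = {}" using False by blast+
      ultimately show ?thesis by blast
    qed
  qed
  then obtain M where M: "M \<in> ?\<A>" "\<forall>X\<in>?\<A>. M \<subseteq> X \<longrightarrow> X = M" by (elim bexE)
  show ?thesis
  proof (rule that[of M])
    fix L assume L: "submod scale T L" "M \<subseteq> L" "L \<noteq> M"
    show "L \<inter> E \<noteq> {}"
    proof
      assume "L \<inter> E = {}"
      with L M(1) have "L \<in> ?\<A>" by blast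
      then have "L = M" using bspec[OF M(2)] L(2) by simp
      then show False using L(3) by simp
    qed
  qed (use M(1) in auto)
qed

text \<open>P. Hall's theorem. Modulo a submodule \<open>M\<close> that is maximal among those avoiding \<open>m\<close>, the
  annihilator of \<open>m\<close> is a maximal ideal and consists of nilpotent operators.\<close>

theorem residually_finite:
  assumes fin: "finite T" "finite Y" and K: "submod scale T K"
    and gen: "submod scale T hull (K \<union> Y) = UNIV" and m: "m \<notin> K"
  shows "\<exists>L. submod scale T L \<and> K \<subseteq> L \<and> m \<notin> L \<and> fin_mod UNIV L"
proof -
  note A = subrg_ring_gen[of T]
  obtain M where M: "submod scale T M" "K \<subseteq> M" "m \<notin> M"
    and maximal: "\<And>L. submod scale T L \<Longrightarrow> M \<subseteq> L \<Longrightarrow> L \<noteq> M \<Longrightarrow> m \<in> L"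
    using exists_maximal_avoiding[OF K, of "{m}"] m by auto
  have "submod scale T hull (K \<union> Y) \<subseteq> submod scale T hull (M \<union> Y)"
    using M(2) by (intro hull_mono) auto
  then have genM: "submod scale T hull (M \<union> Y) = UNIV" using gen by auto
  note M_scale = scale_ring_gen_closed[OF M(1)]
  define I where "I = {a. a *s m \<in> M}"
  have I: "submod (*) T I"
    by (rule submodI) (auto simp: I_def scale_left_diff_distrib simp flip: scale_scale
        intro: submod_zero[OF M(1)] submod_diff[OF M(1)] submod_scale[OF M(1)])
  have I1: "1 \<notin> I" using M(3) by (simp add: I_def)
  have "\<exists>b\<in>ring_gen T. a * b - 1 \<in> I" if a: "a \<in> ring_gen T" "a \<notin> I" for a
  proof -
    \<comment> \<open>\<open>?L\<close> is \<open>M\<close> plus the multiples of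
      \<open>a *s m\<close>. It is larger than \<open>M\<close>, hence contains \<open>m\<close>,
      and the coefficient found there inverts \<open>a\<close> modulo \<open>I\<close>.\<close>
    let ?L = "{x. \<exists>b\<in>ring_gen T. x - (b * a) *s m \<in> M}"
    have "submod scale T ?L"
    proof (rule submodI)
      show "0 \<in> ?L" using submod_zero[OF M(1)] subrg_zero[OF A] by (auto intro!: bexI[of _ 0])
      fix x y assume "x \<in> ?L" "y \<in> ?L"
      then obtain b c where bc: "b \<in> ring_gen T" "c \<in> ring_gen T" "x - (b * a) *s m \<in> M" "y - (c * a) *s m \<in> M" by blast
      have eq: "(x - y) - ((b - c) * a) *s m = (x - (b * a) *s m) - (y - (c * a) *s m)"
        by (simp add: left_diff_distrib scale_left_diff_distrib)
      have "(x - y) - ((b - c) * a) *s m \<in> M" unfolding eq by (rule submod_diff[OF M(1) bc(3,4)])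
      then show "x - y \<in> ?L" using subrg_diff[OF A bc(1,2)] by blast
    next
      fix t x assume t: "t \<in> T" and "x \<in> ?L"
      then obtain b where b: "b \<in> ring_gen T" "x - (b * a) *s m \<in> M" by blast
      have "t *s x - ((t * b) * a) *s m \<in> M"
        using submod_scale[OF M(1) t b(2)] by (simp add: scale_right_diff_distrib mult.assoc)
      then show "t *s x \<in> ?L" using subrg_mult[OF A ring_gen_inc[OF t] b(1)] by blast
    qed
    moreover have "M \<subseteq> ?L" using subrg_zero[OF A] by (auto intro!: bexI[of _ 0])
    moreover have "a *s m \<in> ?L" using one_in_ring_gen submod_zero[OF M(1)] by (auto intro!: bexI[of _ 1])
    then have "?L \<noteq> M" using a(2) by (auto simp: I_def)
    ultimately have "m \<in> ?L" by (rule maximal)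
    then obtain b where b: "b \<in> ring_gen T" "m - (b * a) *s m \<in> M" by blast
    have eq: "(a * b - 1) *s m = - (m - (b * a) *s m)" by (simp add: scale_left_diff_distrib mult.commute)
    have "a * b - 1 \<in> I" unfolding I_def mem_Collect_eq eq by (rule submod_uminus[OF M(1) b(2)])
    then show ?thesis using b(1) by blast
  qed
  then have finI: "fin_mod (ring_gen T) I" by (rule finitely_generated_field_finite[OF fin(1) I I1])
  have nilpotent: "\<exists>s. \<forall>v. a ^ s *s v \<in> M" if a: "a \<in> ring_gen T" "a \<in> I" for a
  proof -
    \<comment> \<open>Fitting's argument: the kernels \<open>L n\<close> of the powers of
      \<open>a\<close> modulo \<open>M\<close> become stationary, and from then on kernel and image
      of \<open>a ^ s\<close> meet only in zero modulo \<open>M\<close>. As \<open>m\<close> is in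
      the kernel, it is not in the image, which is therefore zero modulo \<open>M\<close> by
      maximality.\<close>
    define L where "L n = {v. a ^ n *s v \<in> M}" for n
    have ra: "a ^ n \<in> ring_gen T" for n by (rule subrg_power[OF A a(1)])
    have L: "submod scale T (L n)" for n
      by (rule submodI) (auto simp: L_def scale_right_diff_distrib scale_left_commute[of "a ^ n"]
        simp del: scale_scale intro: submod_zero[OF M(1)] submod_diff[OF M(1)] submod_scale[OF M(1)])
    have L_Suc: "L n \<subseteq> L (Suc n)" for n
      using M_scale[OF a(1)] by (auto simp: L_def simp flip: scale_scale)
    have "M \<subseteq> L n" for n using M_scale[OF ra] by (auto simp: L_def)
    from ascending_chain[of T Y M L, OF fin M(1) genM L this L_Suc]
    obtain N where N: "\<And>n. n \<ge> N \<Longrightarrow> L n = L N" by blast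
    \<comment> \<open>\<open>Suc N\<close> and not \<open>N\<close>, since one factor
      \<open>a\<close> is spent on moving \<open>m\<close> into \<open>M\<close>.\<close>
    define s where "s = Suc N"
    have am: "a ^ s *s m \<in> M"
      using M_scale[OF ra[of N], of "a *s m"] a(2) by (simp add: s_def I_def power_commutes)
    let ?E = "{k + a ^ s *s v |k v. k \<in> M}"
    have "m \<notin> ?E"
    proof
      assume "m \<in> ?E"
      then obtain k v where kv: "m = k + a ^ s *s v" "k \<in> M" by blast
      have "a ^ (s + s) *s v = a ^ s *s m - a ^ s *s k"
        by (simp add: kv(1) scale_right_distrib power_add)
      then have "v \<in> L (s + s)" using submod_diff[OF M(1) am M_scale[OF ra kv(2)]] by (simp add: L_def)
      then have "v \<in> L s" using N[of s] N[of "s + s"] by (simp add: s_def)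
      then show False using kv submod_add[OF M(1)] M(3) by (auto simp: L_def)
    qed
    moreover have "M \<subseteq> ?E" by (rule subsetI, rule plus_rangeI[of _ _ _ _ 0]) auto
    ultimately have "?E = M" using maximal[OF submod_plus_range[OF M(1)]] by blast
    then have "a ^ s *s v \<in> M" for v
      using plus_rangeI[OF submod_zero[OF M(1)], of "a ^ s *s v" "a ^ s" v] by simp
    then show ?thesis by blast
  qed
  obtain i j where "i < j" "of_nat i - of_nat j \<in> I"
    using pigeonhole_fin_mod[OF finI I, of of_nat] scale_of_int_closed
      module.scale_of_int_closed[OF module_times submod_ring_gen one_in_ring_gen, of "int n" T for n] by auto
  then have p: "int (j - i) > 0" "of_int (int (j - i)) \<in> I"
    using submod_uminus[OF I, of "of_nat i - of_nat j"] by (auto simp: of_nat_diff)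
  have "\<exists>i j. i < j \<and> t ^ i - t ^ j \<in> I" if "t \<in> T" for t
    by (rule pigeonhole_fin_mod[OF finI I]) (rule subrg_power[OF A ring_gen_inc[OF that]])
  then obtain i' j' where ij: "\<And>t. t \<in> T \<Longrightarrow> i' t < j' t \<and> t ^ i' t - t ^ j' t \<in> I" by metis
  \<comment> \<open>A positive integer in \<open>I\<close> and one relation in \<open>I\<close> for
    each generator. All of them act nilpotently modulo \<open>M\<close>, and where they act as zero
    \<open>fin_mod_of_relations\<close> applies.\<close>
  define E where "E = insert (of_int (int (j - i))) ((\<lambda>t. t ^ i' t - t ^ j' t) ` T)"
  have p_in: "of_int (int (j - i)) \<in> ring_gen T"
    using module.scale_of_int_closed[OF module_times submod_ring_gen one_in_ring_gen, of "int (j - i)" T] by simp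
  have "fin_mod UNIV M"
  proof (rule fin_mod_nilpotents[OF _ _ M(1)])
    show "finite E" using fin(1) by (simp add: E_def)
    show E: "E \<subseteq> ring_gen T"
      using p_in subrg_diff[OF A subrg_power[OF A ring_gen_inc] subrg_power[OF A ring_gen_inc]]
      by (auto simp: E_def)
    show "\<exists>s. \<forall>v. e ^ s *s v \<in> M" if "e \<in> E" for e
      by (rule nilpotent) (use that E p ij in \<open>auto simp: E_def\<close>)
    fix L assume L: "submod scale T L" "M \<subseteq> L" "\<And>e v. e \<in> E \<Longrightarrow> e *s v \<in> L"
    show "fin_mod UNIV L"
    proof (rule fin_mod_of_relations[OF fin genM L(1,2) p(1)])
      show "of_int (int (j - i)) *s v \<in> L" for v by (rule L(3)) (simp add: E_def)
      show "\<exists>i j. i < j \<and> (\<forall>v. (t ^ i - t ^ j) *s v \<in> L)" if "t \<in> T" for t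
        using ij[OF that] L(3)[of "t ^ i' t - t ^ j' t"] that by (auto simp: E_def)
    qed
  qed
  then show ?thesis using M by blast
qed

end

section \<open>Finitely generated free abelian groups\<close>

lemma module_frag_cmul: "module (frag_cmul :: int \<Rightarrow> ('a \<Rightarrow>\<^sub>0 int) \<Rightarrow> _)"
  by unfold_locales (auto simp: frag_cmul_distrib frag_cmul_distrib2)

abbreviation addsub :: "('a \<Rightarrow>\<^sub>0 int) set \<Rightarrow> bool" where
  "addsub \<equiv> submod frag_cmul {}"

definition sumset :: "'v::ab_group_add set \<Rightarrow> 'v set \<Rightarrow> 'v set" where
  "sumset K L = {k + l |k l. k \<in> K \<and> l \<in> L}"

lemma addsub_sumset: "addsub K \<Longrightarrow> addsub L \<Longrightarrow> addsub (sumset K L)"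
  unfolding sumset_def by (rule module.submod_sumset[OF module_frag_cmul])

lemma sumset_subset: "submod s T K \<Longrightarrow> submod s T L \<Longrightarrow> K \<subseteq> sumset K L \<and> L \<subseteq> sumset K L"
  using submod_zero[of s T K] submod_zero[of s T L] by (force simp: sumset_def)

lemma sumset_mem: "k \<in> K \<Longrightarrow> l \<in> L \<Longrightarrow> k + l \<in> sumset K L"
  by (auto simp: sumset_def)

text \<open>The free abelian group on the whole type is finitely generated modulo \<open>off X\<close>, and
  \<open>off X\<close> meets the free abelian group on \<open>X\<close> trivially. This replaces passing to a type
  with carrier \<open>X\<close>.\<close>

definition off :: "'a set \<Rightarrow> ('a \<Rightarrow>\<^sub>0 int) set" where
  "off X = {q. \<forall>x\<in>X. Poly_Mapping.lookup q x = 0}"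

lemma addsub_off: "addsub (off X)"
  by (rule submodI) (auto simp: off_def lookup_minus)

lemma off_Int: "Poly_Mapping.keys q \<subseteq> X \<Longrightarrow> q \<in> off X \<Longrightarrow> q = 0"
proof (rule poly_mapping_eqI)
  fix k
  assume "Poly_Mapping.keys q \<subseteq> X" "q \<in> off X"
  then show "Poly_Mapping.lookup q k = Poly_Mapping.lookup 0 k"
    by (cases "k \<in> X") (auto simp: off_def in_keys_iff)
qed

lemma addsub_keys: "addsub {q. Poly_Mapping.keys q \<subseteq> X}"
  by (rule submodI) (use keys_diff in fastforce)+

lemma addsub_induct_UNIV:
  assumes L: "addsub L" and "\<And>x. frag_of x \<in> L"
  shows "q \<in> L"
  by (rule frag_induction[of q UNIV "\<lambda>q. q \<in> L"]) (use assms submod_zero[OF L] submod_diff[OF L] in auto)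

lemma addsub_hull_UNIV:
  assumes "off X \<subseteq> U"
  shows "addsub hull (U \<union> frag_of ` X) = UNIV"
proof -
  have "frag_of x \<in> addsub hull (U \<union> frag_of ` X)" for x
  proof (cases "x \<in> X")
    case False
    then have "frag_of x \<in> off X" by (auto simp: off_def)
    then show ?thesis using assms by (intro hull_inc) auto
  qed (auto intro: hull_inc)
  then show ?thesis using addsub_induct_UNIV[OF submod_hull] by blast
qed

text \<open>One point is separated by P. Hall's theorem with no scalars; finitely many points are
  handled by intersecting. \<open>off X \<subseteq> U\<close> makes the quotient finitely
  generated.\<close>

lemma separate_finite_set:
  assumes X: "finite X" and U: "addsub U" "off X \<subseteq> U" and "finite E" "E \<inter> U = {}"
  shows "\<exists>V. addsub V \<and> U \<subseteq> V \<and> E \<inter> V = {} \<and> fin_mod UNIV V"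
  using assms(4,5)
proof (induction E)
  case empty
  have "addsub UNIV" "fin_mod (UNIV :: ('a \<Rightarrow>\<^sub>0 int) set) UNIV" by (auto simp: submod_def fin_mod_def)
  then show ?case by (intro exI[of _ UNIV]) auto
next
  case (insert e E)
  then obtain V where V: "addsub V" "U \<subseteq> V" "E \<inter> V = {}" "fin_mod UNIV V" by auto
  obtain L where L: "addsub L" "U \<subseteq> L" "e \<notin> L" "fin_mod UNIV L"
    using module.residually_finite[OF module_frag_cmul finite.emptyI finite_imageI[OF X] U(1) addsub_hull_UNIV[OF U(2)], of e]
      insert.prems by blast
  show ?case
    by (rule exI[of _ "V \<inter> L"]) (use V L submod_Int[OF V(1) L(1)] fin_mod_Int[OF V(4) L(4) V(1) L(1)] in blast)
qed

lemma fin_mod_torsion: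
  assumes X: "finite X" and U: "addsub U" "off X \<subseteq> U"
    and "\<And>x. x \<in> X \<Longrightarrow> \<exists>n>0. frag_cmul n (frag_of x) \<in> U"
  shows "fin_mod UNIV U"
proof -
  have "fin_mod (addsub hull (frag_of ` X)) U"
    using assms(4) by (intro module.fin_mod_hull_empty[OF module_frag_cmul] finite_imageI X U(1)) auto
  from module.fin_mod_UNIV[OF module_frag_cmul addsub_hull_UNIV[OF U(2)] U(1) order.refl hull_subset submod_hull this]
  show ?thesis .
qed

text \<open>\<open>R\<close> is maximal among the subgroups containing \<open>off X\<close> that
  meet \<open>P\<close> trivially. If \<open>frag_of x\<close> is not in \<open>R\<close>, adjoining
  it to \<open>R\<close> produces a nonzero element of \<open>P\<close>, so a nonzero multiple of
  \<open>frag_of x\<close> lies in \<open>P + R\<close>. The quotient by \<open>P + R\<close> is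
  thus finitely generated and torsion.\<close>

lemma exists_complement:
  assumes X: "finite X" and P: "addsub P" "P \<inter> off X = {0}"
  shows "\<exists>R. addsub R \<and> off X \<subseteq> R \<and> P \<inter> R = {0} \<and> fin_mod UNIV (sumset P R)"
proof -
  have "off X \<inter> (P - {0}) = {}" using P(2) by blast
  then obtain R where R: "addsub R" "off X \<subseteq> R" "R \<inter> (P - {0}) = {}"
    and maximal: "\<And>L. addsub L \<Longrightarrow> R \<subseteq> L \<Longrightarrow> L \<noteq> R \<Longrightarrow> L \<inter> (P - {0}) \<noteq> {}"
    using module.exists_maximal_avoiding[OF module_frag_cmul addsub_off] by metis
  note PR = addsub_sumset[OF P(1) R(1)]
  note sub = sumset_subset[OF P(1) R(1)]
  have "fin_mod UNIV (sumset P R)"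
  proof (rule fin_mod_torsion[OF X PR])
    show "off X \<subseteq> sumset P R" using R(2) sub by blast
    fix x assume "x \<in> X"
    let ?q = "frag_of x"
    show "\<exists>n>0. frag_cmul n ?q \<in> sumset P R"
    proof (cases "?q \<in> R")
      case True
      then show ?thesis using sub by (intro exI[of _ 1]) auto
    next
      case False
      let ?L = "addsub hull (insert ?q R)"
      have "?L \<noteq> R" using hull_inc[of ?q "insert ?q R" addsub] False by blast
      moreover have "R \<subseteq> ?L" using hull_subset[of "insert ?q R" addsub] by blast
      ultimately obtain p where p: "p \<in> ?L" "p \<in> P" "p \<noteq> 0" using maximal[OF submod_hull] by blast
      then obtain k r where kr: "p = frag_cmul k ?q + r" "r \<in> R"
        using module.submod_hull_insert[OF module_frag_cmul, of ?q R] hull_same[of addsub R, OF R(1)] by auto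
      have "k \<noteq> 0" using kr p R(3) by auto
      have "p - r \<in> sumset P R" using submod_diff[OF PR] sub p(2) kr(2) by blast
      then have *: "frag_cmul k ?q \<in> sumset P R" using kr(1) by simp
      then show ?thesis
      proof (cases "k > 0")
        case False
        then show ?thesis using submod_uminus[OF PR *] \<open>k \<noteq> 0\<close> by (intro exI[of _ "- k"]) auto
      qed blast
    qed
  qed
  moreover have "P \<inter> R = {0}" using R(3) submod_zero[OF P(1)] submod_zero[OF R(1)] by blast
  ultimately show ?thesis using R by blast
qed

text \<open>The last condition keeps different cosets of \<open>P\<close> with representatives in
  \<open>C\<close> apart modulo \<open>P + R\<close>. A complement \<open>R1\<close> is cut down by
  a finite-index \<open>U\<close> that contains \<open>P\<close> and avoids the differences in
  question.\<close>

lemma exists_complement_separating: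
  assumes X: "finite X" and P: "addsub P" "\<And>p. p \<in> P \<Longrightarrow> Poly_Mapping.keys p \<subseteq> X"
    and C: "finite C" "\<And>c. c \<in> C \<Longrightarrow> Poly_Mapping.keys c \<subseteq> X"
  shows "\<exists>R. addsub R \<and> off X \<subseteq> R \<and> P \<inter> R = {0} \<and> fin_mod UNIV (sumset P R) \<and>
    (\<forall>c\<in>C. \<forall>c'\<in>C. c - c' \<in> sumset P R \<longrightarrow> c - c' \<in> P)"
proof -
  have P_off: "P \<inter> off X = {0}" 
    using off_Int[OF P(2)] submod_zero[OF P(1)] submod_zero[OF addsub_off, of X] by auto
  obtain R1 where R1: "addsub R1" "off X \<subseteq> R1" "P \<inter> R1 = {0}" "fin_mod UNIV (sumset P R1)"
    using exists_complement[OF X P(1) P_off] by blast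
  define E where "E = (\<lambda>(c, c'). c - c') ` (C \<times> C) - P"
  have E: "finite E" unfolding E_def using C(1) by blast
  have "e \<notin> sumset P (off X)" if e: "e \<in> E" for e
  proof
    assume "e \<in> sumset P (off X)"
    then obtain p j where pj: "e = p + j" "p \<in> P" "j \<in> off X" by (auto simp: sumset_def)
    obtain c c' where c: "c \<in> C" "c' \<in> C" "e = c - c'" using e by (auto simp: E_def)
    have "Poly_Mapping.keys (c - c' - p) \<subseteq> X"
      using C(2)[OF c(1)] C(2)[OF c(2)] P(2)[OF pj(2)] keys_diff[of "c - c'" p] keys_diff[of c c'] by blast
    moreover have "c - c' - p = j" using pj(1) c(3) by simp
    ultimately have "j = 0" using off_Int pj(3) by metis
    then show False using pj e by (simp add: E_def)
  qed
  then have "E \<inter> sumset P (off X) = {}" by blast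
  then obtain U where U: "addsub U" "sumset P (off X) \<subseteq> U" "E \<inter> U = {}" "fin_mod UNIV U"
    using separate_finite_set[OF X addsub_sumset[OF P(1) addsub_off] _ E]
      sumset_subset[OF P(1) addsub_off[of X]] by blast
  have PU: "P \<subseteq> U" "off X \<subseteq> U" using U(2) sumset_subset[OF P(1) addsub_off[of X]] by blast+
  define R where "R = R1 \<inter> U"
  have R: "addsub R" unfolding R_def by (rule submod_Int[OF R1(1) U(1)])
  \<comment> \<open>The modular law, valid since \<open>P \<subseteq> U\<close>; it keeps the index
    of \<open>P + R\<close> finite.\<close>
  have "sumset P R1 \<inter> U \<subseteq> sumset P R"
  proof
    fix u assume u: "u \<in> sumset P R1 \<inter> U"
    then obtain p r where pr: "u = p + r" "p \<in> P" "r \<in> R1" by (auto simp: sumset_def)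
    then have "r \<in> U" using submod_diff[OF U(1), of u p] u PU(1) by auto
    then show "u \<in> sumset P R" using pr by (auto simp: sumset_def R_def)
  qed
  then have "fin_mod UNIV (sumset P R)"
    using fin_mod_mono[OF fin_mod_Int[OF R1(4) U(4) addsub_sumset[OF P(1) R1(1)] U(1)] order.refl] by blast
  moreover have "sumset P R \<subseteq> U"
    using submod_add[OF U(1)] PU(1) by (auto simp: sumset_def R_def)
  then have "c - c' \<in> P" if "c \<in> C" "c' \<in> C" "c - c' \<in> sumset P R" for c c'
    using that U(3) by (auto simp: E_def)
  moreover have "P \<inter> R = {0}" "off X \<subseteq> R"
    using R1 PU(2) submod_zero[OF R] submod_zero[OF P(1)] by (auto simp: R_def)
  ultimately show ?thesis using R by blast
qed

text \<open>Finitely many elements of \<open>P\<close> represent its cosets outside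
  \<open>P'\<close>. They also avoid \<open>P' + off X\<close>, so some finite-index
  \<open>U\<close> containing \<open>P'\<close> excludes them, and with them their whole
  cosets.\<close>

lemma exists_finite_index_meeting:
  assumes X: "finite X" and P: "addsub P" "P \<inter> off X = {0}" and P': "addsub P'" "P' \<subseteq> P" "fin_mod P P'"
  shows "\<exists>U. addsub U \<and> fin_mod UNIV U \<and> U \<inter> P \<subseteq> P'"
proof -
  obtain Z where Z: "finite Z" "\<And>p. p \<in> P \<Longrightarrow> \<exists>z\<in>Z. p - z \<in> P'" using P'(3) unfolding fin_mod_def by blast
  define E where "E = (Z \<inter> P) - P'"
  have E: "finite E" using Z(1) by (simp add: E_def)
  have "e \<notin> sumset P' (off X)" if "e \<in> E" for e
  proof
    assume "e \<in> sumset P' (off X)"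
    then obtain p j where pj: "e = p + j" "p \<in> P'" "j \<in> off X" by (auto simp: sumset_def)
    have "e - p \<in> P" using submod_diff[OF P(1), of e p] that pj(2) P'(2) by (auto simp: E_def)
    then have "j = 0" using pj P(2) by auto
    then show False using pj that by (simp add: E_def)
  qed
  then have "E \<inter> sumset P' (off X) = {}" by blast
  then obtain U where U: "addsub U" "sumset P' (off X) \<subseteq> U" "E \<inter> U = {}" "fin_mod UNIV U"
    using separate_finite_set[OF X addsub_sumset[OF P'(1) addsub_off] _ E]
      sumset_subset[OF P'(1) addsub_off[of X]] by blast
  have "p \<in> P'" if p: "p \<in> U" "p \<in> P" for p
  proof (rule ccontr)
    assume np: "p \<notin> P'"
    obtain z where z: "z \<in> Z" "p - z \<in> P'" using Z(2) p by blast
    have zP: "z \<in> P" using submod_diff[OF P(1) p(2), of "p - z"] z(2) P'(2) by auto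
    have zU: "z \<in> U" using submod_diff[OF U(1) p(1), of "p - z"] z(2) U(2) sumset_subset[OF P'(1) addsub_off[of X]] by auto
    have "z \<notin> P'" using submod_add[OF P'(1) z(2), of z] np by auto
    then show False using z zP zU U(3) by (auto simp: E_def)
  qed
  then show ?thesis using U by blast
qed

section \<open>Modules over the group ring\<close>

text \<open>Multiplication of finitely supported functions is convolution, so those on the free
  abelian group form its integral group ring, in which \<open>frag_of q\<close> is the group element
  \<open>q\<close>.\<close>

type_synonym 'a group_ring = "('a \<Rightarrow>\<^sub>0 int) \<Rightarrow>\<^sub>0 int"

definition gscale :: "'a group_ring \<Rightarrow> ('a \<Rightarrow> 'a group_ring) \<Rightarrow> 'a \<Rightarrow> 'a group_ring" where
  "gscale r v = (\<lambda>x. r * v x)"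

definition act :: "('a \<Rightarrow>\<^sub>0 int) \<Rightarrow> ('a \<Rightarrow> 'a group_ring) \<Rightarrow> 'a \<Rightarrow> 'a group_ring" where
  "act q = gscale (frag_of q)"

lemma module_gscale: "module gscale"
  by unfold_locales (auto simp: gscale_def fun_eq_iff algebra_simps)

lemma act_apply: "act q v x = frag_of q * v x"
  by (simp add: act_def gscale_def)

lemma act_act: "act p (act q v) = act (p + q) v"
  by (simp add: act_apply fun_eq_iff mult_single flip: mult.assoc)

lemma act_0 [simp]: "act 0 v = v"
  by (simp add: act_apply fun_eq_iff)

lemma act_zero [simp]: "act p 0 = 0"
  by (simp add: act_apply fun_eq_iff)

lemma act_diff: "act p (v - w) = act p v - act p w"
  and act_add: "act p (v + w) = act p v + act p w"
  and act_uminus: "act p (- v) = - act p v"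
  by (simp_all add: act_apply fun_eq_iff algebra_simps)

lemma act_in: "submod gscale (frag_of ` Q) L \<Longrightarrow> q \<in> Q \<Longrightarrow> v \<in> L \<Longrightarrow> act q v \<in> L"
  unfolding act_def by (rule submod_scale) auto

lemma submod_actI:
  assumes "0 \<in> L" "\<And>v w. v \<in> L \<Longrightarrow> w \<in> L \<Longrightarrow> v - w \<in> L" "\<And>q v. q \<in> Q \<Longrightarrow> v \<in> L \<Longrightarrow> act q v \<in> L"
  shows "submod gscale (frag_of ` Q) L"
  by (rule submodI) (use assms in \<open>auto simp: act_def\<close>)

text \<open>Inverses are listed among the scalars because the group ring of a subgroup is generated
  as a ring by its generators together with their inverses.\<close>

lemma act_hull_in:
  assumes L: "submod gscale (frag_of ` (G \<union> uminus ` G)) L" and "p \<in> addsub hull G" "v \<in> L"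
  shows "act p v \<in> L"
proof -
  let ?S = "{p. \<forall>v\<in>L. act p v \<in> L \<and> act (- p) v \<in> L}"
  have "addsub ?S"
  proof (rule submodI)
    fix p q assume p: "p \<in> ?S" and q: "q \<in> ?S"
    have "act (p - q) v \<in> L \<and> act (- (p - q)) v \<in> L" if v: "v \<in> L" for v
    proof
      have "act p (act (- q) v) \<in> L" using p q v by blast
      then show "act (p - q) v \<in> L" by (simp add: act_act)
      have "act q (act (- p) v) \<in> L" using p q v by blast
      then show "act (- (p - q)) v \<in> L" by (simp add: act_act)
    qed
    then show "p - q \<in> ?S" by blast
  qed auto
  moreover have "G \<subseteq> ?S" using act_in[OF L] by auto
  ultimately have "addsub hull G \<subseteq> ?S" by (rule hull_minimal[rotated])
  then show ?thesis using assms by blast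
qed

section \<open>Passage to the group ring of a quotient\<close>

definition coset_of :: "('a \<Rightarrow>\<^sub>0 int) set \<Rightarrow> ('a \<Rightarrow>\<^sub>0 int) \<Rightarrow> ('a \<Rightarrow>\<^sub>0 int) set" where
  "coset_of R q = {q'. q - q' \<in> R}"

lemma coset_of_eq_iff:
  assumes R: "addsub R"
  shows "coset_of R q = coset_of R q' \<longleftrightarrow> q - q' \<in> R"
proof
  assume "coset_of R q = coset_of R q'"
  moreover have "q' \<in> coset_of R q'" using submod_zero[OF R] by (simp add: coset_of_def)
  ultimately have "q' \<in> coset_of R q" by simp
  then show "q - q' \<in> R" by (simp add: coset_of_def)
next
  assume d: "q - q' \<in> R"
  have "q - k \<in> R \<longleftrightarrow> q' - k \<in> R" for k
    using submod_add[OF R d, of "q' - k"] submod_diff[OF R _ d, of "q - k"] by auto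
  then show "coset_of R q = coset_of R q'" by (simp add: coset_of_def)
qed

lemma coset_of_add: "coset_of R (p + q) = (+) p ` coset_of R q"
proof (intro equalityI subsetI)
  fix k assume "k \<in> coset_of R (p + q)"
  then have "k - p \<in> coset_of R q" by (simp add: coset_of_def algebra_simps)
  then show "k \<in> (+) p ` coset_of R q" by (intro image_eqI[of _ _ "k - p"]) auto
qed (auto simp: coset_of_def algebra_simps)

text \<open>The natural map from \<open>\<int>[Q]\<close> to \<open>\<int>[Q/R]\<close>, with cosets
  kept as sets. Translation by \<open>q\<close> moves these sets, so the kernel is stable under
  multiplication by group elements.\<close>

definition collapse :: "('a \<Rightarrow>\<^sub>0 int) set \<Rightarrow> 'a group_ring \<Rightarrow> ('a \<Rightarrow>\<^sub>0 int) set \<Rightarrow>\<^sub>0 int" where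
  "collapse R = frag_extend (frag_of \<circ> coset_of R)"

lemma collapse_diff: "collapse R (f - g) = collapse R f - collapse R g"
  and collapse_0 [simp]: "collapse R 0 = 0"
  and collapse_of [simp]: "collapse R (frag_of q) = frag_of (coset_of R q)"
  by (simp_all add: collapse_def frag_extend_diff)

lemma collapse_mult: "collapse R (frag_of q * f) = frag_extend (frag_of \<circ> (`) ((+) q)) (collapse R f)"
  by (rule frag_induction[of f UNIV])
    (simp_all add: mult_single right_diff_distrib collapse_diff frag_extend_diff coset_of_add)

lemma collapse_shift: "addsub R \<Longrightarrow> r \<in> R \<Longrightarrow> collapse R (frag_of r * f) = collapse R f"
proof (rule frag_induction[of f UNIV "\<lambda>f. collapse R (frag_of r * f) = collapse R f"])
  fix q assume "addsub R" "r \<in> R"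
  then have "coset_of R (r + q) = coset_of R q" by (simp add: coset_of_eq_iff)
  then show "collapse R (frag_of r * frag_of q) = collapse R (frag_of q)" by (simp add: mult_single)
qed (simp_all add: right_diff_distrib collapse_diff)

text \<open>\<open>coset_of R\<close> is injective on \<open>S\<close>, so a left inverse of it
  carries \<open>collapse R f\<close> back to \<open>f\<close>.\<close>

lemma collapse_eq_0:
  assumes "addsub R" "Poly_Mapping.keys f \<subseteq> S" "\<And>k k'. k \<in> S \<Longrightarrow> k' \<in> S \<Longrightarrow> k - k' \<in> R \<Longrightarrow> k = k'"
    and "collapse R f = 0"
  shows "f = 0"
proof -
  have inj: "inj_on (coset_of R) S" using assms(1,3) by (auto simp: inj_on_def coset_of_eq_iff)
  define g where "g = inv_into S (coset_of R)"
  have "frag_extend (frag_of \<circ> g) (collapse R f) = frag_extend ((frag_of \<circ> g) \<circ> coset_of R) f"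
    unfolding collapse_def by (rule frag_extend_compose)
  also have "\<dots> = frag_extend frag_of f"
    by (rule frag_extend_eq) (use assms(2) inj in \<open>auto simp: g_def\<close>)
  also have "\<dots> = f" by (rule frag_expansion[symmetric])
  finally show ?thesis using assms(4) by simp
qed

text \<open>For finite \<open>C\<close>, vectors living on finitely many cosets of \<open>P\<close>,
  as do all elements of a finitely generated \<open>\<int>[P]\<close>-submodule of
  \<open>\<int>[Q]^X\<close>.\<close>

definition supported :: "'a set \<Rightarrow> ('a \<Rightarrow>\<^sub>0 int) set \<Rightarrow> ('a \<Rightarrow>\<^sub>0 int) set \<Rightarrow> ('a \<Rightarrow> 'a group_ring) set" where
  "supported X C P = {v. (\<forall>x. x \<notin> X \<longrightarrow> v x = 0) \<and> (\<forall>x\<in>X. \<forall>q\<in>Poly_Mapping.keys (v x). \<exists>c\<in>C. q - c \<in> P)}"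

lemma keys_frag_mult: "Poly_Mapping.keys (frag_of p * f) \<subseteq> (+) p ` Poly_Mapping.keys f"
  using keys_mult[of "frag_of p" f] by auto

lemma supported_zero: "0 \<in> supported X C P"
  by (simp add: supported_def)

lemma supported_diff: "v \<in> supported X C P \<Longrightarrow> w \<in> supported X C P \<Longrightarrow> v - w \<in> supported X C P"
  unfolding supported_def using keys_diff by fastforce

lemma supported_act:
  assumes "addsub P" "p \<in> P" "v \<in> supported X C P"
  shows "act p v \<in> supported X C P"
  unfolding supported_def
proof (intro CollectI conjI allI ballI impI)
  show "act p v x = 0" if "x \<notin> X" for x using assms(3) that by (simp add: supported_def act_apply)
  fix x q assume x: "x \<in> X" and "q \<in> Poly_Mapping.keys (act p v x)"
  then obtain k where k: "k \<in> Poly_Mapping.keys (v x)" "q = p + k"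
    using keys_frag_mult[of p "v x"] by (auto simp: act_apply)
  then obtain c where c: "c \<in> C" "k - c \<in> P" using assms(3) x unfolding supported_def by blast
  have "q - c = p + (k - c)" by (simp add: k)
  then show "\<exists>c\<in>C. q - c \<in> P" using submod_add[OF assms(1,2) c(2)] c(1) by metis
qed

lemma vector_in_submod:
  assumes X: "finite X" and L: "submod gscale T L"
    and off: "\<And>v. (\<And>x. x \<in> X \<Longrightarrow> v x = 0) \<Longrightarrow> v \<in> L"
    and basis: "\<And>x q. x \<in> X \<Longrightarrow> 0(x := frag_of q) \<in> L"
  shows "v \<in> L"
proof -
  have coord: "0(x := f) \<in> L" if "x \<in> X" for x f
  proof (rule frag_induction[of f UNIV "\<lambda>f. 0(x := f) \<in> L"])
    show "0(x := 0) \<in> L" using submod_zero[OF L] by (simp add: fun_upd_idem)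
    fix a b :: "'a group_ring" assume ab: "0(x := a) \<in> L" "0(x := b) \<in> L"
    have "0(x := a - b) = 0(x := a) - 0(x := b)" by (auto simp: fun_eq_iff)
    then show "0(x := a - b) \<in> L" using submod_diff[OF L ab] by simp
  qed (use basis that in auto)
  have "(\<lambda>x. if x \<in> X' then v x else 0) \<in> L" if "finite X'" "X' \<subseteq> X" for X'
    using that
  proof (induction X')
    case empty
    then show ?case using submod_zero[OF L] by (simp add: zero_fun_def)
  next
    case (insert x X')
    have "(\<lambda>y. if y \<in> insert x X' then v y else 0) = 0(x := v x) + (\<lambda>y. if y \<in> X' then v y else 0)"
      using insert.hyps by (auto simp: fun_eq_iff)
    then show ?case using submod_add[OF L coord insert.IH, of x "v x"] insert.prems by simp
  qed
  from this[OF X order.refl] have 1: "(\<lambda>x. if x \<in> X then v x else 0) \<in> L" .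
  have 2: "(\<lambda>x. if x \<in> X then 0 else v x) \<in> L" by (rule off) auto
  have 3: "v = (\<lambda>x. if x \<in> X then v x else 0) + (\<lambda>x. if x \<in> X then 0 else v x)" by (auto simp: fun_eq_iff)
  show ?thesis by (subst 3) (rule submod_add[OF L 1 2])
qed

text \<open>P. Hall's theorem needs a module that is finitely generated over
  \<open>\<int>[P]\<close>, which \<open>\<int>[Q]^X\<close> need not be, while
  \<open>\<int>[Q/R]^X\<close> is. Enlarging \<open>K\<close> by the kernel \<open>D\<close> of the
  passage to it does not capture \<open>m\<close>, because nonzero vectors supported on
  \<open>C + P\<close> are not in \<open>D\<close>.\<close>

lemma exists_invariant_finite_index:
  assumes X: "finite X" and G: "finite G" "\<And>q. q \<in> G \<Longrightarrow> Poly_Mapping.keys q \<subseteq> X"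
    and C: "finite C" "\<And>c. c \<in> C \<Longrightarrow> Poly_Mapping.keys c \<subseteq> X"
    and K: "submod gscale (frag_of ` (G \<union> uminus ` G)) K" "K \<subseteq> supported X C (addsub hull G)"
    and m: "m \<in> supported X C (addsub hull G)" "m \<notin> K"
  shows "\<exists>L L0. submod gscale (frag_of ` (G \<union> uminus ` G)) L \<and> K \<subseteq> L \<and> m \<notin> L \<and> L0 \<subseteq> L
    \<and> submod gscale (frag_of ` UNIV) L0 \<and> fin_mod UNIV L0"
proof -
  define P where "P = addsub hull G"
  let ?T = "frag_of ` (G \<union> uminus ` G)"
  have P: "addsub P" unfolding P_def by (rule submod_hull)
  have "P \<subseteq> {q. Poly_Mapping.keys q \<subseteq> X}"
    unfolding P_def by (rule hull_minimal) (use G addsub_keys in auto)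
  then have PX: "p \<in> P \<Longrightarrow> Poly_Mapping.keys p \<subseteq> X" for p by blast
  obtain R where R: "addsub R" "off X \<subseteq> R" "P \<inter> R = {0}" "fin_mod UNIV (sumset P R)"
    and sep: "\<And>c c'. c \<in> C \<Longrightarrow> c' \<in> C \<Longrightarrow> c - c' \<in> sumset P R \<Longrightarrow> c - c' \<in> P"
    using exists_complement_separating[OF X P PX C] by blast
  from R(4) obtain B where B: "finite B" "\<And>q. \<exists>b\<in>B. q - b \<in> sumset P R" unfolding fin_mod_def by blast
  have decompose: "\<exists>b\<in>B. \<exists>p\<in>P. \<exists>r\<in>R. q = p + r + b" for q
  proof -
    obtain b p r where "b \<in> B" "p \<in> P" "r \<in> R" "q - b = p + r" using B(2)[of q] by (auto simp: sumset_def)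
    moreover from this(4) have "q = p + r + b" by (simp add: algebra_simps)
    ultimately show ?thesis by blast
  qed
  \<comment> \<open>Coordinates outside \<open>X\<close> are unconstrained in \<open>D\<close>, so
    they are killed as well.\<close>
  define D where "D = {v :: 'a \<Rightarrow> 'a group_ring. \<forall>x\<in>X. collapse R (v x) = 0}"
  have D: "submod gscale (frag_of ` Q) D" for Q
    by (rule submod_actI) (auto simp: D_def collapse_diff act_apply collapse_mult)
  define K1 where "K1 = {k + d |k d. k \<in> K \<and> d \<in> D}"
  have K1: "submod gscale ?T K1" unfolding K1_def by (rule module.submod_sumset[OF module_gscale K(1) D])
  have DK1: "D \<subseteq> K1"
    unfolding K1_def by (rule subsetI, rule sumsetI[OF submod_zero[OF K(1)]]) auto
  have KK1: "K \<subseteq> K1"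
    unfolding K1_def by (rule subsetI, rule sumsetI[OF _ submod_zero[OF D]]) auto
  have mK1: "m \<notin> K1"
  proof
    assume "m \<in> K1"
    then obtain k d where kd: "m = k + d" "k \<in> K" "d \<in> D" by (auto simp: K1_def)
    then have "d = m - k" by simp
    then have d: "d \<in> supported X C P" using supported_diff[OF m(1), of k] K(2) kd(2) by (auto simp: P_def)
    have "d x = 0" for x
    proof (cases "x \<in> X")
      case True
      show ?thesis
      proof (rule collapse_eq_0[OF R(1)])
        show "Poly_Mapping.keys (d x) \<subseteq> {q. \<exists>c\<in>C. q - c \<in> P}" using d True by (auto simp: supported_def)
        show "collapse R (d x) = 0" using kd(3) True by (auto simp: D_def)
        fix q q' assume "q \<in> {q. \<exists>c\<in>C. q - c \<in> P}" "q' \<in> {q. \<exists>c\<in>C. q - c \<in> P}" and qq: "q - q' \<in> R"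
        then obtain c c' where c: "c \<in> C" "q - c \<in> P" "c' \<in> C" "q' - c' \<in> P" by blast
        \<comment> \<open>Support points congruent modulo \<open>R\<close> lie in the same coset of
          \<open>P\<close> by the choice of \<open>R\<close>, so their difference is in
          \<open>P \<inter> R\<close>.\<close>
        have "c - c' = ((q' - c') - (q - c)) + (q - q')" by simp
        also have "\<dots> \<in> sumset P R" by (intro sumset_mem submod_diff[OF P] c qq)
        finally have cc: "c - c' \<in> P" using sep c by blast
        have "q - q' = (q - c) - (q' - c') + (c - c')" by simp
        also have "\<dots> \<in> P" by (intro submod_add[OF P] submod_diff[OF P] c cc)
        finally have "q - q' \<in> P \<inter> R" using qq by blast
        then show "q = q'" using R(3) by auto
      qed
    qed (use d in \<open>auto simp: supported_def\<close>)
    then have "d = 0" by (simp add: fun_eq_iff)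
    then show False using kd m(2) by simp
  qed
  \<comment> \<open>Unit vectors translated by representatives of the finite quotient by
    \<open>P + R\<close>. Translations by \<open>P\<close> are available as scalars, and those by
    \<open>R\<close> are invisible modulo \<open>D\<close>.\<close>
  define Y where "Y = (\<lambda>(x, b). (0 :: 'a \<Rightarrow> 'a group_ring)(x := frag_of b)) ` (X \<times> B)"
  have gen: "submod gscale ?T hull (K1 \<union> Y) = UNIV"
  proof -
    let ?H = "submod gscale ?T hull (K1 \<union> Y)"
    have H: "submod gscale ?T ?H" by (rule submod_hull)
    have DH: "D \<subseteq> ?H" using DK1 hull_subset[of "K1 \<union> Y" "submod gscale ?T"] by blast
    have "v \<in> ?H" for v
    proof (rule vector_in_submod[OF X H])
      show "v \<in> ?H" if "\<And>x. x \<in> X \<Longrightarrow> v x = 0" for v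
        using that DH by (auto simp: D_def)
      fix x q assume x: "x \<in> X"
      obtain b p r where q: "b \<in> B" "p \<in> P" "r \<in> R" "q = p + r + b" using decompose[of q] by blast
      have "0(x := frag_of b) \<in> Y" using x q(1) by (auto simp: Y_def)
      then have "0(x := frag_of b) \<in> ?H" by (intro hull_inc) auto
      then have 1: "act p (0(x := frag_of b)) \<in> ?H" using act_hull_in[OF H] q(2) unfolding P_def by blast
      have "act p (0(x := frag_of b)) = 0(x := frag_of (p + b))" by (auto simp: fun_eq_iff act_apply mult_single)
      with 1 have 1: "0(x := frag_of (p + b)) \<in> ?H" by simp
      have "coset_of R q = coset_of R (p + b)" using q by (simp add: coset_of_eq_iff[OF R(1)])
      then have "0(x := frag_of q) - 0(x := frag_of (p + b)) \<in> D" by (auto simp: D_def collapse_diff)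
      then have "0(x := frag_of q) - 0(x := frag_of (p + b)) \<in> ?H" using DH by blast
      from submod_add[OF H this 1] show "0(x := frag_of q) \<in> ?H" by simp
    qed
    then show ?thesis by blast
  qed
  have "finite ?T" "finite Y" using G(1) X B(1) by (auto simp: Y_def)
  from module.residually_finite[OF module_gscale this K1 gen mK1]
  obtain L where L: "submod gscale ?T L" "K1 \<subseteq> L" "m \<notin> L" "fin_mod UNIV L" by blast
  have PL: "act p v \<in> L" if "p \<in> P" "v \<in> L" for p v
    using act_hull_in[OF L(1)] that unfolding P_def by blast
  have RL: "act r v \<in> L" if r: "r \<in> R" and v: "v \<in> L" for r v
  proof -
    have "act r v - v \<in> D" using r by (auto simp: D_def act_apply collapse_diff collapse_shift[OF R(1)])
    then have "act r v - v \<in> L" using DK1 L(2) by blast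
    from submod_add[OF L(1) this v] show ?thesis by simp
  qed
  \<comment> \<open>The largest part of \<open>L\<close> stable under all translations. Since
    \<open>P\<close> and \<open>R\<close> preserve \<open>L\<close>, only the finitely many
    translations by \<open>B\<close> have to be tested, which keeps the index finite.\<close>
  define L0 where "L0 = {v. \<forall>q. act q v \<in> L}"
  have L0: "submod gscale (frag_of ` UNIV) L0"
    by (rule submod_actI)
      (use submod_zero[OF L(1)] submod_diff[OF L(1)] in \<open>auto simp: L0_def act_diff act_act\<close>)
  have L0_L: "L0 \<subseteq> L" unfolding L0_def using act_0 by (metis (mono_tags, lifting) mem_Collect_eq subsetI)
  have "{v. \<forall>b\<in>B. act b v \<in> L} \<subseteq> L0"
  proof
    fix v assume v: "v \<in> {v. \<forall>b\<in>B. act b v \<in> L}"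
    have "act q v \<in> L" for q
    proof -
      obtain b p r where q: "b \<in> B" "p \<in> P" "r \<in> R" "q = p + r + b" using decompose[of q] by blast
      have "act p (act r (act b v)) \<in> L" by (rule PL[OF q(2) RL[OF q(3)]]) (use v q(1) in blast)
      then show ?thesis by (simp add: q(4) act_act add.assoc)
    qed
    then show "v \<in> L0" by (simp add: L0_def)
  qed
  moreover have "submod gscale {} {v. \<forall>b\<in>B'. act b v \<in> L} \<and> fin_mod UNIV {v. \<forall>b\<in>B'. act b v \<in> L}"
    if "finite B'" for B'
    using that
  proof (induction B')
    case empty
    show ?case by (auto simp: submod_def fin_mod_def)
  next
    case (insert b B')
    let ?S = "{v. act b v \<in> L}"
    have S: "submod gscale {} ?S"
      by (rule submodI) (use submod_zero[OF L(1)] submod_diff[OF L(1)] in \<open>auto simp: act_diff\<close>)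
    obtain f :: "('a \<Rightarrow> 'a group_ring) \<Rightarrow> 'a \<Rightarrow> 'a group_ring" where f: "finite (range f)" "\<And>v w. f v = f w \<Longrightarrow> v - w \<in> L"
      using fin_mod_range_coloring[OF L(4,1)] by metis
    have "fin_mod UNIV ?S"
    proof (rule fin_modI_coloring[of "f \<circ> act b"])
      show "finite (range (f \<circ> act b))" by (rule finite_subset[OF _ f(1)]) auto
    qed (use f(2) in \<open>auto simp: act_diff\<close>)
    moreover have "{v. \<forall>b\<in>insert b B'. act b v \<in> L} = ?S \<inter> {v. \<forall>b\<in>B'. act b v \<in> L}" by auto
    ultimately show ?case
      using submod_Int[OF S conjunct1[OF insert.IH]] fin_mod_Int[OF _ conjunct2[OF insert.IH] S conjunct1[OF insert.IH]]
      by simp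
  qed
  from this[OF B(1)] have "fin_mod UNIV {v. \<forall>b\<in>B. act b v \<in> L}" by blast
  ultimately have "fin_mod UNIV L0" using fin_mod_mono[OF _ order.refl] by blast
  then show ?thesis using L L0 L0_L KK1 by blast
qed

text \<open>This is the kernel of an action on the finite quotient by \<open>L\<close>. An element
  acts through the images of the representatives \<open>Z\<close>, for which there are finitely many
  possibilities.\<close>

lemma trivial_action_finite_index:
  assumes L: "submod gscale (frag_of ` UNIV) L" and fin: "fin_mod UNIV L"
  shows "addsub {q. \<forall>v. act q v - v \<in> L}" "fin_mod UNIV {q. \<forall>v. act q v - v \<in> L}"
proof -
  have aL: "v \<in> L \<Longrightarrow> act q v \<in> L" for q v using act_in[OF L] by blast
  let ?S = "{q. \<forall>v. act q v - v \<in> L}"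
  show "addsub ?S"
  proof (rule submodI)
    show "0 \<in> ?S" using submod_zero[OF L] by simp
    fix p q assume p: "p \<in> ?S" and q: "q \<in> ?S"
    have "act (p - q) v - v \<in> L" for v
    proof -
      have "act (p - q) v - v = (act p (act (- q) v) - act (- q) v) - act (- q) (act q v - v)"
        by (simp add: act_act act_diff)
      also have "\<dots> \<in> L" by (rule submod_diff[OF L _ aL]) (use p q in auto)
      finally show ?thesis .
    qed
    then show "p - q \<in> ?S" by blast
  qed auto
  obtain f :: "('a \<Rightarrow> 'a group_ring) \<Rightarrow> 'a \<Rightarrow> 'a group_ring"
    where f: "finite (range f)" "\<And>v w. f v = f w \<Longrightarrow> v - w \<in> L"
    using fin_mod_range_coloring[OF fin L] by metis
  obtain Z where Z: "finite Z" "\<And>v. \<exists>z\<in>Z. v - z \<in> L" using fin unfolding fin_mod_def by blast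
  let ?c = "\<lambda>q. restrict (\<lambda>z. f (act q z)) Z"
  show "fin_mod UNIV ?S"
  proof (rule fin_modI_coloring)
    show "finite (range ?c)"
      by (rule finite_subset[of _ "Z \<rightarrow>\<^sub>E range f"]) (use Z(1) f(1) in \<open>auto intro: finite_PiE\<close>)
    fix p q assume eq: "?c p = ?c q"
    have "act (p - q) v - v \<in> L" for v
    proof -
      obtain z where z: "z \<in> Z" "v - z \<in> L" using Z(2) by blast
      have "f (act p z) = f (act q z)" using fun_cong[OF eq, of z] z(1) by simp
      then have 1: "act p z - act q z \<in> L" by (rule f(2))
      have "act (p - q) v - v = act (- q) ((act p z - act q z) + (act p (v - z) - act q (v - z)))"
        by (simp add: act_act act_diff act_add)
      also have "\<dots> \<in> L" by (rule aL[OF submod_add[OF L 1 submod_diff[OF L aL aL]]]) (rule z)+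
      finally show ?thesis .
    qed
    then show "p - q \<in> ?S" by blast
  qed
qed

section \<open>Separating finitely generated subgroups\<close>

lemma (in group) finite_index_subgroupI:
  assumes H: "subgroup H G" and f: "finite (f ` carrier G)"
    "\<And>x y. x \<in> carrier G \<Longrightarrow> y \<in> carrier G \<Longrightarrow> f x = f y \<Longrightarrow> x \<otimes> inv y \<in> H"
  shows "finite_index_subgroup H G"
proof -
  let ?r = "\<lambda>c. H #> (SOME x. x \<in> carrier G \<and> f x = c)"
  have "rcosets H \<subseteq> ?r ` f ` carrier G"
  proof
    fix K assume "K \<in> rcosets H"
    then obtain x where x: "x \<in> carrier G" "K = H #> x" by (auto simp: RCOSETS_def)
    define y where "y = (SOME y. y \<in> carrier G \<and> f y = f x)"
    have y: "y \<in> carrier G \<and> f y = f x" unfolding y_def by (rule someI[of _ x]) (simp add: x)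
    have "x \<otimes> inv y \<in> H" using f(2)[of x y] x y by simp
    moreover have "x = (x \<otimes> inv y) \<otimes> y" using x y by (simp add: m_assoc)
    ultimately have "x \<in> H #> y" unfolding r_coset_def by blast
    then have "H #> y = H #> x" using repr_independence H y by blast
    then show "K \<in> ?r ` f ` carrier G" using x unfolding y_def by blast
  qed
  then have "finite (rcosets H)" using f(1) finite_subset by blast
  then show ?thesis using H by (simp add: finite_index_subgroup_def)
qed

lemma (in group) separableI:
  assumes S: "subgroup S G"
    and sep: "\<And>g. g \<in> carrier G \<Longrightarrow> g \<notin> S \<Longrightarrow> \<exists>H. finite_index_subgroup H G \<and> (\<forall>h\<in>H. h \<otimes> g \<notin> S)"
  shows "separable S G"
proof -
  have "\<exists>T. openin (profinite_topology G) T \<and> g \<in> T \<and> T \<subseteq> carrier G - S" if g: "g \<in> carrier G - S" for g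
  proof -
    obtain H where H: "finite_index_subgroup H G" "\<forall>h\<in>H. h \<otimes> g \<notin> S" using sep g by blast
    have sub: "subgroup H G" using H(1) by (simp add: finite_index_subgroup_def)
    have "H #> g \<in> finite_index_cosets G"
      using H(1) g by (auto simp: finite_index_cosets_def RCOSETS_def)
    then have "openin (profinite_topology G) (H #> g)"
      unfolding profinite_topology_def by (rule topology_generated_by_Basis)
    moreover have "g \<in> H #> g" using rcos_self[OF _ sub] g by blast
    moreover have "H #> g \<subseteq> carrier G" using r_coset_subset_G[OF subgroup.subset[OF sub]] g by blast
    moreover have "(H #> g) \<inter> S = {}" using H(2) by (auto simp: r_coset_def)
    ultimately show ?thesis by blast
  qed
  then have "openin (profinite_topology G) (carrier G - S)" by (subst openin_subopen) blast
  then show ?thesis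
    using S subgroup.subset[OF S] by (simp add: separable_def closedin_def topspace_profinite_topology)
qed

text \<open>\<open>x \<mapsto> (\<alpha> x, \<pi> x)\<close> embeds \<open>G\<close> into the wreath product of free abelian groups.\<close>

locale magnus_rep = group G for G (structure) +
  fixes X :: "'x set" and \<pi> :: "'a \<Rightarrow> ('x \<Rightarrow>\<^sub>0 int)" and \<alpha> :: "'a \<Rightarrow> 'x \<Rightarrow> 'x group_ring"
  assumes finite_X: "finite X"
    and pi_mult: "x \<in> carrier G \<Longrightarrow> y \<in> carrier G \<Longrightarrow> \<pi> (x \<otimes> y) = \<pi> x + \<pi> y"
    and alpha_mult: "x \<in> carrier G \<Longrightarrow> y \<in> carrier G \<Longrightarrow> \<alpha> (x \<otimes> y) = \<alpha> x + act (\<pi> x) (\<alpha> y)"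
    and trivial: "x \<in> carrier G \<Longrightarrow> \<pi> x = 0 \<Longrightarrow> \<alpha> x = 0 \<Longrightarrow> x = \<one>"
    and keys_pi: "x \<in> carrier G \<Longrightarrow> Poly_Mapping.keys (\<pi> x) \<subseteq> X"
    and supported_alpha: "x \<in> carrier G \<Longrightarrow> \<alpha> x \<in> supported X {0} {q. Poly_Mapping.keys q \<subseteq> X}"
begin

lemma pi_one [simp]: "\<pi> \<one> = 0"
  using pi_mult[of \<one> \<one>] by simp

lemma alpha_one [simp]: "\<alpha> \<one> = 0"
  using alpha_mult[of \<one> \<one>] by simp

lemma pi_inv: "x \<in> carrier G \<Longrightarrow> \<pi> (inv x) = - \<pi> x"
  using pi_mult[of "inv x" x] by (simp add: eq_neg_iff_add_eq_0)

lemma alpha_inv: "x \<in> carrier G \<Longrightarrow> \<alpha> (inv x) = - act (- \<pi> x) (\<alpha> x)"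
  using alpha_mult[of "inv x" x] by (simp add: pi_inv eq_neg_iff_add_eq_0)

lemma pi_div: "x \<in> carrier G \<Longrightarrow> y \<in> carrier G \<Longrightarrow> \<pi> (x \<otimes> inv y) = \<pi> x - \<pi> y"
  by (simp add: pi_mult pi_inv)

lemma alpha_div: "x \<in> carrier G \<Longrightarrow> y \<in> carrier G \<Longrightarrow> \<alpha> (x \<otimes> inv y) = \<alpha> x - act (\<pi> x - \<pi> y) (\<alpha> y)"
  by (simp add: alpha_mult alpha_inv act_uminus act_act)

lemma pi_pow: "x \<in> carrier G \<Longrightarrow> \<pi> (x [^] (n::nat)) = frag_cmul (int n) (\<pi> x)"
  by (induction n) (simp_all add: pi_mult frag_cmul_distrib)

text \<open>The preimage of the semidirect product of \<open>L\<close> and \<open>V\<close>. As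
  \<open>V\<close> acts trivially modulo \<open>L\<close>, the classes of \<open>\<alpha> x\<close>
  and \<open>\<pi> x\<close> determine the right coset of \<open>x\<close>.\<close>

lemma finite_index_preimage:
  assumes L: "submod gscale (frag_of ` UNIV) L" "fin_mod UNIV L" and V: "addsub V" "fin_mod UNIV V"
    and triv: "\<And>q v. q \<in> V \<Longrightarrow> act q v - v \<in> L"
  shows "finite_index_subgroup {h \<in> carrier G. \<alpha> h \<in> L \<and> \<pi> h \<in> V} G" (is "finite_index_subgroup ?H G")
proof -
  have aL: "v \<in> L \<Longrightarrow> act q v \<in> L" for q v using act_in[OF L(1)] by blast
  obtain f :: "('x \<Rightarrow> 'x group_ring) \<Rightarrow> 'x \<Rightarrow> 'x group_ring"
    where f: "finite (range f)" "\<And>v w. f v = f w \<Longrightarrow> v - w \<in> L"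
    using fin_mod_range_coloring[OF L(2,1)] by metis
  obtain g :: "('x \<Rightarrow>\<^sub>0 int) \<Rightarrow> ('x \<Rightarrow>\<^sub>0 int)"
    where g: "finite (range g)" "\<And>v w. g v = g w \<Longrightarrow> v - w \<in> V"
    using fin_mod_range_coloring[OF V(2,1)] by metis
  show ?thesis
  proof (rule finite_index_subgroupI)
    show "subgroup ?H G"
    proof (rule subgroupI)
      have "\<one> \<in> ?H" using submod_zero[OF L(1)] submod_zero[OF V(1)] by simp
      then show "?H \<noteq> {}" by blast
      fix a assume "a \<in> ?H"
      then have a: "a \<in> carrier G" "\<alpha> a \<in> L" "\<pi> a \<in> V" by auto
      then show "inv a \<in> ?H"
        using submod_uminus[OF L(1) aL] submod_uminus[OF V(1)] by (simp add: alpha_inv pi_inv)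
      fix b assume "b \<in> ?H"
      then have b: "b \<in> carrier G" "\<alpha> b \<in> L" "\<pi> b \<in> V" by auto
      show "a \<otimes> b \<in> ?H"
        using a b submod_add[OF L(1) a(2) aL[OF b(2)]] submod_add[OF V(1) a(3) b(3)]
        by (simp add: alpha_mult pi_mult)
    qed auto
    show "finite ((\<lambda>x. (f (\<alpha> x), g (\<pi> x))) ` carrier G)"
      by (rule finite_subset[of _ "range f \<times> range g"]) (use f(1) g(1) in auto)
    fix x y assume xy: "x \<in> carrier G" "y \<in> carrier G" "(f (\<alpha> x), g (\<pi> x)) = (f (\<alpha> y), g (\<pi> y))"
    have V: "\<pi> x - \<pi> y \<in> V" and L': "\<alpha> x - \<alpha> y \<in> L" using f(2) g(2) xy(3) by auto
    have "\<alpha> (x \<otimes> inv y) = (\<alpha> x - \<alpha> y) - (act (\<pi> x - \<pi> y) (\<alpha> y) - \<alpha> y)"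
      using xy by (simp add: alpha_div)
    also have "\<dots> \<in> L" by (rule submod_diff[OF L(1) L' triv[OF V]])
    finally show "x \<otimes> inv y \<in> ?H" using xy V by (simp add: pi_div)
  qed
qed

lemma separate:
  assumes A: "finite A" "A \<subseteq> carrier G" and g: "g \<in> carrier G" "g \<notin> generate G A"
  shows "\<exists>H. finite_index_subgroup H G \<and> (\<forall>h\<in>H. h \<otimes> g \<notin> generate G A)"
proof -
  let ?S = "generate G A"
  have S: "subgroup ?S G" by (rule generate_is_subgroup[OF A(2)])
  have SG: "s \<in> ?S \<Longrightarrow> s \<in> carrier G" for s using subgroup.subset[OF S] by blast
  note S_mult = subgroup.m_closed[OF S] and S_inv = subgroup.m_inv_closed[OF S]
  note S_one = subgroup.one_closed[OF S]
  define P where "P = addsub hull (\<pi> ` A)"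
  have P: "addsub P" unfolding P_def by (rule submod_hull)
  have "P \<subseteq> {q. Poly_Mapping.keys q \<subseteq> X}"
    unfolding P_def by (rule hull_minimal) (use keys_pi A(2) addsub_keys in auto)
  then have PX: "p \<in> P \<Longrightarrow> Poly_Mapping.keys p \<subseteq> X" for p by blast
  have P_off: "P \<inter> off X = {0}"
    using off_Int[OF PX] submod_zero[OF P] submod_zero[OF addsub_off, of X] by auto
  have image_diff: "\<pi> s - \<pi> t = \<pi> (s \<otimes> inv t)" "s \<otimes> inv t \<in> ?S" if "s \<in> ?S" "t \<in> ?S" for s t
    using that SG S_mult S_inv by (simp_all add: pi_div)
  have "addsub (\<pi> ` ?S)"
  proof (rule submodI)
    show "0 \<in> \<pi> ` ?S" using S_one by (intro image_eqI[of _ _ \<one>]) auto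
    fix x y assume "x \<in> \<pi> ` ?S" "y \<in> \<pi> ` ?S"
    then show "x - y \<in> \<pi> ` ?S" using image_diff by auto
  qed auto
  then have "P \<subseteq> \<pi> ` ?S" unfolding P_def by (rule hull_minimal[rotated]) (auto intro: generate.incl)
  then have P_ex: "\<exists>s\<in>?S. \<pi> s = p" if "p \<in> P" for p using that by blast
  have pi_A: "a \<in> A \<Longrightarrow> \<pi> a \<in> P" for a unfolding P_def by (rule hull_inc) auto
  have pi_S: "\<pi> s \<in> P" if "s \<in> ?S" for s
    using that
  proof (induction rule: generate.induct)
    case (eng s t)
    then show ?case using submod_add[OF P] SG by (simp add: pi_mult)
  qed (use A(2) pi_A submod_zero[OF P] submod_uminus[OF P] pi_inv in auto)
  show ?thesis
  proof (cases "\<pi> g \<in> P")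
    case False
    \<comment> \<open>In this case the image in the free abelian group already separates. Adding
      \<open>off X\<close> makes the quotient finitely generated and cannot capture
      \<open>\<pi> g\<close>, whose keys lie in \<open>X\<close>.\<close>
    have "\<pi> g \<notin> sumset P (off X)"
    proof
      assume "\<pi> g \<in> sumset P (off X)"
      then obtain p j where pj: "\<pi> g = p + j" "p \<in> P" "j \<in> off X" by (auto simp: sumset_def)
      have "Poly_Mapping.keys (\<pi> g - p) \<subseteq> X" using keys_diff[of "\<pi> g" p] keys_pi[OF g(1)] PX[OF pj(2)] by blast
      then have "j = 0" using off_Int[of j X] pj by simp
      then show False using pj False by simp
    qed
    then obtain V where V: "addsub V" "sumset P (off X) \<subseteq> V" "\<pi> g \<notin> V" "fin_mod UNIV V"
      using separate_finite_set[OF finite_X addsub_sumset[OF P addsub_off], of X "{\<pi> g}"]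
        sumset_subset[OF P addsub_off[of X]] by auto
    have PV: "P \<subseteq> V" using V(2) sumset_subset[OF P addsub_off[of X]] by blast
    let ?H = "{h \<in> carrier G. \<alpha> h \<in> UNIV \<and> \<pi> h \<in> V}"
    have "finite_index_subgroup ?H G"
      by (rule finite_index_preimage[OF _ _ V(1,4)]) (auto simp: submod_def fin_mod_def)
    moreover have "h \<otimes> g \<notin> ?S" if h: "h \<in> ?H" for h
    proof
      assume "h \<otimes> g \<in> ?S"
      then have "\<pi> h + \<pi> g \<in> V" using pi_S PV h g(1) pi_mult by fastforce
      then show False using submod_diff[OF V(1), of "\<pi> h + \<pi> g" "\<pi> h"] h V(3) by simp
    qed
    ultimately show ?thesis by blast
  next
    case True
    then obtain s0 where s0: "s0 \<in> ?S" "\<pi> s0 = \<pi> g" using P_ex by blast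
    \<comment> \<open>Right multiplication by an element of \<open>?S\<close> does not affect
      membership in \<open>?S\<close> and moves \<open>g\<close> into the kernel of
      \<open>\<pi>\<close>.\<close>
    define g' where "g' = g \<otimes> inv s0"
    have g': "g' \<in> carrier G" "\<pi> g' = 0" using g(1) SG[OF s0(1)] s0(2) by (simp_all add: g'_def pi_div)
    define m where "m = \<alpha> g'"
    define K where "K = \<alpha> ` {s \<in> ?S. \<pi> s = 0}"
    \<comment> \<open>All group elements occurring in \<open>m\<close> and in the generators; the
      supports of all \<open>\<alpha> s\<close> with \<open>s \<in> ?S\<close> stay in their cosets
      of \<open>P\<close>.\<close>
    define C where "C = (\<Union>v\<in>insert m (\<alpha> ` A). \<Union>x\<in>X. Poly_Mapping.keys (v x))"
    have C_fin: "finite C" unfolding C_def using A(1) finite_X by auto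
    have C_X: "Poly_Mapping.keys c \<subseteq> X" if "c \<in> C" for c
    proof -
      from that obtain a x where ax: "a \<in> carrier G" "x \<in> X" "c \<in> Poly_Mapping.keys (\<alpha> a x)"
        using A(2) g'(1) by (auto simp: C_def m_def)
      then show ?thesis using supported_alpha[OF ax(1)] by (auto simp: supported_def)
    qed
    have supp: "\<alpha> a \<in> supported X C P" if a: "\<alpha> a \<in> insert m (\<alpha> ` A)" "a \<in> carrier G" for a
      unfolding supported_def
    proof (intro CollectI conjI allI ballI impI)
      show "\<alpha> a x = 0" if "x \<notin> X" for x using supported_alpha[OF a(2)] that by (simp add: supported_def)
      fix x q assume "x \<in> X" "q \<in> Poly_Mapping.keys (\<alpha> a x)"
      then have "q \<in> C" using a(1) unfolding C_def by blast
      then show "\<exists>c\<in>C. q - c \<in> P" using submod_zero[OF P] by (intro bexI[of _ q]) auto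
    qed
    have m_supp: "m \<in> supported X C P" unfolding m_def using supp[of g'] g'(1) by (simp add: m_def)
    have S_supp: "\<alpha> s \<in> supported X C P" if "s \<in> ?S" for s
      using that
    proof (induction rule: generate.induct)
      case one
      show ?case unfolding alpha_one by (rule supported_zero)
    next
      case (incl a)
      then show ?case using supp A(2) by blast
    next
      case (inv a)
      then have "act (- \<pi> a) (\<alpha> a) \<in> supported X C P"
        using A(2) by (intro supported_act[OF P] submod_uminus[OF P] pi_A supp) auto
      from supported_diff[OF supported_zero this] show ?case
        unfolding alpha_inv[OF subsetD[OF A(2) inv]] diff_0 .
    next
      case (eng s t)
      have "\<alpha> s - (0 - act (\<pi> s) (\<alpha> t)) \<in> supported X C P"
        by (intro supported_diff supported_zero supported_act[OF P] eng.IH pi_S eng.hyps)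
      then show ?case unfolding alpha_mult[OF SG[OF eng.hyps(1)] SG[OF eng.hyps(2)]] diff_0 diff_minus_eq_add .
    qed
    have K_sub: "submod gscale (frag_of ` (\<pi> ` A \<union> uminus ` \<pi> ` A)) K"
    proof (rule submod_actI)
      show "0 \<in> K" unfolding K_def using S_one by (intro image_eqI[of _ _ \<one>]) auto
    next
      fix v w assume "v \<in> K" "w \<in> K"
      then obtain s t where st: "v = \<alpha> s" "w = \<alpha> t" "s \<in> ?S" "t \<in> ?S" "\<pi> s = 0" "\<pi> t = 0"
        by (auto simp: K_def)
      then have "v - w = \<alpha> (s \<otimes> inv t)" "\<pi> (s \<otimes> inv t) = 0" using SG by (simp_all add: alpha_div pi_div)
      then show "v - w \<in> K" using image_diff(2)[OF st(3,4)] by (auto simp: K_def)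
    next
      fix q v assume q: "q \<in> \<pi> ` A \<union> uminus ` \<pi> ` A" and "v \<in> K"
      then obtain k where k: "v = \<alpha> k" "k \<in> ?S" "\<pi> k = 0" by (auto simp: K_def)
      have "q \<in> P" using q pi_A submod_uminus[OF P] by auto
      then obtain s where s: "s \<in> ?S" "\<pi> s = q" using P_ex by blast
      note c = SG[OF k(2)] SG[OF s(1)]
      \<comment> \<open>Conjugation by an element over \<open>q\<close> acts on the abelian kernel
        of \<open>\<pi>\<close> as \<open>act q\<close>.\<close>
      have "\<alpha> (s \<otimes> k \<otimes> inv s) = \<alpha> (s \<otimes> k) - act (\<pi> (s \<otimes> k) - \<pi> s) (\<alpha> s)"
        using c by (intro alpha_div) auto
      also have "\<dots> = act q v" using c k s(2) by (simp add: alpha_mult pi_mult)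
      finally have "\<alpha> (s \<otimes> k \<otimes> inv s) = act q v" .
      moreover have "\<pi> (s \<otimes> k \<otimes> inv s) = 0" using c k by (simp add: pi_mult pi_inv)
      moreover have "s \<otimes> k \<otimes> inv s \<in> ?S" by (intro S_mult S_inv s k)
      ultimately show "act q v \<in> K" unfolding K_def by force
    qed
    have "m \<notin> K"
    proof
      assume "m \<in> K"
      then obtain k where k: "k \<in> ?S" "\<pi> k = 0" "\<alpha> g' = \<alpha> k" by (auto simp: K_def m_def)
      have "g' \<otimes> inv k = \<one>"
        by (rule trivial) (use g' k SG in \<open>simp_all add: pi_div alpha_div\<close>)
      then have "g' = k" using g'(1) SG[OF k(1)] inv_equality[of g' "inv k"] by simp
      then have "g = k \<otimes> s0" unfolding g'_def using g(1) SG[OF s0(1)] by (auto simp: m_assoc)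
      then show False using S_mult[OF k(1) s0(1)] g(2) by simp
    qed
    then obtain L L0 where L: "submod gscale (frag_of ` (\<pi> ` A \<union> uminus ` \<pi> ` A)) L" "K \<subseteq> L" "m \<notin> L" "L0 \<subseteq> L"
      and L0: "submod gscale (frag_of ` UNIV) L0" "fin_mod UNIV L0"
      using exists_invariant_finite_index[OF finite_X finite_imageI[OF A(1)] _ C_fin C_X K_sub _ m_supp[unfolded P_def]]
        keys_pi A(2) S_supp unfolding P_def K_def by blast
    have aL0: "v \<in> L0 \<Longrightarrow> act q v \<in> L0" for q v using act_in[OF L0(1)] by blast
    define Q2 where "Q2 = {q. \<forall>v. act q v - v \<in> L0}"
    have Q2: "addsub Q2" "fin_mod UNIV Q2" unfolding Q2_def by (rule trivial_action_finite_index[OF L0])+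
    \<comment> \<open>Elements of \<open>P\<close> with a lift to \<open>?S\<close> that is harmless
      modulo \<open>L0\<close>. These lifts later correct an \<open>h\<close> that moves in the free
      abelian group.\<close>
    define P' where "P' = \<pi> ` {s \<in> ?S. \<pi> s \<in> Q2 \<and> \<alpha> s \<in> L0}"
    have P': "addsub P'"
    proof (rule submodI)
      show "0 \<in> P'" unfolding P'_def
        using S_one submod_zero[OF Q2(1)] submod_zero[OF L0(1)] by (intro image_eqI[of _ _ \<one>]) auto
      fix x y assume "x \<in> P'" "y \<in> P'"
      then obtain s t where st: "x = \<pi> s" "y = \<pi> t" "s \<in> ?S" "t \<in> ?S" "\<pi> s \<in> Q2" "\<pi> t \<in> Q2" "\<alpha> s \<in> L0" "\<alpha> t \<in> L0"
        by (auto simp: P'_def)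
      have "\<pi> (s \<otimes> inv t) \<in> Q2" using submod_diff[OF Q2(1) st(5,6)] image_diff(1)[OF st(3,4)] by simp
      moreover have "\<alpha> (s \<otimes> inv t) \<in> L0"
        using submod_diff[OF L0(1) st(7) aL0[OF st(8)]] SG st(3,4) by (simp add: alpha_div)
      ultimately show "x - y \<in> P'"
        unfolding P'_def st(1,2) image_diff(1)[OF st(3,4)] using image_diff(2)[OF st(3,4)] by blast
    qed auto
    have P'_P: "P' \<subseteq> P" unfolding P'_def using pi_S by blast
    obtain f :: "('x \<Rightarrow> 'x group_ring) \<Rightarrow> 'x \<Rightarrow> 'x group_ring"
      where f: "finite (range f)" "\<And>v w. f v = f w \<Longrightarrow> v - w \<in> L0"
      using fin_mod_range_coloring[OF L0(2,1)] by metis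
    obtain c :: "('x \<Rightarrow>\<^sub>0 int) \<Rightarrow> ('x \<Rightarrow>\<^sub>0 int)"
      where c: "finite (range c)" "\<And>v w. c v = c w \<Longrightarrow> v - w \<in> Q2"
      using fin_mod_range_coloring[OF Q2(2,1)] by metis
    \<comment> \<open>Two powers of \<open>a\<close> have the same classes modulo \<open>L0\<close>
      and modulo \<open>Q2\<close>, and the power of \<open>a\<close> by which they differ lies over
      an element of \<open>P'\<close>. So \<open>P\<close> is torsion modulo
      \<open>P'\<close>.\<close>
    have "\<exists>n>0. frag_cmul n (\<pi> a) \<in> P'" if a: "a \<in> A" for a
    proof -
      have aG: "a \<in> carrier G" using a A(2) by blast
      have pow_S: "a [^] (n::nat) \<in> ?S" for n
        by (induction n) (use S_one S_mult generate.incl[OF a] in auto)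
      let ?c = "\<lambda>n::nat. (f (\<alpha> (a [^] n)), c (\<pi> (a [^] n)))"
      have "finite (range ?c)"
        by (rule finite_subset[of _ "range f \<times> range c"]) (use f(1) c(1) in auto)
      then have "\<not> inj ?c" using finite_imageD infinite_UNIV_nat by blast
      then obtain i j where ij: "i < j" "?c j = ?c i" by (auto simp: inj_on_def) (metis linorder_neqE_nat)
      define s where "s = a [^] (j - i)"
      have sS: "s \<in> ?S" unfolding s_def by (rule pow_S)
      have eq: "a [^] j = s \<otimes> a [^] i" unfolding s_def using ij(1) aG by (simp add: nat_pow_mult)
      have "\<pi> s = \<pi> (a [^] j) - \<pi> (a [^] i)" using SG[OF sS] aG by (simp add: eq pi_mult)
      then have sQ: "\<pi> s \<in> Q2" using c(2) ij(2) by simp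
      have "\<alpha> s = (\<alpha> (a [^] j) - \<alpha> (a [^] i)) - (act (\<pi> s) (\<alpha> (a [^] i)) - \<alpha> (a [^] i))"
        using SG[OF sS] aG by (simp add: eq alpha_mult)
      also have "\<dots> \<in> L0"
        by (rule submod_diff[OF L0(1)]) (use f(2) ij(2) sQ in \<open>auto simp: Q2_def\<close>)
      finally have "\<pi> s \<in> P'" unfolding P'_def using sS sQ by blast
      then show ?thesis using ij(1) aG by (intro exI[of _ "int (j - i)"]) (auto simp: s_def pi_pow)
    qed
    then have "fin_mod P P'"
      unfolding P_def using A(1) by (intro module.fin_mod_hull_empty[OF module_frag_cmul] P') auto
    then obtain U where U: "addsub U" "fin_mod UNIV U" "U \<inter> P \<subseteq> P'"
      using exists_finite_index_meeting[OF finite_X P P_off P' P'_P] by blast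
    \<comment> \<open>\<open>Q2\<close> makes the action trivial modulo \<open>L0\<close>, and
      \<open>U\<close> ensures that elements of \<open>P\<close> in \<open>?V\<close> have a lift
      with \<open>\<alpha>\<close> in \<open>L0\<close>.\<close>
    let ?V = "U \<inter> Q2"
    let ?H = "{h \<in> carrier G. \<alpha> h \<in> L0 \<and> \<pi> h \<in> ?V}"
    have "finite_index_subgroup ?H G"
      by (rule finite_index_preimage[OF L0 submod_Int[OF U(1) Q2(1)] fin_mod_Int[OF U(2) Q2(2) U(1) Q2(1)]])
        (auto simp: Q2_def)
    moreover have "h \<otimes> g \<notin> ?S" if h: "h \<in> ?H" for h
    proof
      assume hg: "h \<otimes> g \<in> ?S"
      define u where "u = h \<otimes> g'"
      have hG: "h \<in> carrier G" using h by blast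
      have "u = h \<otimes> g \<otimes> inv s0" unfolding u_def g'_def using hG g(1) SG[OF s0(1)] by (simp add: m_assoc)
      then have uS: "u \<in> ?S" using S_mult[OF hg S_inv[OF s0(1)]] by simp
      have pu: "\<pi> u = \<pi> h" using hG g' by (simp add: u_def pi_mult)
      have "\<pi> u \<in> P'" using U(3) pi_S[OF uS] h pu by auto
      then obtain s where s: "s \<in> ?S" "\<pi> s = \<pi> u" "\<alpha> s \<in> L0" by (auto simp: P'_def)
      \<comment> \<open>Dividing by \<open>s\<close> cancels the image in the free abelian group and
        changes \<open>\<alpha> u\<close> only by an element of \<open>L0\<close>.\<close>
      have "\<alpha> (u \<otimes> inv s) \<in> K"
        unfolding K_def using S_mult[OF uS S_inv[OF s(1)]] SG[OF uS] SG[OF s(1)] s(2)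
        by (intro imageI) (simp add: pi_div)
      then have "\<alpha> u - \<alpha> s \<in> L" using SG[OF uS] SG[OF s(1)] s(2) L(2) by (auto simp: alpha_div)
      then have 1: "\<alpha> u \<in> L" using submod_add[OF L(1), of "\<alpha> u - \<alpha> s" "\<alpha> s"] s(3) L(4) by auto
      have 2: "\<alpha> h \<in> L" "act (\<pi> h) m - m \<in> L" using h L(4) by (auto simp: Q2_def)
      have "m = (\<alpha> u - \<alpha> h) - (act (\<pi> h) m - m)" using hG g'(1) by (simp add: u_def m_def alpha_mult)
      also have "\<dots> \<in> L" by (intro submod_diff[OF L(1)] 1 2)
      finally show False using L(3) by simp
    qed
    ultimately show ?thesis by blast
  qed
qed

lemma LERF_if_finitely_generated:
  assumes "fg_subgroup (carrier G) G"
  shows "LERF G"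
  unfolding LERF_def
proof (intro conjI allI impI assms)
  fix S assume "fg_subgroup S G"
  then obtain A where A: "finite A" "A \<subseteq> carrier G" "S = generate G A" by (auto simp: fg_subgroup_def)
  show "separable S G"
    unfolding A(3) by (rule separableI[OF generate_is_subgroup[OF A(2)] separate[OF A(1,2)]])
qed (rule is_group)

end

section \<open>The Magnus embedding\<close>

definition wreath :: "(('a \<Rightarrow> 'a group_ring) \<times> ('a \<Rightarrow>\<^sub>0 int)) monoid" where
  "wreath = \<lparr>carrier = UNIV, mult = \<lambda>(v, p) (w, q). (v + act p w, p + q), one = (0, 0)\<rparr>"

lemma wreath_simps [simp]:
  "carrier wreath = UNIV" "\<one>\<^bsub>wreath\<^esub> = (0, 0)"
  "(v, p) \<otimes>\<^bsub>wreath\<^esub> (w, q) = (v + act p w, p + q)"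
  by (simp_all add: wreath_def)

lemma group_wreath: "group wreath"
proof (rule groupI)
  fix x y z :: "('a \<Rightarrow> 'a group_ring) \<times> ('a \<Rightarrow>\<^sub>0 int)"
  show "x \<otimes>\<^bsub>wreath\<^esub> y \<otimes>\<^bsub>wreath\<^esub> z = x \<otimes>\<^bsub>wreath\<^esub> (y \<otimes>\<^bsub>wreath\<^esub> z)"
    by (cases x; cases y; cases z) (simp add: act_add act_act add.assoc)
  show "\<one>\<^bsub>wreath\<^esub> \<otimes>\<^bsub>wreath\<^esub> x = x" by (cases x) simp
  show "\<exists>y\<in>carrier wreath. y \<otimes>\<^bsub>wreath\<^esub> x = \<one>\<^bsub>wreath\<^esub>"
    by (cases x) (auto intro!: exI[of _ "- act (- snd x) (fst x)"] exI[of _ "- snd x"])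
qed simp_all

text \<open>The second projection has abelian image, so commutators lie in its kernel
  \<open>?N\<close>, which is abelian too.\<close>

lemma derived_wreath: "derived wreath (derived wreath K) \<subseteq> {\<one>\<^bsub>wreath\<^esub>}"
proof -
  interpret W: group wreath by (rule group_wreath)
  let ?N = "{x :: ('a \<Rightarrow> 'a group_ring) \<times> ('a \<Rightarrow>\<^sub>0 int). snd x = 0}"
  have mult: "x \<otimes>\<^bsub>wreath\<^esub> y = (fst x + act (snd x) (fst y), snd x + snd y)" for x y :: "('a \<Rightarrow> 'a group_ring) \<times> _"
    by (cases x; cases y) simp
  have inv: "inv\<^bsub>wreath\<^esub> x = (- act (- snd x) (fst x), - snd x)" for x :: "('a \<Rightarrow> 'a group_ring) \<times> _"
    by (rule W.inv_equality) (auto simp: mult)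
  have "subgroup ?N wreath"
    by (rule W.subgroupI) (auto simp: mult inv intro: exI[of _ 0])
  moreover have "derived_set wreath K \<subseteq> ?N" by (auto simp: mult inv)
  ultimately have "derived wreath K \<subseteq> ?N"
    unfolding derived_def by (intro W.generate_subgroup_incl)
  then have "derived wreath (derived wreath K) \<subseteq> derived wreath ?N" by (rule W.mono_derived)
  also have "\<dots> \<subseteq> {\<one>\<^bsub>wreath\<^esub>}"
    unfolding derived_def
    by (rule W.generate_subgroup_incl[OF _ W.triv_subgroup]) (auto simp: mult inv)
  finally show ?thesis .
qed

lemma hom_eq_on_generate:
  assumes G: "group G" and H: "group H" and f: "f \<in> hom G H" and g: "g \<in> hom G H"
    and A: "A \<subseteq> carrier G" "\<And>a. a \<in> A \<Longrightarrow> f a = g a" and u: "u \<in> generate G A"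
  shows "f u = g u"
proof -
  interpret f: group_hom G H f using G H f by (simp add: group_hom_def group_hom_axioms_def)
  interpret g: group_hom G H g using G H g by (simp add: group_hom_def group_hom_axioms_def)
  show ?thesis using u
  proof (induction rule: generate.induct)
    case (eng s t)
    then show ?case using f.G.generate_in_carrier[OF A(1)] by simp
  qed (use A in \<open>auto simp: f.hom_inv g.hom_inv subset_iff\<close>)
qed

abbreviation letter :: "'a set \<Rightarrow> 'a \<Rightarrow> ('a \<times> bool) list set" where
  "letter X x \<equiv> word_eq X `` {[(x, True)]}"

locale magnus_hom =
  fixes X :: "'a set" and h
  assumes finite_X: "finite X"
    and h_hom: "h \<in> hom (free_group X) wreath"
    and h_letter: "x \<in> X \<Longrightarrow> h (letter X x) = (0(x := 1), frag_of x)"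
begin

abbreviation F where "F \<equiv> free_group X"

definition \<pi> where "\<pi> u = snd (h u)"
text \<open>The vector of Fox derivatives of \<open>u\<close>, with values in the group ring of the
  abelianization.\<close>

definition \<alpha> where "\<alpha> u = fst (h u)"

sublocale F: group F by (rule group_free_group)

sublocale group_hom F wreath h
  by (simp add: group_hom_def group_hom_axioms_def group_free_group group_wreath h_hom)

lemma letter_in: "x \<in> X \<Longrightarrow> letter X x \<in> carrier F"
  by (rule free_group_carrierI) simp

lemma letters: "letter X ` X \<subseteq> carrier F"
  using letter_in by blast

lemma h_mult: "u \<in> carrier F \<Longrightarrow> v \<in> carrier F \<Longrightarrow> h (u \<otimes>\<^bsub>F\<^esub> v) = (\<alpha> u + act (\<pi> u) (\<alpha> v), \<pi> u + \<pi> v)"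
  by (cases "h u"; cases "h v") (simp add: \<alpha>_def \<pi>_def)

lemma pi_mult: "u \<in> carrier F \<Longrightarrow> v \<in> carrier F \<Longrightarrow> \<pi> (u \<otimes>\<^bsub>F\<^esub> v) = \<pi> u + \<pi> v"
  and alpha_mult: "u \<in> carrier F \<Longrightarrow> v \<in> carrier F \<Longrightarrow> \<alpha> (u \<otimes>\<^bsub>F\<^esub> v) = \<alpha> u + act (\<pi> u) (\<alpha> v)"
  unfolding \<pi>_def[of "u \<otimes>\<^bsub>F\<^esub> v"] \<alpha>_def[of "u \<otimes>\<^bsub>F\<^esub> v"]
  by (simp_all only: h_mult fst_conv snd_conv)

lemma pi_one: "\<pi> \<one>\<^bsub>F\<^esub> = 0" and alpha_one: "\<alpha> \<one>\<^bsub>F\<^esub> = 0"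
  by (simp_all add: \<pi>_def \<alpha>_def)

lemma pi_inv: "u \<in> carrier F \<Longrightarrow> \<pi> (inv\<^bsub>F\<^esub> u) = - \<pi> u"
  using pi_mult[of "inv\<^bsub>F\<^esub> u" u] by (simp add: pi_one eq_neg_iff_add_eq_0)

lemma alpha_inv: "u \<in> carrier F \<Longrightarrow> \<alpha> (inv\<^bsub>F\<^esub> u) = - act (- \<pi> u) (\<alpha> u)"
  using alpha_mult[of "inv\<^bsub>F\<^esub> u" u] by (simp add: alpha_one pi_inv eq_neg_iff_add_eq_0)

lemma pi_letter: "x \<in> X \<Longrightarrow> \<pi> (letter X x) = frag_of x"
  and alpha_letter: "x \<in> X \<Longrightarrow> \<alpha> (letter X x) = 0(x := 1)"
  by (simp_all add: \<pi>_def \<alpha>_def h_letter)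

lemma free_group_induct [consumes 1, case_names one letter inv mult]:
  assumes "u \<in> carrier F" "P \<one>\<^bsub>F\<^esub>" "\<And>x. x \<in> X \<Longrightarrow> P (letter X x)" "\<And>x. x \<in> X \<Longrightarrow> P (inv\<^bsub>F\<^esub> letter X x)"
    "\<And>u v. u \<in> carrier F \<Longrightarrow> v \<in> carrier F \<Longrightarrow> P u \<Longrightarrow> P v \<Longrightarrow> P (u \<otimes>\<^bsub>F\<^esub> v)"
  shows "P u"
proof -
  have "u \<in> generate F (letter X ` X)" using assms(1) free_group_generated by blast
  then show ?thesis
  proof (induction rule: generate.induct)
    case (eng u v)
    then show ?case using assms(5) F.generate_in_carrier[OF letters] by blast
  qed (use assms in auto)
qed

lemma keys_pi: "u \<in> carrier F \<Longrightarrow> Poly_Mapping.keys (\<pi> u) \<subseteq> X"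
proof (induction u rule: free_group_induct)
  case (mult u v)
  then show ?case using keys_add[of "\<pi> u" "\<pi> v"] by (auto simp: pi_mult)
qed (auto simp: pi_one pi_letter pi_inv letter_in)

lemma supported_alpha: "u \<in> carrier F \<Longrightarrow> \<alpha> u \<in> supported X {0} {q. Poly_Mapping.keys q \<subseteq> X}"
proof (induction u rule: free_group_induct)
  case one
  show ?case unfolding alpha_one by (rule supported_zero)
next
  case (letter x)
  then show ?case by (auto simp: alpha_letter supported_def)
next
  case (inv x)
  have 1: "0(x := 1) \<in> supported X {0} {q. Poly_Mapping.keys q \<subseteq> X}"
    using inv by (auto simp: supported_def)
  have "0 - act (- frag_of x) (0(x := 1)) \<in> supported X {0} {q. Poly_Mapping.keys q \<subseteq> X}"
    by (intro supported_diff supported_zero supported_act addsub_keys 1) (use inv in simp)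
  then show ?case
    unfolding alpha_inv[OF letter_in[OF inv]] alpha_letter[OF inv] pi_letter[OF inv] diff_0 .
next
  case (mult u v)
  have "\<alpha> u - (0 - act (\<pi> u) (\<alpha> v)) \<in> supported X {0} {q. Poly_Mapping.keys q \<subseteq> X}"
    by (intro supported_diff supported_zero supported_act addsub_keys mult.IH) (use keys_pi mult.hyps in simp)
  then show ?case unfolding alpha_mult[OF mult.hyps] diff_0 diff_minus_eq_add .
qed

text \<open>The abelianization of \<open>F\<close> receives a homomorphism \<open>k\<close> from the
  free abelian group that sends each generator to the class of its letter. So
  \<open>k (\<pi> u)\<close> is the class of \<open>u\<close>.\<close>

lemma kernel_pi:
  assumes u: "u \<in> carrier F" "\<pi> u = 0"
  shows "u \<in> derived F (carrier F)"
proof -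
  let ?D = "derived F (carrier F)"
  interpret D: normal ?D F by (rule F.derived_self_is_normal)
  interpret Q: comm_group "F Mod ?D" by (rule F.derived_quot_is_comm_group)
  \<comment> \<open>The free abelian group is taken on the whole type; generators outside
    \<open>X\<close> are sent to the identity.\<close>
  let ?f = "\<lambda>x. if x \<in> X then ?D #>\<^bsub>F\<^esub> letter X x else \<one>\<^bsub>F Mod ?D\<^esub>"
  have "?D #>\<^bsub>F\<^esub> letter X x \<in> carrier (F Mod ?D)" if "x \<in> X" for x
    using letter_in[OF that] by (auto simp: carrier_FactGroup)
  then have "?f ` UNIV \<subseteq> carrier (F Mod ?D)" using Q.one_closed by (auto simp del: one_FactGroup)
  then obtain k where k: "k \<in> hom (free_Abelian_group UNIV) (F Mod ?D)" "\<And>x. k (frag_of x) = ?f x"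
    using Q.free_Abelian_group_universal[of ?f UNIV] by auto
  have hom1: "(\<lambda>u. k (\<pi> u)) \<in> hom F (F Mod ?D)"
    using k(1) by (auto simp: hom_def pi_mult)
  have "k (\<pi> u) = ?D #>\<^bsub>F\<^esub> u"
  proof (rule hom_eq_on_generate[OF group_free_group Q.is_group hom1 D.r_coset_hom_Mod letters])
    show "u \<in> generate F (letter X ` X)" using u(1) free_group_generated by blast
  qed (auto simp: pi_letter k(2))
  moreover have "k 0 = \<one>\<^bsub>F Mod ?D\<^esub>"
    using Group.hom_one[OF k(1)] Q.is_group by simp
  ultimately have "?D #>\<^bsub>F\<^esub> u = ?D" using u(2) by simp
  then show ?thesis using F.coset_join1[OF _ u(1) D.subgroup_axioms] by blast
qed

text \<open>Choose a section \<open>s\<close> of \<open>\<pi>\<close>. The class of \<open>s(p) u s(p + \<pi>(u))\<^sup>-\<^sup>1\<close> in \<open>F'/F''\<close> is the sum,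
  over the edges of the path that \<open>u\<close> traverses from \<open>p\<close> in the Cayley graph of \<open>\<int>\<^sup>X\<close>, of the
  classes of the edges, and \<open>act p (\<alpha> u)\<close> counts these edges with sign.\<close>

lemma kernel_h:
  assumes u: "u \<in> carrier F" "\<pi> u = 0" "\<alpha> u = 0"
  shows "u \<in> derived F (derived F (carrier F))"
proof -
  let ?N = "derived F (carrier F)"
  let ?D = "derived F ?N"
  let ?FN = "F\<lparr>carrier := ?N\<rparr>"
  have N: "subgroup ?N F" by (rule F.derived_is_subgroup) simp
  have NF: "u \<in> ?N \<Longrightarrow> u \<in> carrier F" for u using subgroup.subset[OF N] by blast
  have D: "subgroup ?D F" by (rule F.derived_is_subgroup[OF subgroup.subset[OF N]])
  interpret FN: group ?FN by (rule F.subgroup_imp_group[OF N])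
  have D_eq: "derived ?FN (carrier ?FN) = ?D" using F.derived_consistent[OF order.refl N] by simp
  interpret DN: normal ?D ?FN by (rule F.derived_subgroup_is_normal[OF N])
  interpret Q: comm_group "?FN Mod ?D" using FN.derived_quot_is_comm_group unfolding D_eq .
  define cls where "cls u = ?D #>\<^bsub>F\<^esub> u" for u
  have "cls = (\<lambda>u. ?D #>\<^bsub>?FN\<^esub> u)" by (simp add: cls_def r_coset_def fun_eq_iff)
  then have cls_hom: "cls \<in> hom ?FN (?FN Mod ?D)" using DN.r_coset_hom_Mod by metis
  have cls_in: "u \<in> ?N \<Longrightarrow> cls u \<in> carrier (?FN Mod ?D)" for u
    using Group.hom_in_carrier[OF cls_hom, of u] by simp
  have cls_mult: "u \<in> ?N \<Longrightarrow> v \<in> ?N \<Longrightarrow> cls (u \<otimes>\<^bsub>F\<^esub> v) = cls u \<otimes>\<^bsub>?FN Mod ?D\<^esub> cls v" for u v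
    using Group.hom_mult[OF cls_hom, of u v] by simp
  have cls_one: "cls \<one>\<^bsub>F\<^esub> = \<one>\<^bsub>?FN Mod ?D\<^esub>"
    using Group.hom_one[OF cls_hom FN.is_group Q.is_group] by simp
  \<comment> \<open>Normalising \<open>s 0\<close> to the identity gives
    \<open>\<beta> 0 u = u\<close> on the kernel of \<open>\<pi>\<close>.\<close>
  define s where "s q = (if q = 0 then \<one>\<^bsub>F\<^esub> else SOME u. u \<in> carrier F \<and> \<pi> u = q)" for q
  have s: "s (\<pi> v) \<in> carrier F \<and> \<pi> (s (\<pi> v)) = \<pi> v" if "v \<in> carrier F" for v
  proof (cases "\<pi> v = 0")
    case False
    have "(SOME u. u \<in> carrier F \<and> \<pi> u = \<pi> v) \<in> carrier F \<and> \<pi> (SOME u. u \<in> carrier F \<and> \<pi> u = \<pi> v) = \<pi> v"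
      by (rule someI[of _ v]) (use that in simp)
    then show ?thesis using False by (simp add: s_def)
  qed (simp add: s_def pi_one)
  \<comment> \<open>The vertices over which \<open>s\<close> is a section. Paths starting in
    \<open>I\<close> stay in \<open>I\<close>, and edges from other vertices will get the trivial
    class.\<close>
  define I where "I = \<pi> ` carrier F"
  have s_in: "p \<in> I \<Longrightarrow> s p \<in> carrier F" and pi_s: "p \<in> I \<Longrightarrow> \<pi> (s p) = p" for p
    using s by (auto simp: I_def)
  have I_add: "p + \<pi> u \<in> I" if p: "p \<in> I" "u \<in> carrier F" for p u
  proof -
    obtain v where "v \<in> carrier F" "p = \<pi> v" using p(1) by (auto simp: I_def)
    then show ?thesis using p(2) unfolding I_def by (intro image_eqI[of _ _ "v \<otimes>\<^bsub>F\<^esub> u"]) (auto simp: pi_mult)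
  qed
  define \<beta> where "\<beta> p u = s p \<otimes>\<^bsub>F\<^esub> u \<otimes>\<^bsub>F\<^esub> inv\<^bsub>F\<^esub> (s (p + \<pi> u))" for p u
  have beta_N: "\<beta> p u \<in> ?N" if "p \<in> I" "u \<in> carrier F" for p u
    unfolding \<beta>_def
    by (rule kernel_pi) (use that s_in I_add pi_s in \<open>simp_all add: pi_mult pi_inv\<close>)
  have beta_mult: "\<beta> p (u \<otimes>\<^bsub>F\<^esub> v) = \<beta> p u \<otimes>\<^bsub>F\<^esub> \<beta> (p + \<pi> u) v"
    if p: "p \<in> I" "u \<in> carrier F" "v \<in> carrier F" for p u v
  proof -
    note c = s_in[OF p(1)] s_in[OF I_add[OF p(1,2)]] s_in[OF I_add[OF I_add[OF p(1,2)] p(3)]] p(2,3)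
    have cancel: "inv\<^bsub>F\<^esub> b \<otimes>\<^bsub>F\<^esub> (b \<otimes>\<^bsub>F\<^esub> w) = w" if "b \<in> carrier F" "w \<in> carrier F" for b w
      using that by (simp add: F.m_assoc[symmetric])
    show ?thesis
      unfolding \<beta>_def using c by (simp add: pi_mult F.m_assoc cancel add.assoc)
  qed
  have "\<exists>k. k \<in> hom (free_Abelian_group UNIV) (?FN Mod ?D) \<and>
      (\<forall>q. k (frag_of q) = (if q \<in> I then cls (\<beta> q (letter X x)) else \<one>\<^bsub>?FN Mod ?D\<^esub>))" if x: "x \<in> X" for x
  proof -
    let ?f = "\<lambda>q. if q \<in> I then cls (\<beta> q (letter X x)) else \<one>\<^bsub>?FN Mod ?D\<^esub>"
    have "?f ` UNIV \<subseteq> carrier (?FN Mod ?D)"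
      using cls_in[OF beta_N[OF _ letter_in[OF x]]] Q.one_closed by (auto simp del: one_FactGroup)
    then show ?thesis by (rule Q.free_Abelian_group_universal) blast
  qed
  then obtain k where k: "\<And>x. x \<in> X \<Longrightarrow> k x \<in> hom (free_Abelian_group UNIV) (?FN Mod ?D)"
    "\<And>x q. x \<in> X \<Longrightarrow> q \<in> I \<Longrightarrow> k x (frag_of q) = cls (\<beta> q (letter X x))" by metis
  have k_in: "x \<in> X \<Longrightarrow> k x f \<in> carrier (?FN Mod ?D)" for x f using Group.hom_in_carrier[OF k(1), of x f] by simp
  have k_add: "x \<in> X \<Longrightarrow> k x (f + g) = k x f \<otimes>\<^bsub>?FN Mod ?D\<^esub> k x g" for x f g
    using Group.hom_mult[OF k(1), of x f g] by simp
  have k_0: "x \<in> X \<Longrightarrow> k x 0 = \<one>\<^bsub>?FN Mod ?D\<^esub>" for x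
    using Group.hom_one[OF k(1), of x] Q.is_group by simp
  \<comment> \<open>The unit vector at \<open>x\<close> with entry \<open>frag_of q\<close> is the
    edge labelled \<open>x\<close> that leaves \<open>q\<close>. \<open>\<Psi>\<close> extends the
    classes of edges additively to all vectors.\<close>
  define \<Psi> where "\<Psi> v = finprod (?FN Mod ?D) (\<lambda>x. k x (v x)) X" for v
  have Psi_in: "\<Psi> v \<in> carrier (?FN Mod ?D)" for v unfolding \<Psi>_def by (rule Q.finprod_closed) (use k_in in auto)
  have Psi_add: "\<Psi> (v + w) = \<Psi> v \<otimes>\<^bsub>?FN Mod ?D\<^esub> \<Psi> w" for v w
  proof -
    have "\<Psi> (v + w) = finprod (?FN Mod ?D) (\<lambda>x. k x (v x) \<otimes>\<^bsub>?FN Mod ?D\<^esub> k x (w x)) X"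
      unfolding \<Psi>_def by (rule Q.finprod_cong') (use k_in k_add in \<open>auto simp del: mult_FactGroup\<close>)
    also have "\<dots> = \<Psi> v \<otimes>\<^bsub>?FN Mod ?D\<^esub> \<Psi> w"
      unfolding \<Psi>_def by (rule Q.finprod_multf) (use k_in in auto)
    finally show ?thesis .
  qed
  have Psi_0: "\<Psi> 0 = \<one>\<^bsub>?FN Mod ?D\<^esub>"
    using Psi_add[of 0 0] Psi_in[of 0] by (metis Q.l_cancel_one' add_0)
  have Psi_letter: "\<Psi> (0(x := frag_of p)) = cls (\<beta> p (letter X x))" if x: "x \<in> X" and p: "p \<in> I" for x p
  proof -
    have "\<Psi> (0(x := frag_of p)) = finprod (?FN Mod ?D) (\<lambda>y. if x = y then k y (frag_of p) else \<one>\<^bsub>?FN Mod ?D\<^esub>) X"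
      unfolding \<Psi>_def by (rule Q.finprod_cong') (use k_in k_0 Q.one_closed in \<open>auto simp del: one_FactGroup\<close>)
    also have "\<dots> = k x (frag_of p)"
      by (rule Q.finprod_singleton[OF x finite_X]) (use k_in in auto)
    finally show ?thesis using k(2) x p by simp
  qed
  have "\<forall>p\<in>I. \<Psi> (act p (\<alpha> u)) = cls (\<beta> p u)" if "u \<in> carrier F" for u
    using that
  proof (induction u rule: free_group_induct)
    case one
    have "\<beta> p \<one>\<^bsub>F\<^esub> = \<one>\<^bsub>F\<^esub>" if "p \<in> I" for p using s_in[OF that] by (simp add: \<beta>_def pi_one)
    then show ?case unfolding alpha_one act_zero Psi_0 using cls_one by metis
  next
    case (letter x)
    have "act p (0(x := 1)) = 0(x := frag_of p)" for p by (auto simp: fun_eq_iff act_apply)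
    then show ?case using Psi_letter letter unfolding alpha_letter[OF letter] by metis
  next
    case (inv x)
    let ?l = "letter X x"
    note l = letter_in[OF inv]
    have li: "inv\<^bsub>F\<^esub> ?l \<in> carrier F" using l by simp
    show ?case
    proof
      fix p assume p: "p \<in> I"
      let ?p = "p + \<pi> (inv\<^bsub>F\<^esub> ?l)"
      have p': "?p \<in> I" by (rule I_add[OF p li])
      have act1: "act ?p (0(x := 1)) = 0(x := frag_of ?p)" by (auto simp: fun_eq_iff act_apply)
      have eq: "\<Psi> (act ?p (\<alpha> ?l)) = cls (\<beta> ?p ?l)"
        unfolding alpha_letter[OF inv] act1 by (rule Psi_letter[OF inv p'])
      \<comment> \<open>An inverse letter runs along its edge backwards: both sides of the claim are
        inverse to the class of the edge that leaves \<open>?p\<close>.\<close>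
      have "\<beta> p (inv\<^bsub>F\<^esub> ?l \<otimes>\<^bsub>F\<^esub> ?l) = \<one>\<^bsub>F\<^esub>" using s_in[OF p] l by (simp add: \<beta>_def pi_one)
      then have "cls (\<beta> p (inv\<^bsub>F\<^esub> ?l)) \<otimes>\<^bsub>?FN Mod ?D\<^esub> cls (\<beta> ?p ?l) = \<one>\<^bsub>?FN Mod ?D\<^esub>"
        using beta_mult[OF p li l] cls_mult[OF beta_N[OF p li] beta_N[OF p' l]] cls_one by metis
      moreover have "act p (\<alpha> (inv\<^bsub>F\<^esub> ?l)) + act ?p (\<alpha> ?l) = 0"
        using l by (simp add: alpha_inv pi_inv act_uminus act_act)
      then have "\<Psi> (act p (\<alpha> (inv\<^bsub>F\<^esub> ?l))) \<otimes>\<^bsub>?FN Mod ?D\<^esub> cls (\<beta> ?p ?l) = \<one>\<^bsub>?FN Mod ?D\<^esub>"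
        using Psi_add Psi_0 eq by metis
      ultimately show "\<Psi> (act p (\<alpha> (inv\<^bsub>F\<^esub> ?l))) = cls (\<beta> p (inv\<^bsub>F\<^esub> ?l))"
        using Q.right_cancel Psi_in cls_in beta_N p li p' l by metis
    qed
  next
    case (mult u v)
    show ?case
    proof
      fix p assume p: "p \<in> I"
      note p' = I_add[OF p mult.hyps(1)]
      have "act p (\<alpha> (u \<otimes>\<^bsub>F\<^esub> v)) = act p (\<alpha> u) + act (p + \<pi> u) (\<alpha> v)"
        using mult.hyps by (simp add: alpha_mult act_add act_act)
      then have "\<Psi> (act p (\<alpha> (u \<otimes>\<^bsub>F\<^esub> v))) = cls (\<beta> p u) \<otimes>\<^bsub>?FN Mod ?D\<^esub> cls (\<beta> (p + \<pi> u) v)"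
        using Psi_add mult.IH p p' by metis
      also have "\<dots> = cls (\<beta> p (u \<otimes>\<^bsub>F\<^esub> v))"
        unfolding beta_mult[OF p mult.hyps]
        by (rule cls_mult[symmetric]) (intro beta_N p p' mult.hyps)+
      finally show "\<Psi> (act p (\<alpha> (u \<otimes>\<^bsub>F\<^esub> v))) = cls (\<beta> p (u \<otimes>\<^bsub>F\<^esub> v))" .
    qed
  qed
  \<comment> \<open>Started at the base point, the closed path of \<open>u\<close> has class
    \<open>cls u\<close>, while its signed edge count \<open>\<alpha> u\<close> is zero.\<close>
  moreover have I0: "0 \<in> I" unfolding I_def using pi_one by (intro image_eqI[of _ _ "\<one>\<^bsub>F\<^esub>"]) auto
  ultimately have "cls (\<beta> 0 u) = \<one>\<^bsub>?FN Mod ?D\<^esub>" using u(1,3) Psi_0 act_zero by metis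
  moreover have "\<beta> 0 u = u" using u by (simp add: \<beta>_def s_def)
  ultimately have "?D #>\<^bsub>F\<^esub> u = ?D" by (simp add: cls_def)
  then show ?thesis using F.coset_join1[OF _ u(1) D] by blast
qed

lemma kernel_h_eq: "kernel F wreath h = derived F (derived F (carrier F))"
proof
  show "kernel F wreath h \<subseteq> derived F (derived F (carrier F))"
    using kernel_h by (auto simp: kernel_def \<pi>_def \<alpha>_def)
  have sub: "derived F (carrier F) \<subseteq> carrier F" by (rule F.derived_in_carrier) simp
  have "h ` derived F (derived F (carrier F)) = derived wreath (derived wreath (h ` carrier F))"
    using derived_img[OF sub] derived_img[OF order.refl] by simp
  then have "h ` derived F (derived F (carrier F)) \<subseteq> {\<one>\<^bsub>wreath\<^esub>}" using derived_wreath by metis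
  then show "derived F (derived F (carrier F)) \<subseteq> kernel F wreath h"
    using F.derived_in_carrier[OF sub] by (auto simp: kernel_def)
qed

lemma LERF_quotient: "LERF (F Mod derived F (derived F (carrier F)))"
proof -
  let ?N = "derived F (derived F (carrier F))"
  let ?Q = "F Mod ?N"
  have normal: "?N \<lhd> F" using normal_kernel by (simp add: kernel_h_eq)
  interpret N: normal ?N F by (rule normal)
  obtain g where g: "g \<in> hom ?Q wreath" "\<And>u. u \<in> carrier F \<Longrightarrow> g (?N #>\<^bsub>F\<^esub> u) = h u"
    using FactGroup_universal_kernel[OF normal] kernel_h_eq by auto
  have Q: "group ?Q" by (rule N.factorgroup_is_group)
  have Q_cases: "\<exists>u\<in>carrier F. x = ?N #>\<^bsub>F\<^esub> u" if "x \<in> carrier ?Q" for x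
    using that by (auto simp: carrier_FactGroup)
  have g_mult: "g (x \<otimes>\<^bsub>?Q\<^esub> y) = (fst (g x) + act (snd (g x)) (fst (g y)), snd (g x) + snd (g y))"
    if "x \<in> carrier ?Q" "y \<in> carrier ?Q" for x y
    using Group.hom_mult[OF g(1) that] by (cases "g x"; cases "g y") simp
  interpret M: magnus_rep ?Q X "\<lambda>x. snd (g x)" "\<lambda>x. fst (g x)"
  proof (intro magnus_rep.intro Q magnus_rep_axioms.intro finite_X)
    fix x assume x: "x \<in> carrier ?Q"
    then obtain u where u: "u \<in> carrier F" "x = ?N #>\<^bsub>F\<^esub> u" using Q_cases by blast
    show "Poly_Mapping.keys (snd (g x)) \<subseteq> X" using keys_pi[OF u(1)] g(2) u by (simp add: \<pi>_def)
    show "fst (g x) \<in> supported X {0} {q. Poly_Mapping.keys q \<subseteq> X}"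
      using supported_alpha[OF u(1)] g(2) u by (simp add: \<alpha>_def)
    show "x = \<one>\<^bsub>?Q\<^esub>" if "snd (g x) = 0" "fst (g x) = 0"
    proof -
      have "u \<in> ?N" using kernel_h[OF u(1)] that g(2) u by (simp add: \<pi>_def \<alpha>_def)
      then show ?thesis using u F.coset_join2[OF u(1) N.subgroup_axioms] by simp
    qed
  qed (simp_all only: g_mult fst_conv snd_conv)
  interpret c: group_hom F ?Q "(#>\<^bsub>F\<^esub>) ?N"
    using N.r_coset_hom_Mod Q by (simp add: group_hom_def group_hom_axioms_def group_free_group)
  have "generate ?Q ((#>\<^bsub>F\<^esub>) ?N ` letter X ` X) = carrier ?Q"
    using c.generate_img[OF letters] free_group_generated[of X] by (simp add: carrier_FactGroup)
  moreover have "(#>\<^bsub>F\<^esub>) ?N ` letter X ` X \<subseteq> carrier ?Q" using letters by (auto simp: carrier_FactGroup)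
  ultimately have "fg_subgroup (carrier ?Q) ?Q"
    unfolding fg_subgroup_def using finite_X by (metis finite_imageI)
  then show ?thesis by (rule M.LERF_if_finitely_generated)
qed

end

theorem corollary4:
  fixes X :: "'a set" and n :: nat
  assumes "finite X" and "card X = n"
  shows "LERF (free_group X Mod
           derived (free_group X) (derived (free_group X) (carrier (free_group X))))"
proof -
  obtain h where h: "h \<in> hom (free_group X) wreath" "\<forall>x\<in>X. h (letter X x) = (0(x := 1), frag_of x)"
    using free_group_universal[OF group_wreath, of "\<lambda>x. (0(x := 1), frag_of x)" X] by auto
  interpret magnus_hom X h
    by unfold_locales (use assms(1) h in auto)
  show ?thesis by (rule LERF_quotient)
qed

end
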